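(* Let $Z_n$ and $\overline{Z}_n$ be the regions defined in the context and $\operatorname{T}$ the number of tilings. (a) For every integer $m\ge 0$: $\operatorname{T}(Z_{12m})=3^{48m^2}$, $\operatorname{T}(Z_{12m+1})=3^{48m^2+8m}$, $\operatorname{T}(Z_{12m+2})=3^{48m^2+16m+1}$, $\operatorname{T}(Z_{12m+3})=3^{48m^2+24m+3}$, $\operatorname{T}(Z_{12m+4})=2\cdot3^{48m^2+32m+5}$, $\operatorname{T}(Z_{12m+5})=2\cdot3^{48m^2+40m+8}$, $\operatorname{T}(Z_{12m+6})=3^{48m^2+48m+12}$, $\operatorname{T}(Z_{12m+7})=3^{48m^2+56m+16}$, $\operatorname{T}(Z_{12m+8})=3^{48m^2+64m+21}$, $\operatorname{T}(Z_{12m+9})=3^{48m^2+72m+27}$, $\operatorname{T}(Z_{12m+10})=2\cdot3^{48m^2+80m+33}$, $\operatorname{T}(Z_{12m+11})=2\cdot3^{48m^2+88m+40}$. (b) For every integer $m\ge0$: $\operatorname{T}(\overline{Z}_{3m})=\operatorname{T}(Z_{3m})$, $\operatorname{T}(\overline{Z}_{6m+1})=2\operatorname{T}(Z_{6m+1})$, $\operatorname{T}(\overline{Z}_{6m+2})=2\operatorname{T}(Z_{6m+2})$, $\operatorname{T}(\overline{Z}_{6m+4})=\tfrac12\operatorname{T}(Z_{6m+4})$, $\operatorname{T}(\overline{Z}_{6m+5})=\tfrac12\operatorname{T}(Z_{6m+5})$.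
   Context: Tilings: given a subdivision of the plane into elementary regions, a tile is the union of two elementary regions sharing an edge; a tiling of a region (finite connected union of elementary regions) is a covering of it by tiles without gaps or overlaps; $\operatorname{T}(R)$ is the number of tilings of $R$. The lattice: the unit square lattice with, for each integer $k$, the zigzag path drawn in through the points $\dots,(0,2k),(1,2k+1),(2,2k),(3,2k+1),\dots$ (consecutive points joined by straight unit-square diagonals). So exactly the unit squares in the horizontal strips $2k\le y\le 2k+1$ are cut by a diagonal. The lower vertices of the zigzags (such as $(0,0)$) are the down-pointing vertices. Arrows denote steps: $\uparrow=(0,1)$, $\downarrow=(0,-1)$, $\rightarrow=(1,0)$, $\nearrow=(1,1)$, $\searrow=(1,-1)$. For $n\ge1$ let $A=(0,0)$ and let $\ell$ be the line $x=n$. $Z_n$: the northwestern boundary starts at $A$ and follows steps periodically with period $\langle\uparrow,\rightarrow,\uparrow,\rightarrow,\nearrow,\rightarrow,\uparrow\rangle$ until it first reaches $\ell$; the southwestern boundary starts at $A$ and follows the period $\langle\rightarrow,\downarrow,\downarrow,\rightarrow,\downarrow,\rightarrow,\searrow\rangle$ until it first reaches $\ell$. The northeastern and southeastern boundaries are the reflections of these two paths in $\ell$. $Z_n$ is the region enclosed by the four paths. $\overline{Z}_n$: the same construction with the northwestern period $\langle\nearrow,\rightarrow,\uparrow,\rightarrow,\uparrow,\uparrow,\rightarrow\rangle$ and the southwestern period $\langle\downarrow,\rightarrow,\searrow,\rightarrow,\downarrow,\rightarrow,\downarrow\rangle$. Convention: $Z_0$ and $\overline{Z}_0$ are empty and $\operatorname{T}(Z_0)=\operatorname{T}(\overline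 Z_0)=1$. *)

theory Defs
  imports Complex_Main "HOL-Library.Disjoint_Sets" "HOL-Library.Product_Plus"
begin

type_synonym point = "int \<times> int"
type_synonym edge = "point set"

text \<open>An elementary region is represented by the set of its boundary edges, an edge being the
  set of its two endpoints. Two distinct elementary regions share an edge iff these sets meet.\<close>

type_synonym cell = "edge set"

definition polygon :: "point list \<Rightarrow> cell" where
  "polygon vs = {{vs ! i, vs ! (Suc i mod length vs)} | i. i < length vs}"

text \<open>The unit squares in the strips between the lines \<open>y = 2k\<close> and \<open>y = 2k + 1\<close> are cut by the
  zigzag with lower vertices \<open>(2j, 2k)\<close>: its diagonals rise in columns starting at even \<open>x\<close> and
  fall in columns starting at odd \<open>x\<close>. The squares in the other strips are not cut.\<close>

definition cells :: "cell set" where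
  "cells =
     {polygon [(x, y), (x + 1, y), (x + 1, y + 1), (x, y + 1)] | x y. odd y}
   \<union> {polygon [(x, y), (x + 1, y), (x + 1, y + 1)] | x y. even y \<and> even x}
   \<union> {polygon [(x, y), (x + 1, y + 1), (x, y + 1)] | x y. even y \<and> even x}
   \<union> {polygon [(x, y), (x + 1, y), (x, y + 1)] | x y. even y \<and> odd x}
   \<union> {polygon [(x + 1, y), (x + 1, y + 1), (x, y + 1)] | x y. even y \<and> odd x}"

text \<open>A region is a set of elementary regions, and a tile is the set of its two constituents.\<close>

definition is_tile :: "cell set \<Rightarrow> bool" where
  "is_tile t \<longleftrightarrow> (\<exists>c\<in>cells. \<exists>d\<in>cells. c \<noteq> d \<and> c \<inter> d \<noteq> {} \<and> t = {c, d})"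

definition tilings :: "cell set \<Rightarrow> cell set set set" where
  "tilings R = {P. partition_on R P \<and> (\<forall>t\<in>P. is_tile t)}"

definition T :: "cell set \<Rightarrow> nat" where
  "T R = card (tilings R)"

lemma T_empty: "T {} = 1"
proof -
  have "tilings {} = {{}}"
    by (auto simp: tilings_def partition_on_def)
  then show ?thesis
    by (simp add: T_def)
qed

text \<open>The elementary regions enclosed by a set \<open>B\<close> of lattice edges are those in the bounded
  connected components of the plane minus \<open>B\<close>. The elementary regions in the component of \<open>c\<close>
  are those reachable from \<open>c\<close> by crossing edges that are not in \<open>B\<close>, and the component is
  bounded iff there are finitely many of them.\<close>

definition crossing :: "edge set \<Rightarrow> (cell \<times> cell) set" where
  "crossing B = {(c, d). c \<in> cells \<and> d \<in> cells \<and> c \<noteq> d \<and> (\<exists>e. e \<in> c \<and> e \<in> d \<and> e \<notin> B)}"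

definition enclosed :: "edge set \<Rightarrow> cell set" where
  "enclosed B = {c \<in> cells. finite ((crossing B)\<^sup>* `` {c})}"

datatype arrow = North | South | East | NorthEast | SouthEast

fun step :: "arrow \<Rightarrow> point" where
  "step North = (0, 1)"
| "step South = (0, -1)"
| "step East = (1, 0)"
| "step NorthEast = (1, 1)"
| "step SouthEast = (1, -1)"

text \<open>The point reached from \<open>A = (0, 0)\<close> after \<open>k\<close> steps, repeating the period \<open>w\<close>.\<close>

definition path_point :: "arrow list \<Rightarrow> nat \<Rightarrow> point" where
  "path_point w k = (\<Sum>i<k. step (w ! (i mod length w)))"

text \<open>The edges traversed from \<open>A\<close> until the line \<open>x = n\<close> is first reached.\<close>

definition path_edges :: "arrow list \<Rightarrow> nat \<Rightarrow> edge set" where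
  "path_edges w n =
     {{path_point w i, path_point w (Suc i)} | i. i < (LEAST k. fst (path_point w k) = int n)}"

definition reflect :: "nat \<Rightarrow> point \<Rightarrow> point" where
  "reflect n p = (2 * int n - fst p, snd p)"

definition region :: "arrow list \<Rightarrow> arrow list \<Rightarrow> nat \<Rightarrow> cell set" where
  "region nw sw n =
     (if n = 0 then {}
      else let W = path_edges nw n \<union> path_edges sw n
           in enclosed (W \<union> (\<lambda>e. reflect n ` e) ` W))"

definition Z :: "nat \<Rightarrow> cell set" where
  "Z = region
     [North, East, North, East, NorthEast, East, North]
     [East, South, South, East, South, East, SouthEast]"

definition Zbar :: "nat \<Rightarrow> cell set" where
  "Zbar = region
     [NorthEast, East, North, East, North, North, East]
     [South, East, SouthEast, East, South, East, South]"

end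

(* The dual graph of the lattice is a crosses-and-wrenches graph: placing the lattice vertices (x, y)
   on suitable heights in {0, 1, 2} of period 4 in y, T(Z_n) is a value of the octahedron recurrence
   with initial values 1. Concretely, urban renewal at the degree 4 vertices of one height contracts
   all diagonals and turns the region, up to forced tiles and a power of 2, into the Aztec diamond of
   order n whose edge weights (1 or 1/2) depend only on y mod 4. Three rounds of urban renewal on the
   whole Aztec diamond lower its order by 3 and exchange the weights of Z with those of Zbar, which
   gives T(Z_(n+3)) = 3^(2n+3) T(Zbar_n) and T(Zbar_(n+3)) = 3^(2n+3) T(Z_n).
   Urban renewal is done at all cells simultaneously: a matching sum is split according to the set of
   vertices covered inside each 4-cycle, and the 4-cycle is self-complementary up to reweighting. *)

theory Submission
  imports Defs "HOL-Library.FuncSet"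
begin

section \<open>Matching sums decomposed into cells\<close>

text \<open>Nothing is inserted into or removed from the graph during renewal; only the record of
  covered vertices changes. A vertex of two cells is covered in exactly one of them, hence after
  complementation in exactly the other, while a vertex of a single cell switches between present and
  absent. The rim of the Aztec diamond consists of the latter, so a round lowers the order by one.
  The lattice points with odd coordinate sum carry no diagonal, so the four elementary regions
  around each form a 4-cycle, and every diagonal joins a triangle of such a cell at an even height
  to one at the odd height above. Renewing exactly one of these heights makes the diagonal
  contractible, and a square between two cells must be complemented in both or in neither. This
  leaves two sets of heights, complementary and of period 4; they produce the boundaries of
  \<open>Z\<close> and \<open>Zbar\<close>. With \<open>g = 2\<close> at the heights kept and
  \<open>g = 1\<close> at the renewed ones, \<open>g (y + 2) = 2 / g y\<close> makes the
  denominators of the three rounds monomials in \<open>g\<close>; the constants \<open>3 / 2\<close>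
  and \<open>2 / 3\<close> of the last two supply the power of 3.\<close>

definition pm :: "'v set \<Rightarrow> 'v set set \<Rightarrow> 'v set set set" where
  "pm V E = {P. partition_on V P \<and> P \<subseteq> E}"

definition msum :: "'v set \<Rightarrow> 'v set set \<Rightarrow> ('v set \<Rightarrow> real) \<Rightarrow> real" where
  "msum V E w = (\<Sum>P\<in>pm V E. \<Prod>e\<in>P. w e)"

text \<open>A family \<open>S\<close> records for each cell the set of vertices that a matching covers by edges of
  that cell.\<close>

definition fam :: "'c set \<Rightarrow> ('c \<Rightarrow> 'v set) \<Rightarrow> 'v set \<Rightarrow> ('c \<Rightarrow> 'v set) set" where
  "fam C U V = {S \<in> PiE C (\<lambda>c. Pow (U c)). \<forall>v. card {c \<in> C. v \<in> S c} = of_bool (v \<in> V)}"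

text \<open>A contraction of local weights. A cell enters only through the dependence of its weight
  on the set of vertices it covers, so cells can be exchanged for others with the same
  dependence.\<close>

definition net ::
    "'c set \<Rightarrow> ('c \<Rightarrow> 'v set) \<Rightarrow> ('c \<Rightarrow> 'v set \<Rightarrow> real) \<Rightarrow> 'v set \<Rightarrow> real" where
  "net C U \<phi> V = (\<Sum>S\<in>fam C U V. \<Prod>c\<in>C. \<phi> c (S c))"

lemma pm_cong:
  assumes "\<And>e. e \<subseteq> V \<Longrightarrow> e \<in> E \<longleftrightarrow> e \<in> E'"
  shows "pm V E = pm V E'"
proof -
  have "P \<subseteq> E \<longleftrightarrow> P \<subseteq> E'" if "partition_on V P" for P
    using that assms unfolding partition_on_def by blast
  then show ?thesis
    unfolding pm_def by blast
qed

lemma msum_cong: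
  assumes "\<And>e. e \<subseteq> V \<Longrightarrow> e \<in> E \<longleftrightarrow> e \<in> E'"
  shows "msum V E w = msum V E' w"
  using pm_cong[of V E E'] assms by (simp add: msum_def)

lemma finite_pm: "finite V \<Longrightarrow> finite (pm V E)"
  by (rule finite_subset[OF _ finitely_many_partition_on]) (auto simp: pm_def)

lemma net_cong:
  assumes "\<And>c S. c \<in> C \<Longrightarrow> S \<subseteq> U c \<Longrightarrow> \<phi> c S = \<psi> c S"
  shows "net C U \<phi> V = net C U \<psi> V"
  unfolding net_def
  by (intro sum.cong prod.cong refl) (use assms in \<open>auto simp: fam_def PiE_def Pi_def\<close>)

lemma net_scale:
  "net C U (\<lambda>c S. k c * \<phi> c S) V = (\<Prod>c\<in>C. k c) * net C U \<phi> V"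
  by (simp add: net_def prod.distrib sum_distrib_left)

section \<open>Complementing, renaming and removing vertices in a net\<close>

definition toggle :: "'v set \<Rightarrow> 'v set \<Rightarrow> 'v set \<Rightarrow> 'v set" where
  "toggle K A S = (S - K) \<union> (A \<inter> K - S)"

lemma toggle_toggle: "S \<subseteq> A \<Longrightarrow> toggle K A (toggle K A S) = S"
  by (auto simp: toggle_def)

text \<open>At a vertex of \<open>K\<close> the cells that cover it afterwards are those that
  contain it and did not cover it before. The count in the hypothesis is chosen so that their number
  is the indicator of \<open>V'\<close>.\<close>

lemma toggle_fam:
  assumes "finite C" and S: "S \<in> fam C U V"
    and K: "\<And>v. v \<in> K \<Longrightarrow> card {c \<in> C. v \<in> U c} = of_bool (v \<in> V) + of_bool (v \<in> V')"
    and nK: "\<And>v. v \<notin> K \<Longrightarrow> v \<in> V \<longleftrightarrow> v \<in> V'"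
  shows "(\<lambda>c\<in>C. toggle K (U c) (S c)) \<in> fam C U V'"
proof -
  have sub: "S c \<subseteq> U c" if "c \<in> C" for c
    using S that by (auto simp: fam_def PiE_def Pi_def)
  have card: "card {c \<in> C. v \<in> S c} = of_bool (v \<in> V)" for v
    using S by (simp add: fam_def)
  have "card {c \<in> C. v \<in> (\<lambda>c\<in>C. toggle K (U c) (S c)) c} = of_bool (v \<in> V')" for v
  proof (cases "v \<in> K")
    case True
    have "{c \<in> C. v \<in> (\<lambda>c\<in>C. toggle K (U c) (S c)) c} = {c \<in> C. v \<in> U c} - {c \<in> C. v \<in> S c}"
      using True by (auto simp: toggle_def)
    moreover have "{c \<in> C. v \<in> S c} \<subseteq> {c \<in> C. v \<in> U c}"
      using sub by blast
    ultimately show ?thesis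
      using K[OF True] card[of v] \<open>finite C\<close> by (simp add: card_Diff_subset)
  next
    case False
    then have "{c \<in> C. v \<in> (\<lambda>c\<in>C. toggle K (U c) (S c)) c} = {c \<in> C. v \<in> S c}"
      by (auto simp: toggle_def)
    then show ?thesis
      using nK[OF False] card[of v] by simp
  qed
  moreover have "toggle K (U c) (S c) \<subseteq> U c" if "c \<in> C" for c
    using sub[OF that] by (auto simp: toggle_def)
  ultimately show ?thesis
    by (auto simp: fam_def)
qed

text \<open>Toggling is an involution and its hypothesis is symmetric in \<open>V\<close> and
  \<open>V'\<close>, so it is a bijection between the two sets of families. This performs urban
  renewal at all cells at once, provided that each local weight can be rewritten in terms of the
  complement.\<close>

lemma net_toggle:
  assumes fin: "finite C"
    and K: "\<And>v. v \<in> K \<Longrightarrow> card {c \<in> C. v \<in> U c} = of_bool (v \<in> V) + of_bool (v \<in> V')"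
    and nK: "\<And>v. v \<notin> K \<Longrightarrow> v \<in> V \<longleftrightarrow> v \<in> V'"
    and \<phi>: "\<And>c S. c \<in> C \<Longrightarrow> S \<subseteq> U c \<Longrightarrow> \<phi> c S = \<psi> c (toggle K (U c) S)"
  shows "net C U \<phi> V = net C U \<psi> V'"
proof -
  have sub: "S c \<subseteq> U c" if "c \<in> C" "S \<in> fam C U W" for S W c
    using that by (auto simp: fam_def PiE_def Pi_def)
  have ext: "S c = undefined" if "c \<notin> C" "S \<in> fam C U W" for S W c
    using that by (auto simp: fam_def PiE_def extensional_def)
  have invol: "(\<lambda>c\<in>C. toggle K (U c) ((\<lambda>c\<in>C. toggle K (U c) (S c)) c)) = S"
    if "S \<in> fam C U W" for S W
    using sub[OF _ that] ext[OF _ that] by (auto simp: fun_eq_iff toggle_toggle restrict_def)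
  show ?thesis
    unfolding net_def
  proof (rule sum.reindex_bij_witness[where i = "\<lambda>S. \<lambda>c\<in>C. toggle K (U c) (S c)"
        and j = "\<lambda>S. \<lambda>c\<in>C. toggle K (U c) (S c)"], goal_cases)
    case (2 S)
    then show ?case
      using toggle_fam[OF fin _ K nK] by blast
  next
    case (4 S)
    then show ?case
      using toggle_fam[OF fin, of S U V' K V] K nK by (simp add: add.commute)
  next
    case (5 S)
    show ?case
      by (intro prod.cong refl) (use sub[OF _ 5] \<phi> in simp)
  qed (use invol in blast)+
qed

lemma net_image:
  assumes "inj j"
  shows "net C (\<lambda>c. j ` U c) \<phi> (j ` V) = net C U (\<lambda>c S. \<phi> c (j ` S)) V"
  unfolding net_def
proof (rule sum.reindex_bij_witness[where i = "\<lambda>S. \<lambda>c\<in>C. j ` S c"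
      and j = "\<lambda>S. \<lambda>c\<in>C. j -` S c"], goal_cases)
  case (1 S)
  then have "S c \<subseteq> j ` U c" if "c \<in> C" for c
    using that by (auto simp: fam_def PiE_def Pi_def)
  moreover have "S c = undefined" if "c \<notin> C" for c
    using 1 that by (auto simp: fam_def PiE_def extensional_def)
  ultimately show ?case
    by (auto simp: fun_eq_iff restrict_def image_vimage_eq) blast+
next
  case (2 S)
  have "{c \<in> C. v \<in> (\<lambda>c\<in>C. j -` S c) c} = {c \<in> C. j v \<in> S c}" for v
    by auto
  then have "card {c \<in> C. v \<in> (\<lambda>c\<in>C. j -` S c) c} = of_bool (v \<in> V)" for v
    using 2 assms by (auto simp: fam_def inj_image_mem_iff)
  moreover have "S c \<subseteq> j ` U c" if "c \<in> C" for c
    using 2 that by (auto simp: fam_def PiE_def Pi_def)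
  then have "j -` S c \<subseteq> U c" if "c \<in> C" for c
    using that inj_image_mem_iff[OF assms] by blast
  ultimately show ?case
    by (auto simp: fam_def)
next
  case (3 S)
  then have "S c = undefined" if "c \<notin> C" for c
    using that by (auto simp: fam_def PiE_def extensional_def)
  then show ?case
    using assms by (auto simp: fun_eq_iff restrict_def inj_vimage_image_eq)
next
  case (4 S)
  have "card {c \<in> C. v \<in> (\<lambda>c\<in>C. j ` S c) c} = of_bool (v \<in> j ` V)" for v
  proof (cases "v \<in> range j")
    case True
    then obtain u where u: "v = j u" by blast
    have "{c \<in> C. v \<in> (\<lambda>c\<in>C. j ` S c) c} = {c \<in> C. u \<in> S c}"
      using assms by (auto simp: u inj_image_mem_iff)
    then show ?thesis
      using 4 assms by (auto simp: fam_def u inj_image_mem_iff)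
  next
    case False
    then have "{c \<in> C. v \<in> (\<lambda>c\<in>C. j ` S c) c} = {}" and v: "v \<notin> j ` V"
      by auto
    from this(1) show ?thesis
      by (rule ssubst) (simp add: v)
  qed
  moreover have "S c \<subseteq> U c" if "c \<in> C" for c
    using 4 that by (auto simp: fam_def PiE_def Pi_def)
  ultimately show ?case
    by (auto simp: fam_def)
next
  case (5 S)
  have "j ` (j -` S c) = S c" if "c \<in> C" for c
  proof -
    have "S c \<subseteq> j ` U c"
      using 5 that by (auto simp: fam_def PiE_def Pi_def)
    then show ?thesis by blast
  qed
  then show ?case
    by simp
qed

text \<open>The vertices in \<open>I c\<close> are incident to edges of the cell \<open>c\<close> only, so every family covers them in \<open>c\<close>.\<close>

lemma net_private:
  assumes I: "\<And>c. c \<in> C \<Longrightarrow> I c \<subseteq> V" "disjoint_family_on I C"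
    and UI: "\<And>c d. c \<in> C \<Longrightarrow> d \<in> C \<Longrightarrow> U c \<inter> I d = {}"
  shows "net C (\<lambda>c. U c \<union> I c) \<phi> V = net C U (\<lambda>c S. \<phi> c (S \<union> I c)) (V - (\<Union>c\<in>C. I c))"
proof -
  have sub: "S c \<subseteq> U c \<union> I c" if "S \<in> fam C (\<lambda>c. U c \<union> I c) V" "c \<in> C" for S c
    using that by (auto simp: fam_def PiE_def Pi_def)
  have sub': "S c \<subseteq> U c" if "S \<in> fam C U W" "c \<in> C" for S W c
    using that by (auto simp: fam_def PiE_def Pi_def)
  have only: "c = d" if "c \<in> C" "d \<in> C" "v \<in> I c" "v \<in> I d" for c d v
    using I(2) that by (auto simp: disjoint_family_on_def)
  \<comment> \<open>A vertex of \<open>I c\<close> is covered somewhere because it lies in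
    \<open>V\<close>; the shared parts \<open>U d\<close> avoid it and the private sets are
    disjoint, so the covering cell is \<open>c\<close>.\<close>
  have full: "I c \<subseteq> S c" if S: "S \<in> fam C (\<lambda>c. U c \<union> I c) V" and c: "c \<in> C" for S c
  proof
    fix v assume v: "v \<in> I c"
    then have "card {d \<in> C. v \<in> S d} = 1"
      using S I(1)[OF c] by (auto simp: fam_def)
    then have "{d \<in> C. v \<in> S d} \<noteq> {}"
      by (metis card.empty zero_neq_one)
    then obtain d where d: "d \<in> C" "v \<in> S d"
      by blast
    with sub[OF S] UI[OF _ c] v have "v \<in> I d"
      by blast
    with only[OF c _ v] d show "v \<in> S c"
      by blast
  qed
  show ?thesis
    unfolding net_def
  proof (rule sum.reindex_bij_witness[where i = "\<lambda>S. \<lambda>c\<in>C. S c \<union> I c"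
        and j = "\<lambda>S. \<lambda>c\<in>C. S c - I c"], goal_cases)
    case (1 S)
    then have "S c = undefined" if "c \<notin> C" for c
      using that by (auto simp: fam_def PiE_def extensional_def)
    then show ?case
      using full[OF 1] by (auto simp: fun_eq_iff restrict_def)
  next
    case (2 S)
    have "card {c \<in> C. v \<in> (\<lambda>c\<in>C. S c - I c) c} = of_bool (v \<in> V - (\<Union>c\<in>C. I c))" for v
    proof (cases "v \<in> (\<Union>c\<in>C. I c)")
      case True
      then obtain d where d: "d \<in> C" "v \<in> I d" by blast
      have "{c \<in> C. v \<in> (\<lambda>c\<in>C. S c - I c) c} = {}"
        using sub[OF 2] UI[OF _ d(1)] d(2) by fastforce
      then show ?thesis
        by (rule ssubst) (use True in simp)
    next
      case False
      then have "{c \<in> C. v \<in> (\<lambda>c\<in>C. S c - I c) c} = {c \<in> C. v \<in> S c}"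
        by auto
      then show ?thesis
        using 2 False by (auto simp: fam_def)
    qed
    then show ?case
      using sub[OF 2] by (auto simp: fam_def)
  next
    case (3 S)
    then have "S c = undefined" if "c \<notin> C" for c
      using that by (auto simp: fam_def PiE_def extensional_def)
    moreover have "(S c \<union> I c) - I c = S c" if "c \<in> C" for c
      using sub'[OF 3 that] UI[OF that that] by blast
    ultimately show ?case
      by (auto simp: fun_eq_iff restrict_def)
  next
    case (4 S)
    have "card {c \<in> C. v \<in> (\<lambda>c\<in>C. S c \<union> I c) c} = of_bool (v \<in> V)" for v
    proof (cases "v \<in> (\<Union>c\<in>C. I c)")
      case True
      then obtain d where d: "d \<in> C" "v \<in> I d" by blast
      have "v \<notin> S c" if "c \<in> C" for c
        using sub'[OF 4 that] UI[OF that d(1)] d(2) by blast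
      then have "{c \<in> C. v \<in> S c \<union> I c} = {d}"
        using d only[OF _ d(1) _ d(2)] by blast
      moreover have "{c \<in> C. v \<in> (\<lambda>c\<in>C. S c \<union> I c) c} = {c \<in> C. v \<in> S c \<union> I c}"
        by auto
      moreover have "v \<in> V"
        using I(1) d by blast
      ultimately show ?thesis
        by simp
    next
      case False
      then have "{c \<in> C. v \<in> (\<lambda>c\<in>C. S c \<union> I c) c} = {c \<in> C. v \<in> S c}"
        by auto
      then show ?thesis
        using 4 False by (auto simp: fam_def)
    qed
    then show ?case
      using sub'[OF 4] by (auto simp: fam_def)
  next
    case (5 S)
    have "S c - I c \<union> I c = S c" if "c \<in> C" for c
      using full[OF 5 that] by blast
    then show ?case
      by simp
  qed
qed

text \<open>Since the edge sets of the cells are disjoint and exhaust the edges inside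
  \<open>V\<close>, a matching is the same as a choice of the vertices each cell covers together
  with a matching of these vertices inside the cell.\<close>

lemma msum_eq_net:
  fixes V :: "'v set" and C :: "'c set"
  assumes fin: "finite V" "finite C" "\<And>c. c \<in> C \<Longrightarrow> finite (U c)"
    and disj: "disjoint_family_on F C"
    and cover: "\<And>e. e \<in> E \<Longrightarrow> e \<subseteq> V \<Longrightarrow> \<exists>c\<in>C. e \<in> F c"
    and F: "\<And>c. c \<in> C \<Longrightarrow> F c \<subseteq> E" "\<And>c e. c \<in> C \<Longrightarrow> e \<in> F c \<Longrightarrow> e \<subseteq> U c"
  shows "msum V E w = net C U (\<lambda>c S. msum S (F c) w) V"
proof -
  \<comment> \<open>\<open>g\<close> cuts a matching into its parts in the cells, recording the sets
    they cover; \<open>h\<close> glues the parts together again.\<close>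
  define g where "g = (\<lambda>P. ((\<lambda>c\<in>C. \<Union>(P \<inter> F c)), (\<lambda>c\<in>C. P \<inter> F c)))"
  define h where "h = (\<lambda>(S :: 'c \<Rightarrow> 'v set, Q). \<Union>c\<in>C. Q c :: 'v set set)"
  define X where "X = Sigma (fam C U V) (\<lambda>S. PiE C (\<lambda>c. pm (S c) (F c)))"
  have finfam: "finite (fam C U V)"
    unfolding fam_def by (rule finite_subset[OF _ finite_PiE[of C "\<lambda>c. Pow (U c)"]]) (use fin in auto)
  have subU: "S c \<subseteq> U c" if "S \<in> fam C U V" "c \<in> C" for S c
    using that by (auto simp: fam_def PiE_def Pi_def)
  have uniq: "c = d" if "S \<in> fam C U V" "c \<in> C" "d \<in> C" "v \<in> S c" "v \<in> S d" for S c d v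
  proof -
    have "card {c \<in> C. v \<in> S c} \<le> 1"
      using that(1) by (auto simp: fam_def)
    then show ?thesis
      using that fin(2) by (auto simp: card_le_Suc0_iff_eq)
  qed
  have exists: "v \<in> V \<longleftrightarrow> (\<exists>c\<in>C. v \<in> S c)" if "S \<in> fam C U V" for S v
  proof -
    have "card {c \<in> C. v \<in> S c} = of_bool (v \<in> V)"
      using that by (auto simp: fam_def)
    moreover have "card {c \<in> C. v \<in> S c} = 0 \<longleftrightarrow> {c \<in> C. v \<in> S c} = {}"
      using fin(2) by simp
    ultimately show ?thesis
      by (cases "v \<in> V") auto
  qed
  have Q: "Q c \<subseteq> F c" "disjoint (Q c)" "\<Union>(Q c) = S c" "{} \<notin> Q c"
    if "(S, Q) \<in> X" "c \<in> C" for S Q c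
    using that by (auto simp: X_def PiE_def Pi_def pm_def partition_on_def)
  have PF: "P \<inter> F c \<in> pm (\<Union>(P \<inter> F c)) (F c)" if "P \<in> pm V E" for P c
    using that by (auto simp: pm_def partition_on_def disjoint_def)
  \<comment> \<open>Distributivity: a product over cells of matching sums is a sum over all choices
    of one matching per cell.\<close>
  have "net C U (\<lambda>c S. msum S (F c) w) V =
      (\<Sum>S\<in>fam C U V. \<Sum>Q\<in>PiE C (\<lambda>c. pm (S c) (F c)). \<Prod>c\<in>C. \<Prod>e\<in>Q c. w e)"
    unfolding net_def msum_def
  proof (intro sum.cong refl prod_sum_PiE fin)
    fix S c assume "S \<in> fam C U V" "c \<in> C"
    then show "finite (pm (S c) (F c))"
      using subU fin(3) by (meson finite_pm finite_subset)
  qed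
  also have "\<dots> = (\<Sum>(S, Q)\<in>X. \<Prod>c\<in>C. \<Prod>e\<in>Q c. w e)"
    unfolding X_def
  proof (rule sum.Sigma[OF finfam], intro ballI)
    fix S assume S: "S \<in> fam C U V"
    show "finite (PiE C (\<lambda>c. pm (S c) (F c)))"
      using subU[OF S] fin by (intro finite_PiE) (meson finite_pm finite_subset)+
  qed
  also have "\<dots> = (\<Sum>P\<in>pm V E. \<Prod>e\<in>P. w e)"
  proof (rule sum.reindex_bij_witness[where i = g and j = h], goal_cases)
    case (1 a)
    then obtain S Q where a: "a = (S, Q)" and SQ: "(S, Q) \<in> X"
      by (cases a) auto
    have S: "S \<in> fam C U V" and QP: "Q \<in> PiE C (\<lambda>c. pm (S c) (F c))"
      using SQ by (auto simp: X_def)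
    have eq: "(\<Union>c\<in>C. Q c) \<inter> F d = Q d" if d: "d \<in> C" for d
    proof -
      have "c = d" if "c \<in> C" "e \<in> Q c" "e \<in> F d" for c e
        using Q(1)[OF SQ that(1)] that d disj unfolding disjoint_family_on_def by blast
      then show ?thesis
        using Q(1)[OF SQ d] d by blast
    qed
    have "S d = undefined" "Q d = undefined" if "d \<notin> C" for d
      using S QP that by (auto simp: fam_def PiE_def extensional_def)
    then show ?case
      using eq Q(3)[OF SQ] by (auto simp: a g_def h_def fun_eq_iff restrict_def)
  next
    case (2 a)
    then obtain S Q where a: "a = (S, Q)" and SQ: "(S, Q) \<in> X"
      by (cases a) auto
    have S: "S \<in> fam C U V"
      using SQ by (auto simp: X_def)
    have "partition_on V (\<Union>c\<in>C. Q c)"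
    proof (rule partition_onI)
      show "\<Union> (\<Union>c\<in>C. Q c) = V"
        using exists[OF S] Q(3)[OF SQ] by blast
    next
      fix p q assume pq: "p \<in> (\<Union>c\<in>C. Q c)" "q \<in> (\<Union>c\<in>C. Q c)" "p \<noteq> q"
      then obtain c d where cd: "c \<in> C" "p \<in> Q c" "d \<in> C" "q \<in> Q d"
        by blast
      show "disjnt p q"
      proof (cases "c = d")
        case True
        then show ?thesis
          using Q(2)[OF SQ cd(1)] cd pq(3) by (auto simp: disjoint_def disjnt_def)
      next
        case False
        then show ?thesis
          using uniq[OF S cd(1,3)] Q(3)[OF SQ cd(1)] Q(3)[OF SQ cd(3)] cd
          by (auto simp: disjnt_def)
      qed
    next
      show "{} \<notin> (\<Union>c\<in>C. Q c)"
        using Q(4)[OF SQ] by blast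
    qed
    moreover have "(\<Union>c\<in>C. Q c) \<subseteq> E"
      using Q(1)[OF SQ] F(1) by blast
    ultimately show ?case
      by (simp add: a h_def pm_def)
  next
    case (3 P)
    then have "\<exists>c\<in>C. e \<in> F c" if "e \<in> P" for e
      using that cover[of e] by (auto simp: pm_def partition_on_def)
    then show ?case
      by (auto simp: g_def h_def)
  next
    case (4 P)
    then have P: "\<Union>P = V" "disjoint P" "P \<subseteq> E"
      by (auto simp: pm_def partition_on_def)
    have "card {c \<in> C. v \<in> \<Union>(P \<inter> F c)} = of_bool (v \<in> V)" for v
    proof (cases "v \<in> V")
      case True
      then obtain e where e: "e \<in> P" "v \<in> e"
        using P(1) by blast
      moreover from e P obtain c where c: "c \<in> C" "e \<in> F c"
        using cover[of e] by blast
      moreover have "d = c" if d: "d \<in> C" "v \<in> \<Union>(P \<inter> F d)" for d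
      proof -
        obtain e' where e': "e' \<in> P" "e' \<in> F d" "v \<in> e'"
          using d by blast
        then have "e' = e"
          using e P(2) by (auto simp: disjoint_def)
        then show "d = c"
          using c d(1) e'(2) disj unfolding disjoint_family_on_def by blast
      qed
      ultimately have "{c \<in> C. v \<in> \<Union>(P \<inter> F c)} = {c}"
        by blast
      then show ?thesis
        using True by simp
    next
      case False
      then have "{c \<in> C. v \<in> \<Union>(P \<inter> F c)} = {}"
        using P(1) by blast
      then show ?thesis
        by (rule ssubst) (use False in simp)
    qed
    moreover have "{c \<in> C. v \<in> (\<lambda>c\<in>C. \<Union>(P \<inter> F c)) c} = {c \<in> C. v \<in> \<Union>(P \<inter> F c)}" for v
      by auto
    ultimately have "(\<lambda>c\<in>C. \<Union>(P \<inter> F c)) \<in> fam C U V"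
      using F(2) by (fastforce simp: fam_def)
    then show ?case
      using PF[OF 4] by (auto simp: g_def X_def)
  next
    case (5 a)
    then obtain S Q where a: "a = (S, Q)" and SQ: "(S, Q) \<in> X"
      by (cases a) auto
    have S: "S \<in> fam C U V"
      using SQ by (auto simp: X_def)
    have "finite (Q c)" if c: "c \<in> C" for c
    proof -
      have "finite (S c)"
        using subU[OF S c] fin(3)[OF c] finite_subset by blast
      then show ?thesis
        using Q(3)[OF SQ c] finite_UnionD by metis
    qed
    moreover have "Q c \<inter> Q d = {}" if "c \<in> C" "d \<in> C" "c \<noteq> d" for c d
      using Q(1)[OF SQ] that disj unfolding disjoint_family_on_def by blast
    ultimately show ?case
      using fin(2) by (simp add: a h_def prod.UNION_disjoint)
  qed
  finally show ?thesis
    by (simp add: msum_def)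
qed

section \<open>Aztec diamonds and urban renewal\<close>

text \<open>The matching sum of the 4-cycle \<open>p q r s\<close> with edge weights
  \<open>a, b, c, d\<close> in cyclic order, restricted to matchings that cover exactly
  \<open>S\<close>. The value \<open>a * c + b * d\<close> collects the two perfect
  matchings.\<close>

definition quad ::
    "'v \<Rightarrow> 'v \<Rightarrow> 'v \<Rightarrow> 'v \<Rightarrow> real \<Rightarrow> real \<Rightarrow> real \<Rightarrow> real \<Rightarrow> 'v set \<Rightarrow> real" where
  "quad p q r s a b c d S =
     (if S = {} then 1 else if S = {p, q} then a else if S = {q, r} then b
      else if S = {r, s} then c else if S = {s, p} then d
      else if S = {p, q, r, s} then a * c + b * d else 0)"

section \<open>Matchings of a single 4-cycle\<close>

definition cycle4 :: "'v \<Rightarrow> 'v \<Rightarrow> 'v \<Rightarrow> 'v \<Rightarrow> 'v set set" where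
  "cycle4 p q r s = {{p, q}, {q, r}, {r, s}, {s, p}}"

lemma Pow4:
  assumes "S \<subseteq> {p, q, r, s}"
  shows "S \<in> {{}, {p}, {q}, {r}, {s}, {p, q}, {q, r}, {r, s}, {p, s}, {p, r}, {q, s},
     {p, q, r}, {q, r, s}, {p, r, s}, {p, q, s}, {p, q, r, s}}"
proof -
  have "S \<in> Pow {p, q, r, s}"
    using assms by simp
  then show ?thesis
    apply (simp only: Pow_insert Pow_empty image_insert image_empty image_Un Un_insert_left Un_empty_left)
    apply (elim insertE emptyE)
    apply (simp_all only: insert_iff simp_thms)
    done
qed

lemma pm_cycle4:
  assumes "distinct [p, q, r, s]"
  shows "pm S (cycle4 p q r s) =
    {P \<in> {{}, {{p, q}}, {{q, r}}, {{r, s}}, {{s, p}}, {{p, q}, {r, s}}, {{q, r}, {s, p}}}. \<Union>P = S}"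
    (is "_ = {P \<in> ?L. _}")
proof (rule set_eqI)
  fix P
  have 1: "P \<in> ?L" if P: "disjoint P" "P \<subseteq> cycle4 p q r s"
  proof -
    have adj: "e \<notin> P \<or> e' \<notin> P" if "e \<noteq> e'" "e \<inter> e' \<noteq> {}" for e e'
      using P(1) that by (auto simp: disjoint_def)
    have "{p, q} \<notin> P \<or> {q, r} \<notin> P" "{q, r} \<notin> P \<or> {r, s} \<notin> P"
      "{r, s} \<notin> P \<or> {s, p} \<notin> P" "{s, p} \<notin> P \<or> {p, q} \<notin> P"
      using assms by (intro adj; auto simp: doubleton_eq_iff)+
    with Pow4[OF P(2)[unfolded cycle4_def]] show ?thesis
      by (simp only: insert_iff empty_iff) (elim disjE; simp)
  qed
  have 2: "disjoint P \<and> {} \<notin> P \<and> P \<subseteq> cycle4 p q r s" if "P \<in> ?L"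
    using that assms unfolding cycle4_def
    by (simp only: insert_iff empty_iff) (elim disjE; auto simp add: pairwise_insert disjnt_def)
  have iff: "P \<in> ?L \<longleftrightarrow> disjoint P \<and> {} \<notin> P \<and> P \<subseteq> cycle4 p q r s"
    by (rule iffI) (erule 2, elim conjE, erule (1) 1)
  show "P \<in> pm S (cycle4 p q r s) \<longleftrightarrow> P \<in> {P \<in> ?L. \<Union>P = S}"
    unfolding pm_def partition_on_def mem_Collect_eq iff by blast
qed

lemma msum_cycle4:
  assumes "distinct [p, q, r, s]"
  shows "msum S (cycle4 p q r s) w =
    quad p q r s (w {p, q}) (w {q, r}) (w {r, s}) (w {s, p}) S"
proof -
  have ne: "{p, q} \<noteq> {q, r}" "{p, q} \<noteq> {r, s}" "{p, q} \<noteq> {s, p}" "{q, r} \<noteq> {r, s}"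
    "{q, r} \<noteq> {s, p}" "{r, s} \<noteq> {s, p}"
    using assms by (auto simp: doubleton_eq_iff)
  have "e \<noteq> {p, q, r, s}" if "card e = 2" for e
    using that assms by auto
  then have ne4: "{p, q} \<noteq> {p, q, r, s}" "{q, r} \<noteq> {p, q, r, s}"
    "{r, s} \<noteq> {p, q, r, s}" "{s, p} \<noteq> {p, q, r, s}"
    using assms by auto
  have eq: "{q, r} \<union> {s, p} = {p, q, r, s}" "{p, q} \<union> {r, s} = {p, q, r, s}"
    by auto
  define A B C D where "A = {p, q}" and "B = {q, r}" and "C = {r, s}" and "D = {s, p}"
  note ABCD = A_def [symmetric] B_def [symmetric] C_def [symmetric] D_def [symmetric]
  have ne': "A \<noteq> {}" "B \<noteq> {}" "C \<noteq> {}" "D \<noteq> {}"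
    by (auto simp: A_def B_def C_def D_def)
  note ne = ne[unfolded ABCD] and ne4 = ne4[unfolded ABCD] and eq = eq[unfolded ABCD]
  let ?L = "{{}, {A}, {B}, {C}, {D}, {A, C}, {B, D}}"
  have "msum S (cycle4 p q r s) w = (\<Sum>P\<in>{P \<in> ?L. \<Union>P = S}. \<Prod>e\<in>P. w e)"
    unfolding msum_def pm_cycle4[OF assms] ABCD ..
  also have "\<dots> = (\<Sum>P\<in>?L. if \<Union>P = S then \<Prod>e\<in>P. w e else 0)"
    by (rule sum.inter_filter) simp
  also have "\<dots> = quad p q r s (w A) (w B) (w C) (w D) S"
    using ne ne' ne4 eq
    by (simp add: quad_def ABCD doubleton_eq_iff)
  finally show ?thesis
    unfolding ABCD .
qed

text \<open>Urban renewal: covering the complementary vertices is equivalent after exchanging the weights of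
  opposite edges and dividing them by \<open>D\<close>.\<close>

lemma quad_complement:
  assumes d: "distinct [p, q, r, s]" and S: "S \<subseteq> {p, q, r, s}" and D: "D = a * c + b * d" "D \<noteq> 0"
  shows "quad p q r s a b c d S =
    D * quad p q r s (c / D) (d / D) (a / D) (b / D) ({p, q, r, s} - S)"
proof -
  \<comment> \<open>The empty set and the full set change places, so the reweighted full cycle has
    to weigh \<open>1 / D\<close>.\<close>
  have full: "c / D * (a / D) + d / D * (b / D) = 1 / D"
  proof -
    have "c / D * (a / D) + d / D * (b / D) = (a * c + b * d) / (D * D)"
      by (simp add: add_divide_distrib mult.commute)
    then show ?thesis
      using D by simp
  qed
  have ne: "p \<noteq> q" "q \<noteq> p" "p \<noteq> r" "r \<noteq> p" "p \<noteq> s" "s \<noteq> p" "q \<noteq> r" "r \<noteq> q" "q \<noteq> s" "s \<noteq> q"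
    "r \<noteq> s" "s \<noteq> r"
    using d by auto
  have D1: "D * (1 / D) = 1" "D * (x / D) = x" for x
    using D(2) by simp_all
  show ?thesis
    using Pow4[OF S]
    by (elim insertE emptyE; hypsubst; simp only: quad_def full insert_Diff_if Diff_empty insert_iff
        empty_iff ne simp_thms if_True if_False set_eq_subset insert_subset empty_subsetI
        Diff_cancel empty_Diff D1 mult_zero_right D(1)[symmetric])
qed

lemma msum_forced:
  assumes V: "finite V" "u \<in> V" "l \<in> V" and E: "{u, l} \<in> E"
    and only: "\<And>e. e \<in> E \<Longrightarrow> e \<subseteq> V \<Longrightarrow> u \<in> e \<Longrightarrow> e = {u, l}"
  shows "msum V E w = w {u, l} * msum (V - {u, l}) E w"
proof -
  have mem: "{u, l} \<in> P" "P - {{u, l}} \<in> pm (V - {u, l}) E" if "P \<in> pm V E" for P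
  proof -
    have P: "partition_on V P" "P \<subseteq> E"
      using that by (auto simp: pm_def)
    then obtain e where e: "e \<in> P" "u \<in> e"
      using V(2) by (auto simp: partition_on_def)
    then have "e = {u, l}"
      using only[of e] P by (auto simp: partition_on_def)
    then show *: "{u, l} \<in> P"
      using e by simp
    have "X \<inter> {u, l} = {}" if "X \<in> P" "X \<noteq> {u, l}" for X
      by (rule disjointD[OF partition_onD2[OF P(1)] that(1) * that(2)])
    then have "\<Union>(P - {{u, l}}) \<inter> {u, l} = {}"
      unfolding Int_Union2 by simp
    moreover have "V = {u, l} \<union> \<Union>(P - {{u, l}})"
      using partition_onD1[OF P(1)] insert_Diff[OF *] Union_insert by metis
    ultimately have "\<Union>(P - {{u, l}}) = V - {u, l}"
      by (simp add: Int_commute Diff_triv Un_Diff)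
    moreover have "disjoint (P - {{u, l}})" "{} \<notin> P - {{u, l}}" "P - {{u, l}} \<subseteq> E"
      using P unfolding partition_on_def disjoint_def by blast+
    ultimately show "P - {{u, l}} \<in> pm (V - {u, l}) E"
      by (simp add: pm_def partition_on_def)
  qed
  have ins: "insert {u, l} P \<in> pm V E" "{u, l} \<notin> P" if "P \<in> pm (V - {u, l}) E" for P
    using that V E by (auto simp: pm_def partition_on_def disjoint_def)
  have "msum V E w = (\<Sum>P\<in>pm (V - {u, l}) E. \<Prod>e\<in>insert {u, l} P. w e)"
    unfolding msum_def
    by (rule sum.reindex_bij_witness[where i = "insert {u, l}" and j = "\<lambda>P. P - {{u, l}}"])
      (use mem ins in \<open>auto simp: insert_absorb\<close>)
  also have "\<dots> = (\<Sum>P\<in>pm (V - {u, l}) E. w {u, l} * (\<Prod>e\<in>P. w e))"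
  proof (rule sum.cong[OF refl])
    fix P assume P: "P \<in> pm (V - {u, l}) E"
    then have "finite P"
      using V(1) by (auto simp: pm_def intro: finite_elements)
    then show "(\<Prod>e\<in>insert {u, l} P. w e) = w {u, l} * (\<Prod>e\<in>P. w e)"
      using ins(2)[OF P] by simp
  qed
  finally show ?thesis
    by (simp add: msum_def sum_distrib_left)
qed

text \<open>The unit squares \<open>squares N\<close>, named by their lower left corners, form an Aztec diamond of order
  \<open>N\<close>; \<open>diamond N\<close> consists of the alternate inner lattice points, each of which is surrounded by
  a 4-cycle of unit squares. In \<open>aztec N h u d\<close> the edge crossing the lattice edge from the point
  \<open>(x, y)\<close> to the side, up or down has weight \<open>h y\<close>, \<open>u y\<close> or \<open>d y\<close>.\<close>

definition diamond :: "nat \<Rightarrow> point set" where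
  "diamond N = {(x, y). \<bar>x\<bar> + \<bar>y\<bar> < int N \<and> odd (x + y - int N)}"

definition squares :: "nat \<Rightarrow> point set" where
  "squares N = {(x, y). \<bar>2 * x + 1\<bar> + \<bar>2 * y + 1\<bar> \<le> 2 * int N}"

fun corner :: "point \<Rightarrow> point set" where
  "corner (x, y) = {(x - 1, y - 1), (x, y - 1), (x, y), (x - 1, y)}"

fun corner_cycle :: "point \<Rightarrow> point set set" where
  "corner_cycle (x, y) = cycle4 (x - 1, y - 1) (x, y - 1) (x, y) (x - 1, y)"

fun corner_quad :: "real \<Rightarrow> real \<Rightarrow> real \<Rightarrow> point \<Rightarrow> point set \<Rightarrow> real" where
  "corner_quad h u d (x, y) = quad (x - 1, y - 1) (x, y - 1) (x, y) (x - 1, y) d h u h"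

definition aztec :: "nat \<Rightarrow> (int \<Rightarrow> real) \<Rightarrow> (int \<Rightarrow> real) \<Rightarrow> (int \<Rightarrow> real) \<Rightarrow> real" where
  "aztec N h u d = net (diamond N) corner (\<lambda>c. corner_quad (h (snd c)) (u (snd c)) (d (snd c)) c) (squares N)"

section \<open>One round of urban renewal on the whole Aztec diamond\<close>

lemma finite_diamond: "finite (diamond N)"
  by (rule finite_subset[of _ "{- int N..int N} \<times> {- int N..int N}"]) (auto simp: diamond_def)

lemma finite_squares: "finite (squares N)"
  by (rule finite_subset[of _ "{- int N - 1..int N} \<times> {- int N - 1..int N}"]) (auto simp: squares_def)

lemma mem_diamond: "(x, y) \<in> diamond N \<longleftrightarrow> - int N < x + y \<and> x + y < int N \<and>
   - int N < x - y \<and> x - y < int N \<and> odd (x + y - int N)"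
proof -
  have "\<bar>x\<bar> + \<bar>y\<bar> < int N \<longleftrightarrow> - int N < x + y \<and> x + y < int N \<and> - int N < x - y \<and> x - y < int N"
    by linarith
  then show ?thesis by (simp add: diamond_def)
qed
lemma mem_squares: "(x, y) \<in> squares N \<longleftrightarrow>
    - int N \<le> x + y + 1 \<and> x + y + 1 \<le> int N \<and> - int N \<le> x - y \<and> x - y \<le> int N"
proof -
  have "\<bar>a\<bar> + \<bar>b\<bar> \<le> c \<longleftrightarrow> - c \<le> a + b \<and> a + b \<le> c \<and> - c \<le> a - b \<and> a - b \<le> c" for a b c :: int
    by linarith
  from this[of "2 * x + 1" "2 * y + 1" "2 * int N"] show ?thesis by (auto simp add: squares_def)
qed

text \<open>Of the four lattice points at the corners of a unit square just two opposite ones have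
  the parity of \<open>diamond N\<close>, so a square lies in at most two cells.\<close>

lemma diamond_corners:
  "{c \<in> diamond N. (x, y) \<in> corner c} =
     (if even (x + y - int N) then {(x + 1, y), (x, y + 1)} else {(x, y), (x + 1, y + 1)})
     \<inter> diamond N"
proof -
  have "{c \<in> diamond N. (x, y) \<in> corner c} =
      {(x, y), (x + 1, y), (x, y + 1), (x + 1, y + 1)} \<inter> diamond N"
    by auto
  also have "\<dots> = (if even (x + y - int N) then {(x + 1, y), (x, y + 1)} else {(x, y), (x + 1, y + 1)})
      \<inter> diamond N"
  proof (cases "even (x + y - int N)")
    case True
    then have "(x, y) \<notin> diamond N" "(x + 1, y + 1) \<notin> diamond N"
      by (simp_all add: mem_diamond)
    with True show ?thesis
      by auto
  next
    case False
    then have "even (x + 1 + y - int N)" "even (x + (y + 1) - int N)"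
      by presburger+
    then have "(x + 1, y) \<notin> diamond N" "(x, y + 1) \<notin> diamond N"
      unfolding mem_diamond by blast+
    with False show ?thesis
      by auto
  qed
  finally show ?thesis .
qed

lemma card_pair_Int: "a \<noteq> b \<Longrightarrow> card ({a, b} \<inter> Q) = of_bool (a \<in> Q) + of_bool (b \<in> Q)"
  by (cases "a \<in> Q"; cases "b \<in> Q") auto

text \<open>This is the count required by \<open>net_toggle\<close>: squares of the smaller diamond
  lie in two cells and squares of the rim in one, so complementing everywhere strips off the
  rim.\<close>

lemma card_diamond_corners:
  "card {c \<in> diamond (Suc N). v \<in> corner c} = of_bool (v \<in> squares (Suc N)) + of_bool (v \<in> squares N)"
proof -
  obtain x y where v: "v = (x, y)" by fastforce
  \<comment> \<open>In the rotated coordinates the diamonds are boxes. As \<open>a\<close> and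
    \<open>b\<close> have equal parity, a bound of the wrong parity can be tightened by one, which
    reconciles the various inequalities.\<close>
  obtain a where a: "a = x + y" by simp
  obtain b where b: "b = x - y" by simp
  have ab: "even (a - b)" by (simp add: a b)
  show ?thesis
  proof (cases "even (x + y - int (Suc N))")
    case True
    then have p: "even (a - int N - 1)" "even (b - int N - 1)" using ab by (auto simp: a)
    have "card {c \<in> diamond (Suc N). v \<in> corner c} =
        of_bool ((x + 1, y) \<in> diamond (Suc N)) + of_bool ((x, y + 1) \<in> diamond (Suc N))"
      using True unfolding v diamond_corners by (simp add: card_pair_Int)
    moreover have "(x + 1, y) \<in> diamond (Suc N) \<longleftrightarrow> - int N - 1 \<le> a \<and> a < int N \<and> - int N - 1 \<le> b \<and> b < int N"
      using p by (auto simp: mem_diamond a b)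
    moreover have "(x, y + 1) \<in> diamond (Suc N) \<longleftrightarrow> - int N - 1 \<le> a \<and> a < int N \<and> - int N < b \<and> b \<le> int N + 1"
      using p by (auto simp: mem_diamond a b)
    moreover have "v \<in> squares (Suc N) \<longleftrightarrow> - int N - 1 \<le> a \<and> a < int N \<and> - int N - 1 \<le> b \<and> b \<le> int N + 1"
    proof -
      have "v \<in> squares (Suc N) \<longleftrightarrow> - int N - 2 \<le> a \<and> a \<le> int N \<and> - int N - 1 \<le> b \<and> b \<le> int N + 1"
        by (auto simp: mem_squares a b v)
      then show ?thesis using p(1) by presburger
    qed
    moreover have "v \<in> squares N \<longleftrightarrow> - int N - 1 \<le> a \<and> a < int N \<and> - int N < b \<and> b < int N"
    proof -
      have "v \<in> squares N \<longleftrightarrow> - int N - 1 \<le> a \<and> a < int N \<and> - int N \<le> b \<and> b \<le> int N"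
        by (auto simp: mem_squares a b v)
      then show ?thesis using p(2) by presburger
    qed
    moreover have "int N \<le> b \<Longrightarrow> - int N < b"
      using p(2) by presburger
    ultimately show ?thesis by (simp only: of_bool_def) auto
  next
    case False
    then have p: "odd (a - int N - 1)" "odd (b - int N - 1)" using ab by (auto simp: a)
    have "card {c \<in> diamond (Suc N). v \<in> corner c} =
        of_bool ((x, y) \<in> diamond (Suc N)) + of_bool ((x + 1, y + 1) \<in> diamond (Suc N))"
      using False unfolding v diamond_corners by (simp add: card_pair_Int)
    moreover have "(x, y) \<in> diamond (Suc N) \<longleftrightarrow> - int N \<le> a \<and> a \<le> int N \<and> - int N \<le> b \<and> b \<le> int N"
      using p by (auto simp: mem_diamond a b)
    moreover have "(x + 1, y + 1) \<in> diamond (Suc N) \<longleftrightarrow> - int N - 2 \<le> a \<and> a \<le> int N - 2 \<and> - int N \<le> b \<and> b \<le> int N"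
      using p by (auto simp: mem_diamond a b)
    moreover have "v \<in> squares (Suc N) \<longleftrightarrow> - int N - 2 \<le> a \<and> a \<le> int N \<and> - int N \<le> b \<and> b \<le> int N"
    proof -
      have "v \<in> squares (Suc N) \<longleftrightarrow> - int N - 2 \<le> a \<and> a \<le> int N \<and> - int N - 1 \<le> b \<and> b \<le> int N + 1"
        by (auto simp: mem_squares a b v)
      then show ?thesis using p(2) by presburger
    qed
    moreover have "v \<in> squares N \<longleftrightarrow> - int N \<le> a \<and> a \<le> int N - 2 \<and> - int N \<le> b \<and> b \<le> int N"
    proof -
      have "v \<in> squares N \<longleftrightarrow> - int N - 1 \<le> a \<and> a < int N \<and> - int N \<le> b \<and> b \<le> int N"
        by (auto simp: mem_squares a b v)
      then show ?thesis using p(1) by presburger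
    qed
    moreover have "a < - int N \<Longrightarrow> a \<le> int N - 2"
      using p(1) by presburger
    ultimately show ?thesis by (simp only: of_bool_def) auto
  qed
qed

text \<open>Every vertex is complemented. Renewal exchanges opposite edges of a cell, so
  \<open>u\<close> and \<open>d\<close> change places while the two lateral weights, being equal,
  keep theirs.\<close>

lemma aztec_toggle:
  assumes D: "\<And>y. D y = h y ^ 2 + u y * d y" "\<And>y. D y \<noteq> 0"
  shows "aztec (Suc N) h u d = (\<Prod>c\<in>diamond (Suc N). D (snd c)) *
    net (diamond (Suc N)) corner
      (\<lambda>c. corner_quad (h (snd c) / D (snd c)) (d (snd c) / D (snd c)) (u (snd c) / D (snd c)) c) (squares N)"
  unfolding aztec_def net_scale[symmetric]
proof (rule net_toggle[where K = UNIV])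
  fix c S assume "S \<subseteq> corner c"
  then show "corner_quad (h (snd c)) (u (snd c)) (d (snd c)) c S = D (snd c) *
    corner_quad (h (snd c) / D (snd c)) (d (snd c) / D (snd c)) (u (snd c) / D (snd c)) c (toggle UNIV (corner c) S)"
    using D(2)[of "snd c"] quad_complement[where D = "D (snd c)" and S = S, OF _ _ _ D(2)]
    by (cases c) (simp add: toggle_def D(1) power2_eq_square algebra_simps)
qed (use finite_diamond card_diamond_corners in auto)

definition grid :: "point set set" where
  "grid = (\<Union>c. corner_cycle c)"

lemma grid_cases:
  assumes "e \<in> grid"
  obtains x y where "e = {(x - 1, y), (x, y)}" | x y where "e = {(x, y - 1), (x, y)}"
  using assms by (auto simp: grid_def cycle4_def insert_commute)

lemma disjoint_corner_cycles: "disjoint_family_on corner_cycle (diamond N)"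
  unfolding disjoint_family_on_def
  by (auto simp: diamond_def cycle4_def doubleton_eq_iff)

lemma msum_grid:
  assumes V: "finite V"
    and cover: "\<And>e. e \<in> grid \<Longrightarrow> e \<subseteq> V \<Longrightarrow> \<exists>c\<in>diamond N. e \<in> corner_cycle c"
    and w: "\<And>x y. (x, y) \<in> diamond N \<Longrightarrow> w {(x - 1, y - 1), (x, y - 1)} = d y"
      "\<And>x y. (x, y) \<in> diamond N \<Longrightarrow> w {(x, y - 1), (x, y)} = h y"
      "\<And>x y. (x, y) \<in> diamond N \<Longrightarrow> w {(x, y), (x - 1, y)} = u y"
      "\<And>x y. (x, y) \<in> diamond N \<Longrightarrow> w {(x - 1, y), (x - 1, y - 1)} = h y"
  shows "msum V grid w =
    net (diamond N) corner (\<lambda>c. corner_quad (h (snd c)) (u (snd c)) (d (snd c)) c) V"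
proof -
  have "msum V grid w = net (diamond N) corner (\<lambda>c S. msum S (corner_cycle c) w) V"
    by (rule msum_eq_net[OF V finite_diamond _ disjoint_corner_cycles cover])
      (auto simp: grid_def cycle4_def)
  also have "\<dots> = net (diamond N) corner (\<lambda>c. corner_quad (h (snd c)) (u (snd c)) (d (snd c)) c) V"
    by (rule net_cong) (auto simp: msum_cycle4 w)
  finally show ?thesis .
qed

lemma pair_subset: "{a, b} \<subseteq> S \<longleftrightarrow> a \<in> S \<and> b \<in> S"
  by simp

lemma grid_cover_inner:
  assumes "e \<in> grid" "e \<subseteq> squares N"
  shows "\<exists>c\<in>diamond N. e \<in> corner_cycle c"
  using assms(1)
proof (cases rule: grid_cases)
  case (1 x y)
  have "(x, y) \<in> diamond N \<or> (x, y + 1) \<in> diamond N"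
    using assms(2) unfolding 1 pair_subset mem_squares mem_diamond by presburger
  then show ?thesis
    by (rule disjE; intro bexI) (auto simp: 1 cycle4_def insert_commute)
next
  case (2 x y)
  have "(x, y) \<in> diamond N \<or> (x + 1, y) \<in> diamond N"
    using assms(2) unfolding 2 pair_subset mem_squares mem_diamond by presburger
  then show ?thesis
    by (rule disjE; intro bexI) (auto simp: 2 cycle4_def insert_commute)
qed

text \<open>A grid edge crosses a lattice edge, whose two ends have opposite parity. Here the end
  with the parity of \<open>diamond (Suc N)\<close> is chosen, in \<open>grid_cover_inner\<close>
  the other one.\<close>

lemma grid_cover_outer:
  assumes "e \<in> grid" "e \<subseteq> squares N"
  shows "\<exists>c\<in>diamond (Suc N). e \<in> corner_cycle c"
  using assms(1)
proof (cases rule: grid_cases)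
  case (1 x y)
  have "(x, y) \<in> diamond (Suc N) \<or> (x, y + 1) \<in> diamond (Suc N)"
    using assms(2) unfolding 1 pair_subset mem_squares mem_diamond by presburger
  then show ?thesis
    by (rule disjE; intro bexI) (auto simp: 1 cycle4_def insert_commute)
next
  case (2 x y)
  have "(x, y) \<in> diamond (Suc N) \<or> (x + 1, y) \<in> diamond (Suc N)"
    using assms(2) unfolding 2 pair_subset mem_squares mem_diamond by presburger
  then show ?thesis
    by (rule disjE; intro bexI) (auto simp: 2 cycle4_def insert_commute)
qed

text \<open>The same graph read with the other class of lattice points as cells.\<close>

lemma aztec_regroup:
  "net (diamond (Suc N)) corner (\<lambda>c. corner_quad (h (snd c)) (u (snd c)) (d (snd c)) c) (squares N) =
   aztec N h (\<lambda>y. d (y + 1)) (\<lambda>y. u (y - 1))"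
proof -
  \<comment> \<open>The maxima give the right or upper square of the edge. For an edge between
    horizontal neighbours, parity tells whether its cell of order \<open>Suc N\<close> lies below
    it, so that the edge crosses an upward lattice edge, or above it.\<close>
  define w where "w e = (let x = Max (fst ` e); y = Max (snd ` e) in
    if (x - 1, y) \<in> e then if even (x + y - int N) then u y else d (y + 1) else h y)" for e
  have "msum (squares N) grid w =
    net (diamond (Suc N)) corner (\<lambda>c. corner_quad (h (snd c)) (u (snd c)) (d (snd c)) c) (squares N)"
    by (rule msum_grid[OF finite_squares grid_cover_outer])
      (auto simp: w_def diamond_def Let_def max_def)
  moreover have "msum (squares N) grid w = aztec N h (\<lambda>y. d (y + 1)) (\<lambda>y. u (y - 1))"
    unfolding aztec_def
    by (rule msum_grid[OF finite_squares grid_cover_inner])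
      (auto simp: w_def diamond_def Let_def max_def)
  ultimately show ?thesis
    by simp
qed

text \<open>Renewal and regrouping each exchange the roles of up and down, so the two exchanges
  cancel and only a shift of the height by one remains.\<close>

lemma aztec_Suc:
  assumes D: "\<And>y. D y = h y ^ 2 + u y * d y" "\<And>y. D y \<noteq> 0"
  shows "aztec (Suc N) h u d = (\<Prod>c\<in>diamond (Suc N). D (snd c)) *
    aztec N (\<lambda>y. h y / D y) (\<lambda>y. u (y + 1) / D (y + 1)) (\<lambda>y. d (y - 1) / D (y - 1))"
  unfolding aztec_toggle[OF assms] using aztec_regroup[of N "\<lambda>y. h y / D y" "\<lambda>y. d y / D y" "\<lambda>y. u y / D y"] by simp

lemma aztec_0: "aztec 0 h u d = 1"
proof -
  have "diamond 0 = {}" "squares 0 = {}"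
    by (auto simp: mem_diamond mem_squares) presburger
  then show ?thesis
    by (simp add: aztec_def net_def fam_def)
qed

section \<open>Aztec diamonds with weights of period 4\<close>

text \<open>The larger diamond is the smaller one moved one step to the right together with the
  leftmost point of each row, and the move preserves heights.\<close>

lemma prod_diamond_Suc:
  fixes g :: "int \<Rightarrow> real"
  shows "(\<Prod>c\<in>diamond (Suc n). g (snd c)) = (\<Prod>c\<in>diamond n. g (snd c)) * (\<Prod>y = - int n..int n. g y)"
proof -
  let ?s = "\<lambda>(x :: int, y :: int). (x + 1, y)"
  let ?l = "\<lambda>y. (- (int n - \<bar>y\<bar>), y)"
  have D: "diamond (Suc n) = ?s ` diamond n \<union> ?l ` {- int n..int n}"
  proof (intro equalityI subsetI)
    fix c assume c: "c \<in> diamond (Suc n)"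
    obtain x y where xy: "c = (x, y)" by fastforce
    have a: "\<bar>x\<bar> + \<bar>y\<bar> \<le> int n" and e: "even (x + y - int n)"
      using c by (auto simp: xy diamond_def)
    show "c \<in> ?s ` diamond n \<union> ?l ` {- int n..int n}"
    proof (cases "x = - (int n - \<bar>y\<bar>)")
      case True
      then show ?thesis
        using a by (intro UnI2 image_eqI[of _ _ y]) (auto simp: xy)
    next
      case False
      have "x \<noteq> - (int n - \<bar>y\<bar>) + 1"
      proof
        assume "x = - (int n - \<bar>y\<bar>) + 1"
        then have "x + y - int n = (\<bar>y\<bar> + y) - 2 * int n + 1"
          by simp
        moreover have "odd ((\<bar>y\<bar> + y) - 2 * int n + 1)"
          by (cases "y \<ge> 0") auto
        ultimately show False
          using e by (simp only:)
      qed
      then have "\<bar>x - 1\<bar> + \<bar>y\<bar> < int n"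
        using False a by linarith
      then show ?thesis
        using e by (intro UnI1 image_eqI[of _ _ "(x - 1, y)"]) (auto simp: xy diamond_def)
    qed
  next
    fix c assume "c \<in> ?s ` diamond n \<union> ?l ` {- int n..int n}"
    then show "c \<in> diamond (Suc n)"
    proof
      assume "c \<in> ?s ` diamond n"
      then show ?thesis
        by (auto simp: diamond_def)
    next
      assume "c \<in> ?l ` {- int n..int n}"
      then obtain y where c: "c = (- (int n - \<bar>y\<bar>), y)" and y: "\<bar>y\<bar> \<le> int n"
        by auto
      have "even (- (int n - \<bar>y\<bar>) + y - int n)"
        by (cases "y \<ge> 0") auto
      then show ?thesis
        using y by (auto simp: c diamond_def)
    qed
  qed
  have disj: "?s ` diamond n \<inter> ?l ` {- int n..int n} = {}"
    by (auto simp: diamond_def)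
  have s: "inj_on ?s (diamond n)" and l: "inj_on ?l {- int n..int n}"
    by (auto simp: inj_on_def)
  have "(\<Prod>c\<in>diamond (Suc n). g (snd c)) =
      (\<Prod>c\<in>?s ` diamond n. g (snd c)) * (\<Prod>c\<in>?l ` {- int n..int n}. g (snd c))"
    unfolding D by (rule prod.union_disjoint) (use disj finite_diamond in auto)
  then show ?thesis
    unfolding prod.reindex[OF s] prod.reindex[OF l] by (simp add: case_prod_unfold)
qed

lemma prod_diamond_0: "(\<Prod>c\<in>diamond 0. g (snd c)) = (1 :: real)"
proof -
  have "diamond 0 = {}"
    by (auto simp: mem_diamond)
  then show ?thesis by simp
qed

lemma card_diamond: "card (diamond n) = n ^ 2"
proof (induction n)
  case 0
  have "diamond 0 = {}"
    by (auto simp: mem_diamond)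
  then show ?case by simp
next
  case (Suc n)
  \<comment> \<open>With the constant 2 as \<open>g\<close> the product recursion becomes a
    recursion for the cardinality in the exponent.\<close>
  have "(2 :: real) ^ card (diamond (Suc n)) = 2 ^ (card (diamond n) + (2 * n + 1))"
    using prod_diamond_Suc[of "\<lambda>_. 2" n] by (simp add: power_add nat_add_distrib nat_mult_distrib)
  then have "card (diamond (Suc n)) = card (diamond n) + (2 * n + 1)"
    by (subst (asm) power_inject_exp) simp_all
  then show ?case
    using Suc.IH by (simp add: power2_eq_square)
qed

lemma row_prod_Suc:
  fixes g :: "int \<Rightarrow> real"
  shows "(\<Prod>y = - int (Suc n)..int (Suc n). g y) =
    (\<Prod>y = - int n..int n. g y) * (g (int n + 1) * g (- int n - 1))"
proof -
  have "{- int (Suc n)..int (Suc n)} = insert (int n + 1) (insert (- int n - 1) {- int n..int n})"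
    by auto
  then show ?thesis
    by (simp add: mult_ac)
qed

text \<open>For \<open>g = 2\<close> at light and \<open>g = 1\<close> at heavy heights the weights
  \<open>g y / 2\<close> are those of the reduced dual graph, and the product in front collects the
  factor 2 that each renewed heavy cell leaves behind.\<close>

definition chi :: "(int \<Rightarrow> real) \<Rightarrow> nat \<Rightarrow> real" where
  "chi g n = (\<Prod>c\<in>diamond n. 2 / g (snd c)) *
     aztec n (\<lambda>y. g y / 2) (\<lambda>y. g y / 2) (\<lambda>y. g y / 2)"

context
  fixes g :: "int \<Rightarrow> real"
  assumes g: "\<And>y. g y = 1 \<or> g y = 2" and g2: "\<And>y. g (y + 2) = 2 / g y"
begin

section \<open>Three rounds of renewal for weights with \<open>g (y + 2) = 2 / g y\<close>\<close>

lemma g_nz: "g y \<noteq> 0"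
  using g[of y] by auto

lemma g_prev2: "g (y - 2) = 2 / g y"
  using g2[of "y - 2"] g_nz[of "y - 2"] g_nz[of y] by (simp add: field_simps)

lemma g_neighbours: "g (y + 1) * g (y - 1) = 2"
proof -
  have "y - 1 + 2 = y + 1" by simp
  then have "g (y + 1) = 2 / g (y - 1)"
    using g2[of "y - 1"] by (simp only:)
  then show ?thesis
    using g_nz[of "y - 1"] by simp
qed

lemma g_next2: "g (y + 1 + 1) = 2 / g y"
  using g2[of y] by (simp only: add.assoc one_add_one)

lemma g_next2': "g (2 + y) = 2 / g y"
  using g2[of y] by (simp only: add.commute)

lemma g_prev2': "g (y - 1 - 1) = 2 / g y"
  using g_prev2[of y] by (simp add: diff_diff_eq)

text \<open>Values of \<open>g\<close> at distance 2 multiply to 2. Raising \<open>n\<close> by one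
  appends \<open>n + 1\<close> to one row and \<open>n + 3\<close> to the other, and likewise at the
  negative end, hence a factor 4.\<close>

lemma row_prod_row_prod:
  "(\<Prod>y = - int n..int n. g y) * (\<Prod>y = - int (n + 2)..int (n + 2). g y) = 2 ^ (2 * n + 3)"
proof (induction n)
  case 0
  have "{- 2..2 :: int} = {-2, -1, 0, 1, 2}"
    by auto
  then have "(\<Prod>y = - int 0..int 0. g y) * (\<Prod>y = - int (0 + 2)..int (0 + 2). g y) =
      (g 0 * g 2) * (g 0 * g (- 2)) * (g 1 * g (- 1))"
    by (simp add: mult_ac)
  also have "\<dots> = 2 * 2 * 2"
    using g2[of 0] g_prev2[of 0] g_neighbours[of 0] g_nz[of 0] by simp
  finally show ?case
    by simp
next
  case (Suc n)
  have 1: "g (int n + 3) = 2 / g (int n + 1)"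
    using g2[of "int n + 1"] by (simp add: add.commute)
  have 2: "g (- int n - 3) = 2 / g (- int n - 1)"
  proof -
    have "- int n - 1 - 2 = - int n - 3" by simp
    with g_prev2[of "- int n - 1"] show ?thesis by (simp only:)
  qed
  have eq: "int (n + 2) + 1 = int n + 3" "- int (n + 2) - 1 = - int n - 3" "Suc n + 2 = Suc (n + 2)"
    by simp_all
  have "(\<Prod>y = - int (Suc n)..int (Suc n). g y) * (\<Prod>y = - int (Suc n + 2)..int (Suc n + 2). g y) =
      ((\<Prod>y = - int n..int n. g y) * (\<Prod>y = - int (n + 2)..int (n + 2). g y)) *
      ((g (int n + 1) * g (int n + 3)) * (g (- int n - 1) * g (- int n - 3)))"
    unfolding eq(3) row_prod_Suc eq by (simp only: mult_ac)
  also have "\<dots> = 2 ^ (2 * n + 3) * (2 * 2)"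
    unfolding Suc.IH 1 2 using g_nz by simp
  also have "\<dots> = 2 ^ (2 * Suc n + 3)"
    by (simp add: power_add)
  finally show ?case .
qed

lemma aztec_step0:
  "aztec (Suc n) (\<lambda>y. g y / 2) (\<lambda>y. g y / 2) (\<lambda>y. g y / 2) =
   (\<Prod>c\<in>diamond (Suc n). g (snd c) ^ 2 / 2) *
   aztec n (\<lambda>y. 1 / g y) (\<lambda>y. 1 / g (y + 1)) (\<lambda>y. 1 / g (y - 1))"
  using aztec_Suc[of "\<lambda>y. g y ^ 2 / 2" "\<lambda>y. g y / 2" "\<lambda>y. g y / 2" "\<lambda>y. g y / 2" n] g_nz
  by (simp add: power2_eq_square)

text \<open>The denominator is \<open>1 / g y ^ 2 + 1 / 2\<close>, by \<open>g_neighbours\<close>.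
  It equals \<open>3 / 2\<close> for \<open>g y = 1\<close> and \<open>3 / 4\<close> for
  \<open>g y = 2\<close>, that is \<open>3 / (2 * g y)\<close> in both cases; here the factor 3
  enters.\<close>

lemma aztec_step1:
  "aztec (Suc n) (\<lambda>y. 1 / g y) (\<lambda>y. 1 / g (y + 1)) (\<lambda>y. 1 / g (y - 1)) =
   (\<Prod>c\<in>diamond (Suc n). 3 / (2 * g (snd c))) *
   aztec n (\<lambda>_. 2 / 3) (\<lambda>y. g y * g (y + 1) / 3) (\<lambda>y. g y * g (y - 1) / 3)"
proof -
  have D: "3 / (2 * g y) = (1 / g y) ^ 2 + 1 / g (y + 1) * (1 / g (y - 1))" for y
    using g[of y] g_neighbours[of y] by (auto simp: power2_eq_square)
  have h: "1 / g y / (3 / (2 * g y)) = 2 / 3" for y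
    using g_nz[of y] by simp
  have u: "1 / g (y + 1 + 1) / (3 / (2 * g (y + 1))) = g y * g (y + 1) / 3" for y
    by (simp add: g_next2 g_next2' g_nz)
  have d: "1 / g (y - 1 - 1) / (3 / (2 * g (y - 1))) = g y * g (y - 1) / 3" for y
    by (simp add: g_prev2 g_prev2' g_nz)
  show ?thesis
    by (subst aztec_Suc[OF D], simp_all only: h u d) (simp add: g_nz)
qed

text \<open>The denominator \<open>4 / 9 + 2 * g y ^ 2 / 9\<close> agrees with
  \<open>2 * g y / 3\<close> for both values of \<open>g y\<close>. Afterwards all edges of a cell
  are equal again, with weight \<open>1 / g y\<close>, which is half of the exchanged value
  \<open>2 / g y\<close>.\<close>

lemma aztec_step2:
  "aztec (Suc n) (\<lambda>_. 2 / 3) (\<lambda>y. g y * g (y + 1) / 3) (\<lambda>y. g y * g (y - 1) / 3) =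
   (\<Prod>c\<in>diamond (Suc n). 2 * g (snd c) / 3) * aztec n (\<lambda>y. 1 / g y) (\<lambda>y. 1 / g y) (\<lambda>y. 1 / g y)"
proof -
  have D: "2 * g y / 3 = (2 / 3) ^ 2 + g y * g (y + 1) / 3 * (g y * g (y - 1) / 3)" for y
  proof -
    have "g y * g (y + 1) / 3 * (g y * g (y - 1) / 3) = g y * g y * (g (y + 1) * g (y - 1)) / 9"
      by simp
    then show ?thesis
      using g[of y] unfolding g_neighbours by (auto simp: power2_eq_square simp del: times_divide_eq_left times_divide_eq_right)
  qed
  have h: "2 / 3 / (2 * g y / 3) = 1 / g y" for y
    by simp
  have u: "g (y + 1) * g (y + 1 + 1) / 3 / (2 * g (y + 1) / 3) = 1 / g y" for y
    by (simp add: g_next2 g_next2' g_nz)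
  have d: "g (y - 1) * g (y - 1 - 1) / 3 / (2 * g (y - 1) / 3) = 1 / g y" for y
    by (simp add: g_prev2 g_prev2' g_nz)
  show ?thesis
    by (subst aztec_Suc[OF D], simp_all only: h u d) (simp add: g_nz)
qed

text \<open>The products of \<open>g\<close> over diamonds of consecutive orders telescope to rows
  and leave \<open>q n * q (n + 2)\<close>, a power of 2. The constants \<open>3 / 2\<close> and
  \<open>2 / 3\<close> occur \<open>(n + 2) ^ 2\<close> and \<open>(n + 1) ^ 2\<close> times, so
  \<open>3 / 2\<close> survives with exponent \<open>2 * n + 3\<close>, which matches that power of
  2. The remaining \<open>G n\<close> is the prefactor of \<open>chi\<close> for
  \<open>2 / g\<close>.\<close>

lemma chi_step: "chi g (n + 3) = 3 ^ (2 * n + 3) * chi (\<lambda>y. 2 / g y) n"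
proof -
  define G where "G n = (\<Prod>c\<in>diamond n. g (snd c))" for n
  define q where "q n = (\<Prod>y = - int n..int n. g y)" for n
  let ?az = "aztec n (\<lambda>y. 1 / g y) (\<lambda>y. 1 / g y) (\<lambda>y. 1 / g y)"
  have G: "G (Suc n) = G n * q n" for n
    unfolding G_def q_def by (rule prod_diamond_Suc)
  have nz: "G n \<noteq> 0" "q n \<noteq> 0" for n
    by (simp_all add: G_def q_def g_nz finite_diamond)
  have sq: "q n * q (n + 2) = 2 ^ (2 * n + 3)"
    unfolding q_def by (rule row_prod_row_prod)
  have Suc: "n + 3 = Suc (Suc (Suc n))" "n + 2 = Suc (Suc n)" "n + 1 = Suc n"
    by simp_all
  have "chi g (n + 3) = (\<Prod>c\<in>diamond (n + 3). 2 / g (snd c) * (g (snd c) ^ 2 / 2)) *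
      ((\<Prod>c\<in>diamond (n + 2). 3 / (2 * g (snd c))) *
      ((\<Prod>c\<in>diamond (n + 1). 2 * g (snd c) / 3) * ?az))"
    unfolding chi_def Suc aztec_step0 aztec_step1 aztec_step2 prod.distrib by (simp only: mult.assoc)
  also have "(\<lambda>c. 2 / g (snd c) * (g (snd c) ^ 2 / 2)) = (\<lambda>c :: point. g (snd c))"
    using g_nz by (auto simp: power2_eq_square)
  also have "(\<Prod>c\<in>diamond (n + 2). 3 / (2 * g (snd c))) = (3 / 2) ^ (n + 2) ^ 2 / G (n + 2)"
  proof -
    have "(\<Prod>c\<in>diamond (n + 2). 3 / 2 / g (snd c)) = (3 / 2) ^ (n + 2) ^ 2 / G (n + 2)"
      unfolding prod_dividef prod_constant card_diamond G_def power_divide ..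
    then show ?thesis
      by simp
  qed
  also have "(\<Prod>c\<in>diamond (n + 1). 2 * g (snd c) / 3) = (2 / 3) ^ (n + 1) ^ 2 * G (n + 1)"
  proof -
    have "(\<Prod>c\<in>diamond (n + 1). 2 / 3 * g (snd c)) = (2 / 3) ^ (n + 1) ^ 2 * G (n + 1)"
      unfolding prod.distrib prod_constant card_diamond G_def ..
    then show ?thesis
      by simp
  qed
  also have "(\<Prod>c\<in>diamond (n + 3). g (snd c)) = G (n + 2) * q (n + 2)"
    using G[of "n + 2"] by (simp add: G_def numeral_3_eq_3)
  also have "G (n + 2) * q (n + 2) * ((3 / 2) ^ (n + 2) ^ 2 / G (n + 2) * ((2 / 3) ^ (n + 1) ^ 2 * G (n + 1) * ?az)) =
      (q n * q (n + 2)) * (3 / 2) ^ (2 * n + 3) * (G n * ?az)"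
  proof -
    have "(n + 2) ^ 2 = (n + 1) ^ 2 + (2 * n + 3)"
      by (simp add: power2_eq_square)
    then have "(3 / 2 :: real) ^ (n + 2) ^ 2 * (2 / 3) ^ (n + 1) ^ 2 =
        (3 / 2) ^ ((n + 1) ^ 2 + (2 * n + 3)) * (2 / 3) ^ (n + 1) ^ 2"
      by (simp only:)
    also have "\<dots> = (3 / 2 * (2 / 3)) ^ (n + 1) ^ 2 * (3 / 2) ^ (2 * n + 3)"
      unfolding power_mult_distrib power_add by (simp only: mult_ac)
    finally have "(3 / 2 :: real) ^ (n + 2) ^ 2 * (2 / 3) ^ (n + 1) ^ 2 =
        (3 / 2 * (2 / 3)) ^ (n + 1) ^ 2 * (3 / 2) ^ (2 * n + 3)" .
    then have p: "(3 / 2 :: real) ^ (n + 2) ^ 2 * (2 / 3) ^ (n + 1) ^ 2 = (3 / 2) ^ (2 * n + 3)"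
      by simp
    have "G (n + 2) * q (n + 2) * ((3 / 2) ^ (n + 2) ^ 2 / G (n + 2) * ((2 / 3) ^ (n + 1) ^ 2 * G (n + 1) * ?az)) =
      q (n + 2) * ((3 / 2) ^ (n + 2) ^ 2 * (2 / 3) ^ (n + 1) ^ 2) * (G (n + 1) * ?az)"
      using nz(1)[of "n + 2"] by simp
    also have "\<dots> = (q n * q (n + 2)) * (3 / 2) ^ (2 * n + 3) * (G n * ?az)"
      unfolding p using G[of n] by simp
    finally show ?thesis .
  qed
  also have "\<dots> = (2 * (3 / 2)) ^ (2 * n + 3) * (G n * ?az)"
    unfolding sq power_mult_distrib ..
  also have "G n * ?az = chi (\<lambda>y. 2 / g y) n"
    by (simp add: chi_def G_def)
  finally show ?thesis
    by simp
qed

lemma chi_0: "chi g 0 = 1"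
proof -
  have "diamond 0 = {}"
    by (auto simp: mem_diamond)
  then show ?thesis
    by (simp add: chi_def aztec_0)
qed

lemma chi_1: "chi g 1 = g 0"
proof -
  have "chi g 1 = (\<Prod>c\<in>diamond (Suc 0). 2 / g (snd c) * (g (snd c) ^ 2 / 2))"
    unfolding chi_def prod.distrib One_nat_def aztec_step0 aztec_0 by simp
  also have "\<dots> = (\<Prod>c\<in>diamond (Suc 0). g (snd c))"
    using g_nz by (simp add: power2_eq_square)
  finally show ?thesis
    by (simp add: prod_diamond_Suc prod_diamond_0)
qed

lemma chi_2: "chi g 2 = 3 * g 0"
proof -
  have "chi g 2 = (\<Prod>c\<in>diamond (Suc (Suc 0)). 2 / g (snd c) * (g (snd c) ^ 2 / 2)) *
      (\<Prod>c\<in>diamond (Suc 0). 3 / (2 * g (snd c)))"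
    unfolding chi_def prod.distrib numeral_2_eq_2 aztec_step0 aztec_step1 aztec_0 by simp
  also have "(\<lambda>c. 2 / g (snd c) * (g (snd c) ^ 2 / 2)) = (\<lambda>c :: point. g (snd c))"
    using g_nz by (auto simp: power2_eq_square)
  also have "(\<Prod>c\<in>diamond (Suc (Suc 0)). g (snd c)) = g 0 * (g 0 * (g 1 * g (- 1)))"
    using row_prod_Suc[of g 0] by (simp add: prod_diamond_Suc prod_diamond_0)
  also have "g 1 * g (- 1) = 2"
    using g_neighbours[of 0] by simp
  also have "(\<Prod>c\<in>diamond (Suc 0). 3 / (2 * g (snd c))) = 3 / (2 * g 0)"
    by (simp add: prod_diamond_Suc[of "\<lambda>y. 3 / (2 * g y)"] prod_diamond_0[of "\<lambda>y. 3 / (2 * g y)"])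
  finally show ?thesis
    using g_nz[of 0] by simp
qed

end

section \<open>From the dual graph to the Aztec diamond\<close>

lemma quad_image:
  assumes "inj_on f A" "{p, q, r, s} \<subseteq> A" "S \<subseteq> A"
  shows "quad (f p) (f q) (f r) (f s) a b c d (f ` S) = quad p q r s a b c d S"
proof -
  have "f ` S = f ` B \<longleftrightarrow> S = B" if "B \<subseteq> A" for B
    using assms that by (simp add: inj_on_image_eq_iff)
  from this[of "{}"] this[of "{p, q}"] this[of "{q, r}"] this[of "{r, s}"] this[of "{s, p}"]
    this[of "{p, q, r, s}"]
  show ?thesis
    using assms(2) by (simp add: quad_def)
qed

lemma quad_rotate: "quad r s p q 1 1 1 1 S = quad p q r s 1 1 1 1 S"
proof -
  have e: "{r, s, p, q} = {p, q, r, s}"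
    by auto
  have "(if Z then 1 else if C then 1 else if D then 1 else if A then 1 else if B then 1
      else if F then 1 * 1 + 1 * 1 else 0) =
    (if Z then 1 else if A then 1 else if B then 1 else if C then 1 else if D then 1
      else if F then 1 * 1 + 1 * 1 else (0 :: real))" for A B C D F Z
    by simp
  then show ?thesis
    unfolding quad_def e .
qed

lemma toggle_image:
  assumes "inj f"
  shows "toggle (f ` K) (f ` A) (f ` S) = f ` toggle K A S"
  using assms by (simp add: toggle_def image_Un image_Int image_set_diff)

lemma msum_pendants:
  assumes d: "distinct [a0, a1, b1, b0, t0, t1]" and S: "S \<subseteq> {a0, a1, b1, b0}"
  shows "msum (S \<union> {t0, t1}) (cycle4 t0 t1 b1 b0 \<union> {{t0, a0}, {t1, a1}}) (\<lambda>_. 1) =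
    quad a0 a1 b1 b0 1 1 1 1 (toggle {a0, a1} {a0, a1, b1, b0} S)"
proof -
  let ?E = "cycle4 t0 t1 b1 b0 \<union> {{t0, a0}, {t1, a1}}"
  define X where "X = toggle {a0, a1} {a0, a1, b1, b0} S"
  \<comment> \<open>\<open>f\<close> pulls the outer ends of the pendant edges back onto the cycle:
    \<open>a0\<close> lies in \<open>X\<close> precisely when \<open>t0\<close> remains for the
    cycle.\<close>
  define f where "f = id(a0 := t0, a1 := t1)"
  have f: "f a0 = t0" "f a1 = t1" "f b1 = b1" "f b0 = b0"
    using d by (auto simp: f_def)
  have finS: "finite S"
    using S by (rule finite_subset) simp
  have E0: "e = {a0, t0}" if "e \<in> ?E" "a0 \<in> e" for e
    using that d by (auto simp: cycle4_def)
  have E1: "e = {a1, t1}" if "e \<in> ?E" "a1 \<in> e" for e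
    using that d by (auto simp: cycle4_def)
  have mem: "{a0, t0} \<in> ?E" "{a1, t1} \<in> ?E"
    by (auto simp: insert_commute)
  have strip0: "msum V ?E (\<lambda>_. 1) = msum (V - {a0, t0}) ?E (\<lambda>_. 1)" if "finite V" "a0 \<in> V" "t0 \<in> V" for V
    using msum_forced[OF that mem(1) E0, of "\<lambda>_. 1"] by simp
  have strip1: "msum V ?E (\<lambda>_. 1) = msum (V - {a1, t1}) ?E (\<lambda>_. 1)" if "finite V" "a1 \<in> V" "t1 \<in> V" for V
    using msum_forced[OF that mem(2) E1, of "\<lambda>_. 1"] by simp
  have "msum (S \<union> {t0, t1}) ?E (\<lambda>_. 1) = msum (f ` X) ?E (\<lambda>_. 1)"
  proof -
    define B where "B = S \<inter> {b1, b0}"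
    have B: "a0 \<notin> B" "a1 \<notin> B" "t0 \<notin> B" "t1 \<notin> B"
      using d by (auto simp: B_def)
    have fB: "f ` B = B"
      using d by (auto simp: B_def f_def image_iff)
    have SB: "S = B \<union> (S \<inter> {a0, a1})"
      using S by (auto simp: B_def)
    have XB: "X = B \<union> ({a0, a1} - S)"
      using S d by (auto simp: X_def B_def toggle_def)
    have fX: "f ` X = B \<union> f ` ({a0, a1} - S)"
      unfolding XB image_Un fB ..
    have t: "a0 \<noteq> a1" "t0 \<noteq> t1" "a0 \<noteq> t0" "a1 \<noteq> t1" "a0 \<noteq> t1" "a1 \<noteq> t0"
      using d by auto
    consider "a0 \<in> S" "a1 \<in> S" | "a0 \<in> S" "a1 \<notin> S" | "a0 \<notin> S" "a1 \<in> S" | "a0 \<notin> S" "a1 \<notin> S"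
      by blast
    then show ?thesis
    proof cases
      case 1
      have "S \<union> {t0, t1} - {a0, t0} - {a1, t1} = f ` X"
        using SB 1 B t unfolding fX by auto
      then show ?thesis
        using strip0[of "S \<union> {t0, t1}"] strip1[of "S \<union> {t0, t1} - {a0, t0}"] 1 t finS by simp
    next
      case 2
      have "S \<union> {t0, t1} - {a0, t0} = f ` X"
        using SB 2 B t f unfolding fX by auto
      then show ?thesis
        using strip0[of "S \<union> {t0, t1}"] 2 finS by simp
    next
      case 3
      have "S \<union> {t0, t1} - {a1, t1} = f ` X"
        using SB 3 B t f unfolding fX by auto
      then show ?thesis
        using strip1[of "S \<union> {t0, t1}"] 3 finS by simp
    next
      case 4
      have "S \<union> {t0, t1} = f ` X"
        using SB 4 B t f unfolding fX by auto
      then show ?thesis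
        by simp
    qed
  qed
  also have "\<dots> = msum (f ` X) (cycle4 t0 t1 b1 b0) (\<lambda>_. 1)"
  proof (rule msum_cong)
    fix e assume e: "e \<subseteq> f ` X"
    have "X \<subseteq> {a0, a1, b1, b0}"
      using S by (auto simp: X_def toggle_def)
    then have "f ` X \<subseteq> {t0, t1, b1, b0}"
      using f by blast
    with e have "e \<subseteq> {t0, t1, b1, b0}"
      by (rule subset_trans)
    then have "a0 \<notin> e" "a1 \<notin> e"
      using d by auto
    then show "e \<in> ?E \<longleftrightarrow> e \<in> cycle4 t0 t1 b1 b0"
      by auto
  qed
  also have "\<dots> = quad t0 t1 b1 b0 1 1 1 1 (f ` X)"
    using d by (subst msum_cycle4) auto
  also have "\<dots> = quad a0 a1 b1 b0 1 1 1 1 X"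
  proof -
    have "inj_on f {a0, a1, b1, b0}"
      using d by (auto simp: f_def inj_on_def)
    moreover have "X \<subseteq> {a0, a1, b1, b0}"
      using S by (auto simp: X_def toggle_def)
    ultimately show ?thesis
      using quad_image[of f "{a0, a1, b1, b0}" a0 a1 b1 b0 X 1 1 1 1] by (simp only: f subset_refl)
  qed
  finally show ?thesis
    unfolding X_def .
qed

text \<open>The elementary regions in the column \<open>[x, x + 1]\<close> are numbered upwards by slots \<open>s\<close>: \<open>3 * k\<close> and
  \<open>3 * k + 1\<close> are the triangles in the strip over \<open>y = 2 * k\<close>, and \<open>3 * k + 2\<close> is the square above.
  Slot \<open>level y\<close> is the first one above height \<open>y\<close>.\<close>

definition level :: "int \<Rightarrow> int" where
  "level y = y + (y + 1) div 2"

text \<open>A square always has a vertical right side. Of the two triangles of a cut unit square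
  only one has it: the lower one where the diagonal rises, the upper one where it falls.\<close>

definition hadj :: "int \<Rightarrow> int \<Rightarrow> bool" where
  "hadj x s \<longleftrightarrow> s mod 3 = 2 \<or> s mod 3 = 0 \<and> even x \<or> s mod 3 = 1 \<and> odd x"

section \<open>The dual graph in coordinates of columns and slots\<close>

definition dual_edges :: "point set set" where
  "dual_edges = {{(x, s), (x, s + 1)} | x s. True} \<union> {{(x, s), (x + 1, s)} | x s. hadj x s}"

lemma level_even: "level (2 * k) = 3 * k"
  and level_odd: "level (2 * k + 1) = 3 * k + 2"
  by (simp_all add: level_def)

lemma level_pred: "level (2 * k - 1) = 3 * k - 1"
  using level_odd[of "k - 1"] by (simp add: level_def)

lemma parity_cases:
  fixes y :: int
  obtains k where "y = 2 * k" | k where "y = 2 * k + 1"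
  by (metis evenE oddE)

text \<open>At even \<open>y\<close> the unit square is cut, and one of its triangles has to
  represent it. For alternating \<open>l\<close> the choice made here is the triangle bordering the
  height, \<open>y\<close> or \<open>y + 1\<close>, that is not light.\<close>

definition main_row :: "(int \<Rightarrow> bool) \<Rightarrow> int \<Rightarrow> int" where
  "main_row l y = level y + of_bool (even y \<and> l y)"

text \<open>Of the unit squares above and below a lattice edge at height \<open>y\<close> one is
  cut, the upper one for even \<open>y\<close> and the lower one for odd \<open>y\<close>. This is
  its triangle bordering that height, and \<open>pend_row\<close> is the one across the
  diagonal.\<close>

definition tri_row :: "int \<Rightarrow> int" where
  "tri_row y = (if even y then level y else level y - 1)"

definition pend_row :: "int \<Rightarrow> int" where
  "pend_row y = (if even y then level y + 1 else level y - 2)"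

text \<open>Both triangles of a cut unit square give the same quotient, so the height is recovered
  whichever of them was chosen.\<close>

lemma strip_main_row: "2 * main_row l y div 3 = y"
  by (cases y rule: parity_cases) (auto simp: main_row_def level_even level_odd)

text \<open>The shift by \<open>n\<close> moves the centre of the Aztec diamond to the symmetry axis
  \<open>x = n\<close> of the regions.\<close>

fun embed :: "nat \<Rightarrow> (int \<Rightarrow> bool) \<Rightarrow> point \<Rightarrow> point" where
  "embed n l (x, y) = (x + int n, main_row l y)"

lemma inj_embed: "inj (embed n l)"
proof (rule injI)
  fix u v assume "embed n l u = embed n l v"
  then show "u = v"
    by (cases u; cases v) (auto dest: arg_cong[where f = "\<lambda>s. 2 * s div 3"] simp: strip_main_row)
qed

fun priv :: "nat \<Rightarrow> (int \<Rightarrow> bool) \<Rightarrow> point \<Rightarrow> point set" where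
  "priv n l (x, y) =
    (if l y then {(x + int n - 1, tri_row y), (x + int n, tri_row y)} else {})"

fun ring :: "nat \<Rightarrow> point \<Rightarrow> point set set" where
  "ring n (x, y) = cycle4 (x + int n - 1, level y - 1) (x + int n, level y - 1)
     (x + int n, level y) (x + int n - 1, level y)"

fun links :: "nat \<Rightarrow> (int \<Rightarrow> bool) \<Rightarrow> point \<Rightarrow> point set set" where
  "links n l (x, y) = (if l y then
     {{(x + int n - 1, tri_row y), (x + int n - 1, pend_row y)},
      {(x + int n, tri_row y), (x + int n, pend_row y)}} else {})"

lemma mod3_cases:
  fixes s :: int
  obtains k where "s = 3 * k" | k where "s = 3 * k + 1" | k where "s = 3 * k + 2"
proof -
  have "\<exists>k. s = 3 * k \<or> s = 3 * k + 1 \<or> s = 3 * k + 2"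
    by presburger
  then show ?thesis
    using that by blast
qed

text \<open>Each horizontal or vertical lattice edge has exactly one end with odd coordinate sum,
  which carries no diagonal, so the dual edge crossing it belongs to the 4-cycle around that end.
  The dual edges that are left cross diagonals.\<close>

lemma dual_edge_cases:
  assumes "e \<in> dual_edges"
  obtains x y where "odd (x + y - int n)" "e \<in> ring n (x, y)"
  | x k where "e = {(x, 3 * k), (x, 3 * k + 1)}"
proof -
  from assms consider (v) x s where "e = {(x, s), (x, s + 1)}" | (h) x s where "e = {(x, s), (x + 1, s)}" "hadj x s"
    by (auto simp: dual_edges_def)
  then show ?thesis
  proof cases
    case v
    show ?thesis
    proof (cases s rule: mod3_cases)
      case (1 k)
      then show ?thesis
        using that(2) v by blast
    next
      case (2 k)
      then have "e \<in> ring n (x - int n, 2 * k + 1)" "e \<in> ring n (x + 1 - int n, 2 * k + 1)"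
        by (simp_all add: v level_odd cycle4_def doubleton_eq_iff)
      moreover have "odd (x - int n + (2 * k + 1) - int n) \<or> odd (x + 1 - int n + (2 * k + 1) - int n)"
        by presburger
      ultimately show ?thesis
        using that(1) by blast
    next
      case (3 k)
      have l: "level (2 * k + 2) = 3 * k + 3"
        using level_even[of "k + 1"] by (simp add: algebra_simps)
      have "e \<in> ring n (x - int n, 2 * k + 2)" "e \<in> ring n (x + 1 - int n, 2 * k + 2)"
        using 3 by (simp_all add: v l cycle4_def doubleton_eq_iff)
      moreover have "odd (x - int n + (2 * k + 2) - int n) \<or> odd (x + 1 - int n + (2 * k + 2) - int n)"
        by presburger
      ultimately show ?thesis
        using that(1) by blast
    qed
  next
    case h
    show ?thesis
    proof (cases s rule: mod3_cases)
      case (1 k)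
      then have x: "even x"
        using h(2) by (auto simp: hadj_def)
      from 1 have "e \<in> ring n (x + 1 - int n, 2 * k)"
        by (simp_all add: h(1) level_even cycle4_def doubleton_eq_iff)
      moreover have "odd (x + 1 - int n + 2 * k - int n)"
        using x by presburger
      ultimately show ?thesis
        using that(1) by blast
    next
      case (2 k)
      then have x: "odd x"
        using h(2) by (auto simp: hadj_def)
      from 2 have "e \<in> ring n (x + 1 - int n, 2 * k + 1)"
        by (simp_all add: h(1) level_odd cycle4_def doubleton_eq_iff)
      moreover have "odd (x + 1 - int n + (2 * k + 1) - int n)"
        using x by presburger
      ultimately show ?thesis
        using that(1) by blast
    next
      case (3 k)
      have l: "level (2 * k + 2) = 3 * k + 3"
        using level_even[of "k + 1"] by (simp add: algebra_simps)
      have "e \<in> ring n (x + 1 - int n, 2 * k + 1)" "e \<in> ring n (x + 1 - int n, 2 * k + 2)"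
        using 3 by (simp_all add: h(1) level_odd l cycle4_def doubleton_eq_iff)
      moreover have "odd (x + 1 - int n + (2 * k + 1) - int n) \<or> odd (x + 1 - int n + (2 * k + 2) - int n)"
        by presburger
      ultimately show ?thesis
        using that(1) by blast
    qed
  qed
qed

lemma vertical_dual_edge: "{(x, s), (x, s + 1)} \<in> dual_edges" "{(x, s), (x, s - 1)} \<in> dual_edges"
proof -
  show "{(x, s), (x, s + 1)} \<in> dual_edges"
    by (auto simp: dual_edges_def)
  have "{(x, s - 1), (x, s - 1 + 1)} \<in> dual_edges"
    unfolding dual_edges_def by blast
  then show "{(x, s), (x, s - 1)} \<in> dual_edges"
    by (simp add: insert_commute)
qed

lemma ring_dual_edges:
  assumes "odd (x + y - int n)"
  shows "ring n (x, y) \<subseteq> dual_edges"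
proof -
  let ?x = "x + int n" and ?s = "level y"
  have "hadj (?x - 1) (?s - 1) \<and> hadj (?x - 1) ?s"
  proof (cases y rule: parity_cases)
    case (1 k)
    moreover have "(3 * k - 1) mod 3 = 2"
      by presburger
    ultimately show ?thesis
      using assms by (auto simp: hadj_def level_even)
  next
    case (2 k)
    moreover have "(3 * k + 1) mod 3 = 1" "(3 * k + 2) mod 3 = 2"
      by presburger+
    ultimately show ?thesis
      using assms by (auto simp: hadj_def level_odd)
  qed
  then have "{(?x - 1, ?s - 1), (?x - 1 + 1, ?s - 1)} \<in> dual_edges" "{(?x - 1, ?s), (?x - 1 + 1, ?s)} \<in> dual_edges"
    unfolding dual_edges_def by blast+
  then show ?thesis
    using vertical_dual_edge(2) by (simp add: cycle4_def insert_commute)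
qed

lemma links_dual_edges: "links n l c \<subseteq> dual_edges"
proof -
  obtain x y where c: "c = (x, y)" by fastforce
  have "{(u, tri_row y), (u, pend_row y)} \<in> dual_edges" for u
    using vertical_dual_edge[of u "level y"] vertical_dual_edge[of u "level y - 1"]
    by (simp add: tri_row_def pend_row_def)
  then show ?thesis
    by (simp add: c)
qed

text \<open>Different lattice points of one parity class are never neighbours in a row or column, so
  their cells share at most one square; hence such cells have no edge in common.\<close>

lemma two_corners:
  assumes c: "c \<in> diamond n" "c' \<in> diamond n" and v: "v \<in> corner c" "v \<in> corner c'"
    and w: "w \<in> corner c" "w \<in> corner c'" and "v \<noteq> w"
  shows "c = c'"
proof -
  obtain x y x' y' where xy: "c = (x, y)" "c' = (x', y')" by fastforce
  have p: "even (x - x' + (y - y'))"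
    using c by (auto simp: xy mem_diamond)
  have near: "x - 1 \<le> fst u \<and> fst u \<le> x \<and> y - 1 \<le> snd u \<and> snd u \<le> y"
    if "u \<in> corner (x, y)" for u x y
    using that by auto
  note nv = near[OF v(1)[unfolded xy]] near[OF v(2)[unfolded xy]]
  note nw = near[OF w(1)[unfolded xy]] near[OF w(2)[unfolded xy]]
  have "fst v = fst w" if "x \<noteq> x'"
    using that nv nw by linarith
  moreover have "snd v = snd w" if "y \<noteq> y'"
    using that nv nw by linarith
  ultimately have or: "x = x' \<or> y = y'"
    using \<open>v \<noteq> w\<close> by (auto simp: prod_eq_iff)
  have small: "\<bar>x - x'\<bar> \<le> 1" "\<bar>y - y'\<bar> \<le> 1"
    using nv by linarith+
  have zero: "z = 0" if "even z" "\<bar>z\<bar> \<le> 1" for z :: int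
    using that by presburger
  have "x = x' \<and> y = y'"
    using or
  proof
    assume "x = x'"
    then show ?thesis
      using p zero[OF _ small(2)] by simp
  next
    assume "y = y'"
    then show ?thesis
      using p zero[OF _ small(1)] by simp
  qed
  then show ?thesis
    by (simp add: xy)
qed

lemma corner_diamond:
  assumes "(u, v) \<in> squares N" "(u, v) \<in> corner (x, y)" "odd (x + y - int (Suc N))"
  shows "(x, y) \<in> diamond (Suc N)"
proof -
  have "x + y \<noteq> int N + 1" "x + y \<noteq> - int N - 1" "x - y \<noteq> int N + 1" "x - y \<noteq> - int N - 1"
    using assms(3) by presburger+
  moreover have "\<bar>x + y\<bar> \<le> int N + 1" "\<bar>x - y\<bar> \<le> int N + 1"
    using assms(1,2) by (auto simp: mem_squares)
  ultimately show ?thesis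
    using assms(3) by (auto simp: mem_diamond)
qed

lemma edge_diamond:
  assumes "{(x - 1, v), (x, v)} \<subseteq> squares N" "v = y \<or> v = y - 1" "odd (x + y - int N)"
  shows "(x, y) \<in> diamond N"
proof -
  have "x + y \<noteq> int N" "x + y \<noteq> - int N" "x - y \<noteq> int N" "x - y \<noteq> - int N"
    using assms(3) by presburger+
  moreover have "\<bar>x + y\<bar> \<le> int N" "\<bar>x - y\<bar> \<le> int N"
    using assms(1,2) by (auto simp: mem_squares)
  ultimately show ?thesis
    using assms(3) by (auto simp: mem_diamond)
qed

text \<open>At a height \<open>y\<close> with \<open>l y\<close> (a light height) the 4-cycles are kept, with the diagonals attached as
  pendant edges; at the other heights they are renewed. Each pair of triangles sharing a diagonal is
  thereby merged into one vertex, represented by the triangle \<open>embed\<close> in the renewed cell; the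
  other triangle belongs to the set \<open>priv\<close> of its light cell.\<close>

definition alternating :: "(int \<Rightarrow> bool) \<Rightarrow> bool" where
  "alternating l \<longleftrightarrow> (\<forall>y. l (y + 1) \<longleftrightarrow> (if even y then \<not> l y else l y))"

text \<open>The squares that the reduction complements. In a cut strip the renewal does it at the
  heavy height and the pendant edges do it at the light one. A square of an uncut strip lies between
  heights that agree and is complemented when they are heavy.\<close>

definition toggled :: "(int \<Rightarrow> bool) \<Rightarrow> point set" where
  "toggled l = {(x, y). even y \<or> \<not> l y}"

text \<open>Renewing a 4-cycle of unit weights divides by \<open>1 * 1 + 1 * 1\<close>, hence the
  weight \<open>1 / 2\<close> at heavy heights.\<close>

definition half :: "(int \<Rightarrow> bool) \<Rightarrow> int \<Rightarrow> real" where
  "half l y = (if l y then 1 else 1 / 2)"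

text \<open>The vertex set on which the reduction to \<open>squares n\<close> is exact. A rim square
  lies in one cell only, so if it is complemented it has to be absent before in order to be present
  afterwards; hence the smaller diamond for the squares in \<open>toggled l\<close>.\<close>

definition core :: "(int \<Rightarrow> bool) \<Rightarrow> nat \<Rightarrow> point set" where
  "core l n = embed n l ` {v \<in> squares n. v \<in> toggled l \<longrightarrow> v \<in> squares (n - 1)} \<union>
     (\<Union>c\<in>diamond n. priv n l c)"

lemma alternating_even: "alternating l \<Longrightarrow> even y \<Longrightarrow> l (y + 1) \<longleftrightarrow> \<not> l y"
  and alternating_odd: "alternating l \<Longrightarrow> odd y \<Longrightarrow> l (y + 1) \<longleftrightarrow> l y"
  by (simp_all add: alternating_def)

context
  fixes l :: "int \<Rightarrow> bool"
  assumes alt: "alternating l"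
begin

section \<open>The core as a net of light and heavy cells\<close>

lemmas l_even = alternating_even[OF alt] and l_odd = alternating_odd[OF alt]

lemma heavy_rows: "\<not> l y \<Longrightarrow> main_row l (y - 1) = level y - 1 \<and> main_row l y = level y"
proof (cases y rule: parity_cases)
  case (1 k)
  then show ?thesis if "\<not> l y"
    using that by (simp add: main_row_def level_even level_pred)
next
  case (2 k)
  then show ?thesis if "\<not> l y"
    using that l_even[of "2 * k"] by (simp add: main_row_def level_even level_odd)
qed

lemma light_even_rows:
  "even y \<Longrightarrow> l y \<Longrightarrow> main_row l (y - 1) = level y - 1 \<and> main_row l y = level y + 1"
  by (elim evenE) (simp add: main_row_def level_even level_pred)

lemma light_odd_rows:
  "odd y \<Longrightarrow> l y \<Longrightarrow> main_row l (y - 1) = level y - 2 \<and> main_row l y = level y"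
  using l_even[of "y - 1"] by (elim oddE) (simp add: main_row_def level_even level_odd)

lemma embed_notin_priv: "embed n l v \<notin> priv n l c"
proof -
  obtain u w x y where uw: "v = (u, w)" "c = (x, y)" by fastforce
  have "main_row l w \<noteq> tri_row y" if "l y"
  proof
    assume eq: "main_row l w = tri_row y"
    then have w: "w = 2 * tri_row y div 3"
      using strip_main_row[of l w] by simp
    show False
    proof (cases y rule: parity_cases)
      case (1 k)
      then have "w = y"
        by (simp add: w tri_row_def level_even)
      then show False
        using eq that 1 by (simp add: main_row_def tri_row_def)
    next
      case (2 k)
      then have "w = y - 1"
        by (simp add: w tri_row_def level_odd)
      then show False
        using eq that 2 l_even[of "2 * k"] by (simp add: main_row_def tri_row_def level_even level_odd)
    qed
  qed
  then show ?thesis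
    by (auto simp: uw)
qed

lemma tri_row_inj: "tri_row y = tri_row y' \<Longrightarrow> y = y'"
  by (cases y rule: parity_cases; cases y' rule: parity_cases;
      simp add: tri_row_def level_even level_odd; presburger)

lemma priv_unique:
  assumes "a \<in> priv n l (x, y)" "a \<in> priv n l (x', y')"
    and "odd (x + y - int n)" "odd (x' + y' - int n)"
  shows "(x, y) = (x', y')"
proof -
  have y: "y = y'"
    using assms(1,2) tri_row_inj by (auto split: if_splits)
  have "\<bar>x - x'\<bar> \<le> 1"
    using assms(1,2) by (auto split: if_splits)
  moreover have "even (x - x')"
    using assms(3,4) unfolding y by presburger
  ultimately have "x = x'"
    by presburger
  then show ?thesis
    using y by simp
qed

lemma corner_toggled_heavy: "\<not> l y \<Longrightarrow> corner (x, y) \<subseteq> (toggled l)"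
  using l_odd[of "y - 1"] by (auto simp: toggled_def)

lemma corner_toggled_light:
  assumes "l y"
  shows "corner (x, y) \<inter> (toggled l) = (if even y then {(x, y), (x - 1, y)} else {(x - 1, y - 1), (x, y - 1)})"
  using assms l_odd[of "y - 1"] by (auto simp: toggled_def)

text \<open>All four squares of a heavy cell are complemented, so this is renewal of a 4-cycle with
  unit weights, whose denominator is 2.\<close>

lemma heavy_cell:
  assumes l: "\<not> l y" and S: "S \<subseteq> corner (x, y)"
  shows "msum (embed n l ` S \<union> priv n l (x, y)) (ring n (x, y) \<union> links n l (x, y)) (\<lambda>_. 1) =
    2 * corner_quad (1 / 2) (1 / 2) (1 / 2) (x, y) (toggle (toggled l) (corner (x, y)) S)"
proof -
  let ?J = "embed n l" and ?p = "(x - 1, y - 1)" and ?q = "(x, y - 1)" and ?r = "(x, y)" and ?s = "(x - 1, y)"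
  have ring: "ring n (x, y) = cycle4 (?J ?p) (?J ?q) (?J ?r) (?J ?s)"
    using heavy_rows[OF l] by (simp add: diff_add_eq)
  have d: "distinct [?J ?p, ?J ?q, ?J ?r, ?J ?s]"
    using heavy_rows[OF l] by simp
  have "toggle (toggled l) (corner (x, y)) S = corner (x, y) - S"
    using corner_toggled_heavy[OF l] S unfolding toggle_def by blast
  moreover have "msum (?J ` S) (ring n (x, y)) (\<lambda>_. 1) = quad ?p ?q ?r ?s 1 1 1 1 S"
    unfolding ring msum_cycle4[OF d]
    by (rule quad_image[where A = UNIV]) (use inj_embed in auto)
  moreover have "\<dots> = 2 * quad ?p ?q ?r ?s (1 / 2) (1 / 2) (1 / 2) (1 / 2) ({?p, ?q, ?r, ?s} - S)"
    by (rule quad_complement) (use S in auto)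
  ultimately show ?thesis
    using l by simp
qed

text \<open>The pendant edges by themselves complement the two squares on the cut side, so the
  4-cycle keeps its weights and no factor arises.\<close>

lemma light_cell:
  assumes l: "l y" and S: "S \<subseteq> corner (x, y)"
  shows "msum (embed n l ` S \<union> priv n l (x, y)) (ring n (x, y) \<union> links n l (x, y)) (\<lambda>_. 1) =
    corner_quad 1 1 1 (x, y) (toggle (toggled l) (corner (x, y)) S)"
proof -
  \<comment> \<open>This covers both positions of the cut side: \<open>t0\<close>, \<open>t1\<close>
    are the triangles in the 4-cycle, and \<open>a0\<close>, \<open>a1\<close> stand for the
    triangles across the diagonals.\<close>
  have gen: "msum (embed n l ` S \<union> priv n l (x, y)) (ring n (x, y) \<union> links n l (x, y)) (\<lambda>_. 1) =
      quad a0 a1 b1 b0 1 1 1 1 (toggle (toggled l) (corner (x, y)) S)"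
    if c: "corner (x, y) = {a0, a1, b1, b0}" and T: "corner (x, y) \<inter> (toggled l) = {a0, a1}"
      and d: "distinct [embed n l a0, embed n l a1, embed n l b1, embed n l b0, t0, t1]"
      and p: "priv n l (x, y) = {t0, t1}"
      and r: "ring n (x, y) = cycle4 t0 t1 (embed n l b1) (embed n l b0)"
      and k: "links n l (x, y) = {{t0, embed n l a0}, {t1, embed n l a1}}"
    for a0 a1 b1 b0 t0 t1
  proof -
    let ?J = "embed n l"
    have JS: "?J ` S \<subseteq> {?J a0, ?J a1, ?J b1, ?J b0}"
      using S unfolding c by blast
    have "msum (?J ` S \<union> priv n l (x, y)) (ring n (x, y) \<union> links n l (x, y)) (\<lambda>_. 1) =
        quad (?J a0) (?J a1) (?J b1) (?J b0) 1 1 1 1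
          (toggle {?J a0, ?J a1} {?J a0, ?J a1, ?J b1, ?J b0} (?J ` S))"
      unfolding p r k by (rule msum_pendants[OF d JS])
    also have "toggle {?J a0, ?J a1} {?J a0, ?J a1, ?J b1, ?J b0} (?J ` S) =
        ?J ` toggle {a0, a1} {a0, a1, b1, b0} S"
      using toggle_image[OF inj_embed[of n l], of "{a0, a1}" "{a0, a1, b1, b0}" S] by simp
    also have "toggle {a0, a1} {a0, a1, b1, b0} S = toggle (toggled l) (corner (x, y)) S"
      using S T unfolding c[symmetric] toggle_def by blast
    also have "quad (?J a0) (?J a1) (?J b1) (?J b0) 1 1 1 1 (?J ` toggle (toggled l) (corner (x, y)) S) =
        quad a0 a1 b1 b0 1 1 1 1 (toggle (toggled l) (corner (x, y)) S)"
      by (rule quad_image[where A = UNIV]) (use inj_embed in auto)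
    finally show ?thesis .
  qed
  show ?thesis
  proof (cases "even y")
    case True
    note rows = light_even_rows[OF True l]
    have T: "corner (x, y) \<inter> (toggled l) = {(x, y), (x - 1, y)}"
      unfolding corner_toggled_light[OF l] using True by simp
    \<comment> \<open>For even \<open>y\<close> the triangles lie above the lattice point, so the
      cycle is listed from its upper side.\<close>
    have "msum (embed n l ` S \<union> priv n l (x, y)) (ring n (x, y) \<union> links n l (x, y)) (\<lambda>_. 1) =
      quad (x, y) (x - 1, y) (x - 1, y - 1) (x, y - 1) 1 1 1 1 (toggle (toggled l) (corner (x, y)) S)"
      using rows True l
      by (intro gen[OF _ T, where ?t0.0 = "(x + int n, tri_row y)" and ?t1.0 = "(x + int n - 1, tri_row y)"])
        (auto simp: tri_row_def pend_row_def cycle4_def diff_add_eq)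
    also have "\<dots> = corner_quad 1 1 1 (x, y) (toggle (toggled l) (corner (x, y)) S)"
      unfolding corner_quad.simps by (rule quad_rotate)
    finally show ?thesis .
  next
    case False
    note rows = light_odd_rows[OF False l]
    have T: "corner (x, y) \<inter> (toggled l) = {(x - 1, y - 1), (x, y - 1)}"
      unfolding corner_toggled_light[OF l] using False by simp
    have "msum (embed n l ` S \<union> priv n l (x, y)) (ring n (x, y) \<union> links n l (x, y)) (\<lambda>_. 1) =
      quad (x - 1, y - 1) (x, y - 1) (x, y) (x - 1, y) 1 1 1 1 (toggle (toggled l) (corner (x, y)) S)"
      using rows False l
      by (intro gen[OF _ T, where ?t0.0 = "(x + int n - 1, tri_row y)" and ?t1.0 = "(x + int n, tri_row y)"])
        (auto simp: tri_row_def pend_row_def cycle4_def diff_add_eq)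
    then show ?thesis
      by simp
  qed
qed

text \<open>A 4-cycle around a lattice point outside the diamond must not contribute an edge inside
  the core. At heavy heights the missing rim squares prevent it; at light heights such a point owns
  no private triangle, and the two squares on its uncut side cannot both be present.\<close>

lemma core_cover:
  assumes e: "e \<in> dual_edges" "e \<subseteq> core l (Suc N)"
  shows "\<exists>c\<in>diamond (Suc N). e \<in> ring (Suc N) c \<union> links (Suc N) l c"
  using e(1)
proof (cases rule: dual_edge_cases[where n = "Suc N"])
  case (1 x y)
  let ?n = "Suc N"
  have main: "v \<in> squares ?n \<and> (v \<in> (toggled l) \<longrightarrow> v \<in> squares N)" if "embed ?n l v \<in> e" for v
  proof -
    have "embed ?n l v \<in> core l ?n"
      using that e(2) by blast
    moreover have "embed ?n l v \<notin> (\<Union>c\<in>diamond ?n. priv ?n l c)"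
      using embed_notin_priv by blast
    ultimately have "embed ?n l v \<in> embed ?n l ` {v \<in> squares ?n. v \<in> (toggled l) \<longrightarrow> v \<in> squares (?n - 1)}"
      unfolding core_def by blast
    then show ?thesis
      unfolding inj_image_mem_iff[OF inj_embed] by simp
  qed
  have "(x, y) \<in> diamond ?n"
  proof (cases "l y")
    case False
    have "e \<subseteq> embed ?n l ` corner (x, y)" "e \<noteq> {}"
      using 1(2) heavy_rows[OF False] by (auto simp: cycle4_def diff_add_eq)
    then obtain v where v: "v \<in> corner (x, y)" "embed ?n l v \<in> e"
      by blast
    then have "v \<in> squares N"
      using main corner_toggled_heavy[OF False] by blast
    then show ?thesis
      using corner_diamond[of "fst v" "snd v"] v(1) 1(1) by simp
  next
    case True
    \<comment> \<open>A triangle in \<open>priv\<close> determines its light cell among the points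
      of this parity, so its presence in the core puts that cell into the diamond.\<close>
    have inP: "(x, y) \<in> diamond ?n" if t: "t \<in> priv ?n l (x, y)" "t \<in> e" for t
    proof -
      have "t \<in> core l ?n"
        using t(2) e(2) by blast
      then obtain c where c: "c \<in> diamond ?n" "t \<in> priv ?n l c"
        using t(1) embed_notin_priv unfolding core_def by blast
      obtain x' y' where "c = (x', y')" by fastforce
      with c t(1) 1(1) show ?thesis
        using priv_unique[of t ?n x y x' y'] by (auto simp: mem_diamond simp del: priv.simps)
    qed
    show ?thesis
    proof (cases "even y")
      case ev: True
      have "(\<exists>t\<in>priv ?n l (x, y). t \<in> e) \<or> e = embed ?n l ` {(x - 1, y - 1), (x, y - 1)}"
        using 1(2) True ev light_even_rows[OF ev True] by (auto simp: cycle4_def tri_row_def diff_add_eq)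
      then show ?thesis
        using inP main edge_diamond[of x "y - 1" ?n y] 1(1) by blast
    next
      case od: False
      have "(\<exists>t\<in>priv ?n l (x, y). t \<in> e) \<or> e = embed ?n l ` {(x - 1, y), (x, y)}"
        using 1(2) True od light_odd_rows[OF od True] by (auto simp: cycle4_def tri_row_def diff_add_eq)
      then show ?thesis
        using inP main edge_diamond[of x y ?n y] 1(1) by blast
    qed
  qed
  then show ?thesis
    using 1(2) by blast
next
  case (2 u k)
  let ?n = "Suc N"
  have strip: "w = 2 * k" if "main_row l w = 3 * k \<or> main_row l w = 3 * k + 1" for w
    using that strip_main_row[of l w] by auto
  have in_core: "(u, s) \<in> core l ?n" if "s = 3 * k \<or> s = 3 * k + 1" for s
    using that e(2) 2 by auto
  have P: "\<exists>c\<in>diamond ?n. (u, s) \<in> priv ?n l c" if "(u, s) \<in> core l ?n" "\<And>w. main_row l w \<noteq> s" for s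
  proof -
    have "(u, s) \<noteq> embed ?n l v" for v
      using that(2)[of "snd v"] by (cases v) auto
    then show ?thesis
      using that(1) unfolding core_def by blast
  qed
  \<comment> \<open>Exactly one of the two triangles at the diagonal is not a main vertex. Being in
    the core, it is private to a light cell of the diamond, and that cell has the diagonal among its
    links.\<close>
  show ?thesis
  proof (cases "l (2 * k)")
    case True
    have "main_row l w \<noteq> 3 * k" for w
      using strip[of w] True by (auto simp: main_row_def level_even)
    then obtain c where c: "c \<in> diamond ?n" "(u, 3 * k) \<in> priv ?n l c"
      using P in_core by blast
    obtain x y where xy: "c = (x, y)" by fastforce
    have "tri_row y = tri_row (2 * k)"
      using c(2) by (auto simp: xy tri_row_def[of "2 * k"] level_even split: if_splits)
    then have "y = 2 * k"
      by (rule tri_row_inj)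
    then have "e \<in> links ?n l c"
      using c(2) by (auto simp: 2 xy tri_row_def pend_row_def level_even split: if_splits)
    then show ?thesis
      using c(1) by blast
  next
    case False
    have "main_row l w \<noteq> 3 * k + 1" for w
      using strip[of w] False by (auto simp: main_row_def level_even)
    then obtain c where c: "c \<in> diamond ?n" "(u, 3 * k + 1) \<in> priv ?n l c"
      using P in_core by blast
    obtain x y where xy: "c = (x, y)" by fastforce
    have "tri_row y = tri_row (2 * k + 1)"
      using c(2) by (auto simp: xy tri_row_def[of "2 * k + 1"] level_odd split: if_splits)
    then have "y = 2 * k + 1"
      by (rule tri_row_inj)
    then have "e \<in> links ?n l c"
      using c(2) by (auto simp: 2 xy tri_row_def pend_row_def level_odd insert_commute split: if_splits)
    then show ?thesis
      using c(1) by blast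
  qed
qed

lemma cell_edge_vertices:
  assumes "e \<in> ring n c \<union> links n l c"
  shows "e \<subseteq> embed n l ` corner c \<union> priv n l c" "\<exists>a b. e = {a, b} \<and> a \<noteq> b"
proof -
  obtain x y where c: "c = (x, y)" by fastforce
  have V: "embed n l ` corner c \<union> priv n l c =
    {(x + int n - 1, main_row l (y - 1)), (x + int n, main_row l (y - 1)),
     (x + int n, main_row l y), (x + int n - 1, main_row l y)} \<union>
    (if l y then {(x + int n - 1, tri_row y), (x + int n, tri_row y)} else {})"
    by (simp add: c diff_add_eq insert_commute)
  have R: "{level y - 1, level y} \<subseteq> {main_row l (y - 1), main_row l y} \<union> (if l y then {tri_row y} else {})"
    using heavy_rows[of y] light_even_rows[of y] light_odd_rows[of y]
    by (cases "l y"; cases "even y") (auto simp: tri_row_def)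
  have L: "{tri_row y, pend_row y} \<subseteq> {main_row l (y - 1), main_row l y} \<union> {tri_row y}" if "l y"
    using light_even_rows[of y] light_odd_rows[of y] that
    by (cases "even y") (auto simp: tri_row_def pend_row_def)
  let ?W = "{x + int n - 1, x + int n} \<times> ({main_row l (y - 1), main_row l y} \<union> (if l y then {tri_row y} else {}))"
  have "e \<subseteq> ?W"
  proof -
    have "e \<subseteq> {x + int n - 1, x + int n} \<times> {level y - 1, level y} \<or>
       l y \<and> e \<subseteq> {x + int n - 1, x + int n} \<times> {tri_row y, pend_row y}"
      using assms by (auto simp: c cycle4_def split: if_splits)
    then show ?thesis
      using R L by (cases "l y") (fastforce+)
  qed
  moreover have "?W \<subseteq> embed n l ` corner c \<union> priv n l c"
    unfolding V by auto
  ultimately show "e \<subseteq> embed n l ` corner c \<union> priv n l c"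
    by (rule subset_trans)
  have "tri_row y \<noteq> pend_row y"
    by (simp add: tri_row_def pend_row_def)
  then have "card e = 2"
    using assms by (auto simp: c cycle4_def split: if_splits)
  then show "\<exists>a b. e = {a, b} \<and> a \<noteq> b"
    by (simp add: card_2_iff)
qed

text \<open>A private vertex belongs to one cell only, so both ends of a common edge would be images
  of squares shared by the two cells, and these share at most one.\<close>

lemma disjoint_cells: "disjoint_family_on (\<lambda>c. ring n c \<union> links n l c) (diamond n)"
  unfolding disjoint_family_on_def
proof (intro ballI impI)
  fix c d assume cd: "c \<in> diamond n" "d \<in> diamond n" "c \<noteq> d"
  have uniq: "c = d" if "a \<in> priv n l c" "a \<in> priv n l d" for a
    using that cd(1,2) priv_unique[of a n "fst c" "snd c" "fst d" "snd d"]
    by (cases c; cases d) (auto simp: mem_diamond simp del: priv.simps)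
  have "e \<notin> ring n d \<union> links n l d" if e: "e \<in> ring n c \<union> links n l c" for e
  proof
    assume e': "e \<in> ring n d \<union> links n l d"
    obtain a b where ab: "e = {a, b}" "a \<noteq> b"
      using cell_edge_vertices(2)[OF e] by blast
    have "a \<in> embed n l ` corner c \<inter> embed n l ` corner d" if "a \<in> e" for a
      using that cell_edge_vertices(1)[OF e] cell_edge_vertices(1)[OF e'] embed_notin_priv uniq cd(3)
      by blast
    then have "a \<in> embed n l ` (corner c \<inter> corner d)" "b \<in> embed n l ` (corner c \<inter> corner d)"
      unfolding ab(1) image_Int[OF inj_embed] by auto
    then obtain v w where vw: "v \<in> corner c \<inter> corner d" "w \<in> corner c \<inter> corner d" "v \<noteq> w"
      using ab(2) by blast
    then show False
      using two_corners[OF cd(1,2)] cd(3) by blast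
  qed
  then show "(ring n c \<union> links n l c) \<inter> (ring n d \<union> links n l d) = {}"
    by blast
qed

lemma squares_mono: "squares N \<subseteq> squares (Suc N)"
  by (auto simp: mem_squares)

text \<open>The triangles of the light cells are private vertices, the remaining vertices are
  renamed to unit squares, and one complementation on \<open>toggled l\<close> replaces all local
  weights simultaneously.\<close>

lemma msum_core:
  "msum (core l (Suc N)) dual_edges (\<lambda>_. 1) =
    (\<Prod>c\<in>diamond (Suc N). if l (snd c) then 1 else 2) * aztec (Suc N) (half l) (half l) (half l)"
proof -
  let ?n = "Suc N" and ?V1 = "{v \<in> squares (Suc N). v \<in> (toggled l) \<longrightarrow> v \<in> squares N}"
  let ?F = "\<lambda>c. ring ?n c \<union> links ?n l c" and ?J = "embed ?n l" and ?P = "priv ?n l"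
  have finP: "finite (?P c)" and finc: "finite (corner c)" for c
    by (cases c, simp)+
  have fin: "finite (core l ?n)"
    using finite_squares finite_diamond finP by (auto simp: core_def)
  have "msum (core l ?n) dual_edges (\<lambda>_. 1) =
      net (diamond ?n) (\<lambda>c. ?J ` corner c \<union> ?P c) (\<lambda>c S. msum S (?F c) (\<lambda>_. 1)) (core l ?n)"
  proof (rule msum_eq_net[OF fin finite_diamond _ disjoint_cells core_cover])
    fix c assume c: "c \<in> diamond ?n"
    show "finite (?J ` corner c \<union> ?P c)"
      using finP finc by simp
    have "odd (fst c + snd c - int ?n)"
      using c by (cases c) (simp add: mem_diamond)
    then have "ring ?n c \<subseteq> dual_edges"
      using ring_dual_edges[of "fst c" "snd c" ?n] by simp
    then show "?F c \<subseteq> dual_edges"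
      using links_dual_edges by blast
  qed (use cell_edge_vertices(1) in blast)+
  also have "\<dots> = net (diamond ?n) (\<lambda>c. ?J ` corner c) (\<lambda>c S. msum (S \<union> ?P c) (?F c) (\<lambda>_. 1))
      (core l ?n - (\<Union>c\<in>diamond ?n. ?P c))"
  proof (rule net_private)
    show "disjoint_family_on ?P (diamond ?n)"
      unfolding disjoint_family_on_def
    proof (intro ballI impI)
      fix c d assume cd: "c \<in> diamond ?n" "d \<in> diamond ?n" "c \<noteq> d"
      have "c = d" if "a \<in> ?P c" "a \<in> ?P d" for a
        using that cd(1,2) priv_unique[of a ?n "fst c" "snd c" "fst d" "snd d"]
        by (cases c; cases d) (auto simp: mem_diamond simp del: priv.simps)
      then show "?P c \<inter> ?P d = {}"
        using cd(3) by blast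
    qed
  qed (use embed_notin_priv in \<open>auto simp: core_def simp del: embed.simps priv.simps corner.simps\<close>)
  also have "core l ?n - (\<Union>c\<in>diamond ?n. ?P c) = ?J ` ?V1"
    using embed_notin_priv by (auto simp: core_def simp del: embed.simps priv.simps)
  also have "net (diamond ?n) (\<lambda>c. ?J ` corner c) (\<lambda>c S. msum (S \<union> ?P c) (?F c) (\<lambda>_. 1)) (?J ` ?V1) =
      net (diamond ?n) corner (\<lambda>c S. msum (?J ` S \<union> ?P c) (?F c) (\<lambda>_. 1)) ?V1"
    by (rule net_image[OF inj_embed])
  also have "\<dots> = net (diamond ?n) corner (\<lambda>c S. (if l (snd c) then 1 else 2) *
      corner_quad (half l (snd c)) (half l (snd c)) (half l (snd c)) c S) (squares ?n)"
  \<comment> \<open>On \<open>toggled l\<close> the presence changes from \<open>squares N\<close>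
    to \<open>squares (Suc N)\<close>, which is the count of \<open>card_diamond_corners\<close>;
    elsewhere it is that of \<open>squares (Suc N)\<close> on both sides.\<close>
  proof (rule net_toggle[where K = "toggled l", OF finite_diamond])
    fix v assume "v \<in> (toggled l)"
    then show "card {c \<in> diamond ?n. v \<in> corner c} = of_bool (v \<in> ?V1) + of_bool (v \<in> squares ?n)"
      using squares_mono[of N] unfolding card_diamond_corners by auto
  next
    fix c S assume "S \<subseteq> corner c"
    then show "msum (?J ` S \<union> ?P c) (?F c) (\<lambda>_. 1) = (if l (snd c) then 1 else 2) *
      corner_quad (half l (snd c)) (half l (snd c)) (half l (snd c)) c (toggle (toggled l) (corner c) S)"
      using heavy_cell[of "snd c" S "fst c" ?n] light_cell[of "snd c" S "fst c" ?n]
      by (cases "l (snd c)") (simp_all add: half_def)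
  qed simp
  finally show ?thesis
    by (simp add: net_scale aztec_def)
qed

end

section \<open>Coordinates for the elementary regions\<close>

text \<open>The path \<open>sep x s\<close> below slot \<open>s\<close> meets the line \<open>x\<close> at height \<open>ht x s\<close>.\<close>

definition ht :: "int \<Rightarrow> int \<Rightarrow> int" where
  "ht x s = (2 * s + of_bool (odd x)) div 3"

definition sep :: "int \<Rightarrow> int \<Rightarrow> edge" where
  "sep x s = {(x, ht x s), (x + 1, ht (x + 1) s)}"

definition side :: "int \<Rightarrow> int \<Rightarrow> edge" where
  "side x s = {(x, ht x s), (x, ht x (s + 1))}"

text \<open>One formula for squares and all triangles: where the paths below and above a slot meet,
  the lateral side degenerates to a point and is left out.\<close>

fun cellat :: "point \<Rightarrow> cell" where
  "cellat (x, s) = {sep x s, sep x (s + 1)} \<union>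
     (if ht x s \<noteq> ht x (s + 1) then {side x s} else {}) \<union>
     (if ht (x + 1) s \<noteq> ht (x + 1) (s + 1) then {side (x + 1) s} else {})"

lemma ht_mod3:
  "ht x (3 * k) = 2 * k" "ht x (3 * k + 1) = 2 * k + of_bool (odd x)" "ht x (3 * k + 2) = 2 * k + 1"
  "ht x (3 * k + 3) = 2 * k + 2"
proof -
  have sh: "ht x (3 * k + b) = 2 * k + ht x b" for b
  proof -
    have "2 * (3 * k + b) + of_bool (odd x) = 2 * b + of_bool (odd x) + 2 * k * (3 :: int)"
      by simp
    then show ?thesis
      unfolding ht_def by simp
  qed
  have c: "ht x 0 = 0" "ht x 1 = of_bool (odd x)" "ht x 2 = 1" "ht x 3 = 2"
    by (cases "even x"; simp add: ht_def)+
  show "ht x (3 * k) = 2 * k" "ht x (3 * k + 1) = 2 * k + of_bool (odd x)" "ht x (3 * k + 2) = 2 * k + 1"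
    "ht x (3 * k + 3) = 2 * k + 2"
    using sh[of 0] sh[of 1] sh[of 2] sh[of 3] by (simp_all add: c)
qed

lemma ht_mono: "s \<le> t \<Longrightarrow> ht x s \<le> ht x t"
  unfolding ht_def by (intro zdiv_mono1) auto

lemma ht_reflect: "even (x - x') \<Longrightarrow> ht x s = ht x' s"
  by (auto simp: ht_def)

lemma hadj_iff: "hadj x s \<longleftrightarrow> ht (x + 1) s \<noteq> ht (x + 1) (s + 1)"
proof (cases s rule: mod3_cases)
  case (1 k)
  then show ?thesis
    by (simp add: hadj_def ht_mod3)
next
  case (2 k)
  then show ?thesis
    using ht_mod3(3)[of "x + 1" k] by (simp add: hadj_def ht_mod3 add.assoc)
next
  case (3 k)
  have "(3 * k + 2) mod 3 = 2"
    by presburger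
  with 3 show ?thesis
    using ht_mod3(4)[of "x + 1" k] by (simp add: hadj_def ht_mod3 add.assoc)
qed

lemma sep_inject: "sep x s = sep x' s' \<longleftrightarrow> x = x' \<and> s = s'"
proof
  assume eq: "sep x s = sep x' s'"
  then have x: "x = x'"
    by (auto simp: sep_def doubleton_eq_iff)
  with eq have "ht x s = ht x s'" "ht (x + 1) s = ht (x + 1) s'"
    by (auto simp: sep_def doubleton_eq_iff)
  then have "s = s'"
    by (cases s rule: mod3_cases; cases s' rule: mod3_cases; cases "even x"; simp add: ht_mod3; presburger)
  with x show "x = x' \<and> s = s'" ..
qed simp

lemma sep_neq_side: "sep x s \<noteq> side x' s'" "side x' s' \<noteq> sep x s"
  by (auto simp: sep_def side_def doubleton_eq_iff)

lemma side_eqD: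
  assumes "side x s = side x' s'" "ht x s \<noteq> ht x (s + 1)" "ht x' s' \<noteq> ht x' (s' + 1)"
  shows "x = x'" "s = s'"
proof -
  show x: "x = x'"
    using assms(1) by (auto simp: side_def doubleton_eq_iff)
  have "ht x s < ht x (s + 1)" "ht x s' < ht x (s' + 1)"
    using assms(2,3) ht_mono[of s "s + 1" x] ht_mono[of s' "s' + 1" x] x by auto
  with assms(1) have "ht x s = ht x s'" and lt: "ht x s < ht x (s + 1)" "ht x s' < ht x (s' + 1)"
    by (auto simp: side_def x doubleton_eq_iff)
  then show "s = s'"
    using ht_mono[of "s + 1" s' x] ht_mono[of "s' + 1" s x] by linarith
qed

lemma mem_cellat:
  "e \<in> cellat (x, s) \<longleftrightarrow> e = sep x s \<or> e = sep x (s + 1) \<or>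
     ht x s \<noteq> ht x (s + 1) \<and> e = side x s \<or>
     ht (x + 1) s \<noteq> ht (x + 1) (s + 1) \<and> e = side (x + 1) s"
  by auto

lemma shared_edge:
  assumes "e \<in> cellat (x, s)" "e \<in> cellat (x', s')" "(x, s) \<noteq> (x', s')"
  obtains "x' = x" "s' = s + 1" "e = sep x (s + 1)" | "x' = x" "s' = s - 1" "e = sep x s"
  | "x' = x + 1" "s' = s" "ht (x + 1) s \<noteq> ht (x + 1) (s + 1)" "e = side (x + 1) s"
  | "x' = x - 1" "s' = s" "ht x s \<noteq> ht x (s + 1)" "e = side x s"
proof -
  from assms(1,2) consider
      "e = sep x s" "e = sep x' s'" | "e = sep x (s + 1)" "e = sep x' s'"
    | "e = sep x s" "e = sep x' (s' + 1)" | "e = sep x (s + 1)" "e = sep x' (s' + 1)"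
    | a b where "e = side a s" "ht a s \<noteq> ht a (s + 1)" "a = x \<or> a = x + 1"
        "e = side b s'" "ht b s' \<noteq> ht b (s' + 1)" "b = x' \<or> b = x' + 1"
    unfolding mem_cellat by (metis sep_neq_side)
  then show ?thesis
  proof cases
    case 1
    then show ?thesis using assms(3) by (simp add: sep_inject)
  next
    case 2
    then show ?thesis using that(1) by (simp add: sep_inject)
  next
    case 3
    then show ?thesis using that(2) by (simp add: sep_inject)
  next
    case 4
    then show ?thesis using assms(3) by (simp add: sep_inject)
  next
    case (5 a b)
    then have "a = b" "s = s'"
      using side_eqD[of a s b s'] by simp_all
    then show ?thesis
      using 5 that(3,4) assms(3) by auto
  qed
qed

lemma shared_dual_edge:
  assumes "e \<in> cellat p" "e \<in> cellat q" "p \<noteq> q"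
  shows "{p, q} \<in> dual_edges"
proof -
  obtain x s x' s' where pq: "p = (x, s)" "q = (x', s')" by fastforce
  have h: "{(x, s), (x + 1, s)} \<in> dual_edges" if "ht (x + 1) s \<noteq> ht (x + 1) (s + 1)" for x
    using that unfolding hadj_iff[symmetric] dual_edges_def by blast
  from assms[unfolded pq] show ?thesis
  proof (cases rule: shared_edge)
    case 1
    then show ?thesis using vertical_dual_edge by (simp add: pq)
  next
    case 2
    then show ?thesis using vertical_dual_edge by (simp add: pq)
  next
    case 3
    then show ?thesis using h[of x] by (simp add: pq)
  next
    case 4
    then show ?thesis using h[of "x - 1"] by (simp add: pq insert_commute)
  qed
qed

lemma dual_edge_shared:
  assumes "e \<in> dual_edges"
  obtains p q where "e = {p, q}" "p \<noteq> q" "cellat p \<inter> cellat q \<noteq> {}"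
proof -
  from assms consider x s where "e = {(x, s), (x, s + 1)}" | x s where "e = {(x, s), (x + 1, s)}" "hadj x s"
    by (auto simp: dual_edges_def)
  then show ?thesis
  proof cases
    case (1 x s)
    have "sep x (s + 1) \<in> cellat (x, s) \<inter> cellat (x, s + 1)"
      by simp
    then have "cellat (x, s) \<inter> cellat (x, s + 1) \<noteq> {}"
      by blast
    then show ?thesis
      by (intro that[OF 1]) (simp_all del: cellat.simps)
  next
    case (2 x s)
    then have "side (x + 1) s \<in> cellat (x, s) \<inter> cellat (x + 1, s)"
      by (simp add: hadj_iff)
    then have "cellat (x, s) \<inter> cellat (x + 1, s) \<noteq> {}"
      by blast
    then show ?thesis
      by (intro that[OF 2(1)]) (simp_all del: cellat.simps)
  qed
qed

lemma inj_cellat: "inj cellat"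
proof (rule injI)
  fix p q :: point assume eq: "cellat p = cellat q"
  obtain x s x' s' where pq: "p = (x, s)" "q = (x', s')" by fastforce
  show "p = q"
  proof (rule ccontr)
    assume "p \<noteq> q"
    then have ne: "(x, s) \<noteq> (x', s')"
      by (simp add: pq)
    have m: "sep x s \<in> cellat (x, s)" "sep x (s + 1) \<in> cellat (x, s)"
      by (simp_all only: mem_cellat simp_thms)
    then have m': "sep x s \<in> cellat (x', s')" "sep x (s + 1) \<in> cellat (x', s')"
      using eq unfolding pq by blast+
    have "x = x' \<and> s' = s - 1"
      using m(1) m'(1) ne by (rule shared_edge) (simp_all add: sep_inject sep_neq_side)
    moreover have "x = x' \<and> s' = s + 1"
      using m(2) m'(2) ne by (rule shared_edge) (simp_all add: sep_inject sep_neq_side)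
    ultimately show False by simp
  qed
qed

section \<open>The elementary regions as pairs of column and slot\<close>

lemma polygon_image:
  "polygon vs = (\<lambda>i. {vs ! i, vs ! (Suc i mod length vs)}) ` {i. i < length vs}"
  unfolding polygon_def by blast

lemma polygon3: "polygon [a, b, c] = {{a, b}, {b, c}, {c, a}}"
proof -
  have i: "{i. i < length [a, b, c]} = {0, Suc 0, Suc (Suc 0)}"
    by auto
  show ?thesis
    unfolding polygon_image i image_insert image_empty by simp
qed

lemma polygon4: "polygon [a, b, c, d] = {{a, b}, {b, c}, {c, d}, {d, a}}"
proof -
  have i: "{i. i < length [a, b, c, d]} = {0, Suc 0, Suc (Suc 0), Suc (Suc (Suc 0))}"
    by auto
  show ?thesis
    unfolding polygon_image i image_insert image_empty by simp
qed

lemma cellat_polygon: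
  "polygon [(x, 2 * k + 1), (x + 1, 2 * k + 1), (x + 1, 2 * k + 2), (x, 2 * k + 2)] = cellat (x, 3 * k + 2)"
  "even x \<Longrightarrow> polygon [(x, 2 * k), (x + 1, 2 * k), (x + 1, 2 * k + 1)] = cellat (x, 3 * k)"
  "even x \<Longrightarrow> polygon [(x, 2 * k), (x + 1, 2 * k + 1), (x, 2 * k + 1)] = cellat (x, 3 * k + 1)"
  "odd x \<Longrightarrow> polygon [(x, 2 * k), (x + 1, 2 * k), (x, 2 * k + 1)] = cellat (x, 3 * k)"
  "odd x \<Longrightarrow> polygon [(x + 1, 2 * k), (x + 1, 2 * k + 1), (x, 2 * k + 1)] = cellat (x, 3 * k + 1)"
  unfolding polygon3 polygon4 cellat.simps sep_def side_def add.assoc one_add_one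
  by (simp_all add: ht_mod3 add.assoc insert_commute)

lemma cells_eq: "cells = range cellat"
proof
  show "cells \<subseteq> range cellat"
  proof
    fix c assume "c \<in> cells"
    then show "c \<in> range cellat"
      unfolding cells_def
    proof (elim UnE CollectE exE conjE)
      fix x y :: int assume c: "c = polygon [(x, y), (x + 1, y), (x + 1, y + 1), (x, y + 1)]" and "odd y"
      then obtain k where "y = 2 * k + 1" by (elim oddE)
      with c have "c = cellat (x, 3 * k + 2)"
        using cellat_polygon(1)[of x k] by (simp only: add.assoc one_add_one)
      then show ?thesis by blast
    next
      fix x y :: int assume c: "c = polygon [(x, y), (x + 1, y), (x + 1, y + 1)]" and "even y" "even x"
      then obtain k where "y = 2 * k" by (elim evenE)
      then show ?thesis
        using c cellat_polygon(2)[OF \<open>even x\<close>, of k] by blast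
    next
      fix x y :: int assume c: "c = polygon [(x, y), (x + 1, y + 1), (x, y + 1)]" and "even y" "even x"
      then obtain k where "y = 2 * k" by (elim evenE)
      then show ?thesis
        using c cellat_polygon(3)[OF \<open>even x\<close>, of k] by blast
    next
      fix x y :: int assume c: "c = polygon [(x, y), (x + 1, y), (x, y + 1)]" and "even y" "odd x"
      then obtain k where "y = 2 * k" by (elim evenE)
      then show ?thesis
        using c cellat_polygon(4)[OF \<open>odd x\<close>, of k] by blast
    next
      fix x y :: int assume c: "c = polygon [(x + 1, y), (x + 1, y + 1), (x, y + 1)]" and "even y" "odd x"
      then obtain k where "y = 2 * k" by (elim evenE)
      then show ?thesis
        using c cellat_polygon(5)[OF \<open>odd x\<close>, of k] by blast
    qed
  qed
  show "range cellat \<subseteq> cells"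
  proof (rule image_subsetI)
    fix p :: point
    obtain x s where p: "p = (x, s)" by fastforce
    show "cellat p \<in> cells"
    proof (cases s rule: mod3_cases)
      case (1 k)
      have "polygon [(x, 2 * k), (x + 1, 2 * k), (x + 1, 2 * k + 1)] \<in> cells" if "even x"
        unfolding cells_def using that dvd_triv_left[of 2 k] by blast
      moreover have "polygon [(x, 2 * k), (x + 1, 2 * k), (x, 2 * k + 1)] \<in> cells" if "odd x"
        unfolding cells_def using that dvd_triv_left[of 2 k] by blast
      ultimately show ?thesis
        unfolding p 1 using cellat_polygon(2,4)[of x k] by (cases "even x") simp_all
    next
      case (2 k)
      have "polygon [(x, 2 * k), (x + 1, 2 * k + 1), (x, 2 * k + 1)] \<in> cells" if "even x"
        unfolding cells_def using that dvd_triv_left[of 2 k] by blast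
      moreover have "polygon [(x + 1, 2 * k), (x + 1, 2 * k + 1), (x, 2 * k + 1)] \<in> cells" if "odd x"
        unfolding cells_def using that dvd_triv_left[of 2 k] by blast
      ultimately show ?thesis
        unfolding p 2 using cellat_polygon(3,5)[of x k] by (cases "even x") simp_all
    next
      case (3 k)
      have "odd (2 * k + 1)" by simp
      then have "polygon [(x, 2 * k + 1), (x + 1, 2 * k + 1), (x + 1, 2 * k + 1 + 1), (x, 2 * k + 1 + 1)] \<in> cells"
        unfolding cells_def by blast
      then show ?thesis
        unfolding p 3 using cellat_polygon(1)[of x k] by (simp only: add.assoc one_add_one)
    qed
  qed
qed

lemma is_tile_iff: "is_tile (cellat ` e) \<longleftrightarrow> e \<in> dual_edges"
proof
  assume "is_tile (cellat ` e)"
  then obtain p q where pq: "cellat p \<noteq> cellat q" "cellat p \<inter> cellat q \<noteq> {}" "cellat ` e = {cellat p, cellat q}"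
    unfolding is_tile_def cells_eq by blast
  then have "cellat ` e = cellat ` {p, q}"
    by simp
  then have "e = {p, q}"
    by (simp only: inj_image_eq_iff[OF inj_cellat])
  then show "e \<in> dual_edges"
    using pq shared_dual_edge by blast
next
  assume "e \<in> dual_edges"
  then obtain p q where pq: "e = {p, q}" "p \<noteq> q" "cellat p \<inter> cellat q \<noteq> {}"
    by (rule dual_edge_shared)
  then have "cellat p \<noteq> cellat q"
    using inj_cellat by (metis injD)
  then show "is_tile (cellat ` e)"
    unfolding is_tile_def cells_eq using pq by blast
qed

lemma T_cellat: "real (T (cellat ` V)) = msum V dual_edges (\<lambda>_. 1)"
proof -
  have "bij_betw ((`) ((`) cellat)) (pm V dual_edges) (tilings (cellat ` V))"
  proof (rule bij_betw_imageI)
    have g: "inj ((`) cellat)"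
      by (intro injI) (simp only: inj_image_eq_iff[OF inj_cellat])
    have "inj ((`) ((`) cellat))"
      by (intro injI) (simp only: inj_image_eq_iff[OF g])
    then show "inj_on ((`) ((`) cellat)) (pm V dual_edges)"
      by (rule inj_on_subset) simp
    show "(`) ((`) cellat) ` pm V dual_edges = tilings (cellat ` V)"
    proof (intro equalityI subsetI)
      fix Q assume "Q \<in> (`) ((`) cellat) ` pm V dual_edges"
      then obtain P where P: "partition_on V P" "P \<subseteq> dual_edges" and Q: "Q = (`) cellat ` P"
        by (auto simp: pm_def)
      have "partition_on (cellat ` V) Q"
      proof (rule partition_onI)
        show "\<Union>Q = cellat ` V"
          using partition_onD1[OF P(1)] unfolding Q by blast
        show "{} \<notin> Q"
          using partition_onD3[OF P(1)] unfolding Q by blast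
        fix a b assume "a \<in> Q" "b \<in> Q" "a \<noteq> b"
        then obtain a' b' where ab: "a' \<in> P" "b' \<in> P" "a' \<noteq> b'" "a = cellat ` a'" "b = cellat ` b'"
          unfolding Q by blast
        then have "a' \<inter> b' = {}"
          using disjointD[OF partition_onD2[OF P(1)]] by blast
        then show "disjnt a b"
          unfolding disjnt_def ab(4,5) by (simp only: image_Int[OF inj_cellat, symmetric] image_empty)
      qed
      then show "Q \<in> tilings (cellat ` V)"
        using P(2) is_tile_iff unfolding Q tilings_def by blast
    next
      fix Q assume "Q \<in> tilings (cellat ` V)"
      then have Q: "partition_on (cellat ` V) Q" "\<And>t. t \<in> Q \<Longrightarrow> is_tile t"
        by (auto simp: tilings_def)
      define P where "P = (-`) cellat ` Q"
      have eq: "cellat ` (cellat -` t) = t" if "t \<in> Q" for t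
      proof -
        have "t \<subseteq> cellat ` V"
          using that unfolding partition_onD1[OF Q(1)] by (rule Union_upper)
        then have "t \<subseteq> range cellat"
          by (rule subset_trans) (rule image_mono, rule subset_UNIV)
        then show ?thesis
          unfolding image_vimage_eq by (rule Int_absorb2)
      qed
      have "(\<lambda>t. cellat ` (cellat -` t)) ` Q = (\<lambda>t. t) ` Q"
        by (rule image_cong[OF refl eq])
      then have QP: "Q = (`) cellat ` P"
        unfolding P_def image_image by simp
      have "partition_on V P"
      proof (rule partition_onI)
        have "cellat ` (\<Union>P) = \<Union>Q"
          unfolding QP by (rule image_Union)
        then have "cellat ` (\<Union>P) = cellat ` V"
          by (simp only: partition_onD1[OF Q(1), symmetric])
        then show "\<Union>P = V"
          by (simp only: inj_image_eq_iff[OF inj_cellat])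
        have in_Q: "cellat ` a \<in> Q" if "a \<in> P" for a
          unfolding QP using that by (rule imageI)
        show "{} \<notin> P"
          using in_Q[of "{}"] partition_onD3[OF Q(1)] by auto
        fix a b assume ab: "a \<in> P" "b \<in> P" "a \<noteq> b"
        then have "cellat ` a \<noteq> cellat ` b"
          by (simp only: inj_image_eq_iff[OF inj_cellat] simp_thms)
        then have "cellat ` a \<inter> cellat ` b = {}"
          by (rule disjointD[OF partition_onD2[OF Q(1)] in_Q[OF ab(1)] in_Q[OF ab(2)]])
        then show "disjnt a b"
          unfolding disjnt_def by blast
      qed
      moreover have "P \<subseteq> dual_edges"
      proof
        fix a assume "a \<in> P"
        then have "cellat ` a \<in> Q"
          unfolding QP by (rule imageI)
        then have "is_tile (cellat ` a)"
          by (rule Q(2))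
        then show "a \<in> dual_edges"
          by (simp only: is_tile_iff)
      qed
      ultimately show "Q \<in> (`) ((`) cellat) ` pm V dual_edges"
        unfolding QP by (intro imageI) (simp add: pm_def)
    qed
  qed
  then have "T (cellat ` V) = card (pm V dual_edges)"
    unfolding T_def by (metis bij_betw_same_card)
  then show ?thesis
    by (simp add: msum_def)
qed

declare cellat.simps [simp del]

section \<open>Enclosed regions described column by column\<close>

lemma crossing_down:
  assumes "sep x s \<notin> B"
  shows "(cellat (x, s), cellat (x, s - 1)) \<in> crossing B"
proof -
  have "sep x s \<in> cellat (x, s) \<inter> cellat (x, s - 1)"
    by (simp add: mem_cellat)
  moreover have "cellat (x, s) \<noteq> cellat (x, s - 1)"
    by (simp only: inj_eq[OF inj_cellat]) simp
  ultimately show ?thesis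
    using assms unfolding crossing_def cells_eq by blast
qed

lemma crossing_sym: "(c, d) \<in> crossing B \<Longrightarrow> (d, c) \<in> crossing B"
  unfolding crossing_def by blast

lemma infinite_column:
  assumes "\<And>i. i \<in> I \<Longrightarrow> cellat (x, i) \<in> X" "infinite I"
  shows "infinite X"
proof
  assume "finite X"
  moreover have "(\<lambda>i. cellat (x, i)) ` I \<subseteq> X"
    using assms(1) by blast
  ultimately have "finite ((\<lambda>i. cellat (x, i)) ` I)"
    by (rule rev_finite_subset)
  moreover have "inj_on (\<lambda>i. cellat (x, i)) I"
    using injD[OF inj_cellat] by (intro inj_onI) blast
  ultimately show False
    using assms(2) finite_imageD by blast
qed

text \<open>Outside the region a column can be followed to infinity in one of the two vertical directions.\<close>

lemma enclosed_columns:
  assumes R: "finite R"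
    and vert: "\<And>x s. (x, s) \<in> R \<Longrightarrow> (x, s + 1) \<notin> R \<Longrightarrow> sep x (s + 1) \<in> B"
      "\<And>x s. (x, s) \<in> R \<Longrightarrow> (x, s - 1) \<notin> R \<Longrightarrow> sep x s \<in> B"
    and horiz: "\<And>x s. (x - 1, s) \<in> R \<longleftrightarrow> (x, s) \<notin> R \<Longrightarrow> ht x s \<noteq> ht x (s + 1) \<Longrightarrow> side x s \<in> B"
    and out: "\<And>x s. (x, s) \<notin> R \<Longrightarrow> (\<forall>t>s. sep x t \<notin> B) \<or> (\<forall>t\<le>s. sep x t \<notin> B)"
  shows "enclosed B = cellat ` R"
proof (intro equalityI subsetI)
  fix c assume "c \<in> cellat ` R"
  then obtain p where p: "p \<in> R" "c = cellat p" by blast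
  \<comment> \<open>Every edge at which \<open>R\<close> can be left belongs to \<open>B\<close>, so
    crossings never lead out of the finite set.\<close>
  have "d \<in> cellat ` R" if "(c, d) \<in> (crossing B)\<^sup>*" for d
    using that
  proof (induction rule: rtrancl_induct)
    case base
    then show ?case using p by blast
  next
    case (step d d')
    then obtain q where q: "q \<in> R" "d = cellat q" by blast
    obtain q' e where q': "d' = cellat q'" "q \<noteq> q'" and e: "e \<in> cellat q" "e \<in> cellat q'" "e \<notin> B"
      using step(2) q(2) unfolding crossing_def cells_eq by blast
    obtain x s x' s' where xs: "q = (x, s)" "q' = (x', s')" by fastforce
    have "q' \<in> R"
      using e(1,2)[unfolded xs] q'(2)[unfolded xs]
    proof (cases rule: shared_edge)
      case 1
      then show ?thesis using vert(1)[of x s] e(3) q(1) xs by auto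
    next
      case 2
      then show ?thesis using vert(2)[of x s] e(3) q(1) xs by auto
    next
      case 3
      then show ?thesis using horiz[of "x + 1" s] e(3) q(1) xs by auto
    next
      case 4
      then show ?thesis using horiz[of x s] e(3) q(1) xs by auto
    qed
    then show ?case using q'(1) by blast
  qed
  then have "(crossing B)\<^sup>* `` {c} \<subseteq> cellat ` R"
    by blast
  then have "finite ((crossing B)\<^sup>* `` {c})"
    using R by (meson finite_imageI finite_subset)
  then show "c \<in> enclosed B"
    using p unfolding enclosed_def cells_eq by blast
next
  fix c assume c: "c \<in> enclosed B"
  then obtain x s where xs: "c = cellat (x, s)"
    unfolding enclosed_def cells_eq by auto
  let ?X = "(crossing B)\<^sup>* `` {c}"
  show "c \<in> cellat ` R"
  proof (rule ccontr)
    assume "c \<notin> cellat ` R"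
    then have "(x, s) \<notin> R"
      unfolding xs by blast
    from out[OF this] have "infinite ?X"
    proof
      assume up: "\<forall>t>s. sep x t \<notin> B"
      have "cellat (x, t) \<in> ?X" if "t \<ge> s" for t
        using that
      proof (induction t rule: int_ge_induct)
        case base
        then show ?case unfolding xs by blast
      next
        case (step t)
        have "(cellat (x, t), cellat (x, t + 1)) \<in> crossing B"
          using crossing_sym[OF crossing_down[of x "t + 1" B]] up step.hyps by simp
        with step.IH show ?case
          by (meson Image_singleton_iff rtrancl.rtrancl_into_rtrancl)
      qed
      then show ?thesis
        by (intro infinite_column[of "{s..}"]) (auto simp: infinite_Ici)
    next
      assume down: "\<forall>t\<le>s. sep x t \<notin> B"
      have "cellat (x, t) \<in> ?X" if "t \<le> s" for t
        using that
      proof (induction t rule: int_le_induct)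
        case base
        then show ?case unfolding xs by blast
      next
        case (step t)
        have "(cellat (x, t), cellat (x, t - 1)) \<in> crossing B"
          using crossing_down[of x t B] down step.hyps by simp
        with step.IH show ?case
          by (meson Image_singleton_iff rtrancl.rtrancl_into_rtrancl)
      qed
      then show ?thesis
        by (intro infinite_column[of "{..s}"]) (auto simp: infinite_Iic)
    qed
    then show False
      using c unfolding enclosed_def by blast
  qed
qed

section \<open>Boundary paths\<close>

lemma path_point_Suc: "path_point w (Suc k) = path_point w k + step (w ! (k mod length w))"
  by (simp add: path_point_def)

lemma path_point_0: "path_point w 0 = (0, 0)"
  by (simp add: path_point_def zero_prod_def)

lemma path_point_numeral:
  "path_point w (numeral k) =
    path_point w (pred_numeral k) + step (w ! (pred_numeral k mod length w))"
  by (simp add: numeral_eq_Suc path_point_Suc)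

lemma path_point_1: "path_point w (Suc 0) = step (w ! (0 mod length w))"
  by (simp add: path_point_Suc path_point_def)

lemma path_point_period:
  assumes "length w = p"
  shows "path_point w (p * q + i) =
    (int q * fst (path_point w p), int q * snd (path_point w p)) + path_point w i"
proof -
  have shift: "path_point w (p + k) = path_point w p + path_point w k" for k
  proof (induction k)
    case 0
    then show ?case by (simp add: path_point_0 prod_eq_iff)
  next
    case (Suc k)
    then show ?case
      using assms by (simp add: path_point_Suc add.assoc)
  qed
  show ?thesis
  proof (induction q)
    case 0
    then show ?case by (simp add: prod_eq_iff)
  next
    case (Suc q)
    have "path_point w (p * Suc q + i) = path_point w (p + (p * q + i))"
      by (simp add: add.assoc)
    then show ?case
      unfolding shift Suc by (simp add: prod_eq_iff algebra_simps)
  qed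
qed

text \<open>A nondecreasing walk with steps of at most 1 cannot jump over \<open>n\<close>, so the
  first index at which it equals \<open>n\<close> is the first at which it is not below
  \<open>n\<close>.\<close>

lemma less_first_hit:
  fixes f :: "nat \<Rightarrow> int"
  assumes "f 0 \<le> n" and step: "\<And>k. f k \<le> f (Suc k)" "\<And>k. f (Suc k) \<le> f k + 1" and "n \<le> f m"
  shows "i < (LEAST k. f k = n) \<longleftrightarrow> f i < n"
proof -
  define K where "K = (LEAST k. n \<le> f k)"
  have K: "n \<le> f K"
    unfolding K_def using assms(4) by (rule LeastI)
  have below: "f j < n" if "j < K" for j
    using not_less_Least[OF that[unfolded K_def]] by simp
  have "f K = n"
  proof (cases K)
    case 0
    then show ?thesis using K assms(1) by simp
  next
    case (Suc j)
    then show ?thesis using K below[of j] step(2)[of j] by simp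
  qed
  moreover have "K \<le> k" if "f k = n" for k
    using below[of k] that by (meson less_irrefl not_le)
  ultimately have "(LEAST k. f k = n) = K"
    by (rule Least_equality)
  moreover have "n \<le> f i" if "K \<le> i"
    using K lift_Suc_mono_le[of f, OF step(1) that] by simp
  ultimately show ?thesis
    using below by (meson not_le)
qed

text \<open>The translate of a step by \<open>q\<close> periods: each period advances by 4 columns
  and by the height \<open>d\<close>, which is 4 for the upper and -4 for the lower paths.\<close>

definition seg :: "int \<Rightarrow> int \<Rightarrow> point \<Rightarrow> point \<Rightarrow> edge" where
  "seg d q a b = {(4 * q + fst a, d * q + snd a), (4 * q + fst b, d * q + snd b)}"

lemma path_edges_seg:
  assumes w: "length w = 7" "path_point w 7 = (4, d)"
  shows "e \<in> path_edges w n \<longleftrightarrow> (\<exists>q r. r < 7 \<and> 4 * int q + fst (path_point w r) < int n \<and>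
    e = seg d (int q) (path_point w r) (path_point w (Suc r)))"
proof -
  let ?p = "path_point w"
  have st: "0 \<le> fst (step a)" "fst (step a) \<le> 1" for a
    by (cases a; simp)+
  have per: "?p (7 * q + r) = (4 * int q + fst (?p r), d * int q + snd (?p r))" for q r
    using path_point_period[OF w(1), of q r] by (simp add: w(2) prod_eq_iff)
  have hit: "i < (LEAST k. fst (?p k) = int n) \<longleftrightarrow> fst (?p i) < int n" for i
  proof (rule less_first_hit)
    show "int n \<le> fst (?p (7 * n + 0))"
      unfolding per by (simp add: path_point_0)
  qed (use st in \<open>simp_all add: path_point_0 path_point_Suc\<close>)
  have "e \<in> path_edges w n \<longleftrightarrow> (\<exists>i. fst (?p i) < int n \<and> e = {?p i, ?p (Suc i)})"
    unfolding path_edges_def hit by blast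
  also have "\<dots> \<longleftrightarrow> (\<exists>q r. r < 7 \<and> fst (?p (7 * q + r)) < int n \<and> e = {?p (7 * q + r), ?p (7 * q + Suc r)})"
  proof
    assume "\<exists>i. fst (?p i) < int n \<and> e = {?p i, ?p (Suc i)}"
    then obtain i where i: "fst (?p i) < int n" "e = {?p i, ?p (Suc i)}" by blast
    have "7 * (i div 7) + i mod 7 = i" "7 * (i div 7) + Suc (i mod 7) = Suc i" "i mod 7 < 7"
      by simp_all
    then show "\<exists>q r. r < 7 \<and> fst (?p (7 * q + r)) < int n \<and> e = {?p (7 * q + r), ?p (7 * q + Suc r)}"
      using i by metis
  next
    assume "\<exists>q r. r < 7 \<and> fst (?p (7 * q + r)) < int n \<and> e = {?p (7 * q + r), ?p (7 * q + Suc r)}"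
    then show "\<exists>i. fst (?p i) < int n \<and> e = {?p i, ?p (Suc i)}"
      by (metis add_Suc_right)
  qed
  finally show ?thesis
    unfolding per seg_def fst_conv .
qed

section \<open>Symmetric regions given by the bottom and top slots of their columns\<close>

definition vert :: "int \<Rightarrow> int \<Rightarrow> edge" where
  "vert x y = {(x, y), (x, y + 1)}"

lemma vert_neq_sep: "vert x y \<noteq> sep x' s" "sep x' s \<noteq> vert x y"
  by (auto simp: vert_def sep_def doubleton_eq_iff)

lemma side_vert:
  assumes "ht x s \<noteq> ht x (s + 1)"
  shows "side x s = vert x (ht x s)"
proof -
  have "ht x (s + 1) \<le> ht x s + 1"
  proof -
    have "ht x (s + 1) \<le> (2 * s + of_bool (odd x) + 3) div 3"
      unfolding ht_def by (intro zdiv_mono1) auto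
    then show ?thesis
      by (simp add: ht_def)
  qed
  then have "ht x (s + 1) = ht x s + 1"
    using assms ht_mono[of s "s + 1" x] by simp
  then show ?thesis
    by (simp add: side_def vert_def)
qed

text \<open>A column is named by its left end, so reflection in \<open>x = n\<close> takes column
  \<open>x\<close> to column \<open>2 * n - 1 - x\<close>; folding selects the one left of the
  axis.\<close>

definition fold_col :: "nat \<Rightarrow> int \<Rightarrow> int" where
  "fold_col n x = min x (2 * int n - 1 - x)"

definition columns :: "(int \<Rightarrow> int) \<Rightarrow> (int \<Rightarrow> int) \<Rightarrow> nat \<Rightarrow> point set" where
  "columns L H n = {(x, s). 0 \<le> fold_col n x \<and> L (fold_col n x) \<le> s \<and> s < H (fold_col n x)}"

lemma mem_columns: "(x, s) \<in> columns L H n \<longleftrightarrow> 0 \<le> fold_col n x \<and> L (fold_col n x) \<le> s \<and> s < H (fold_col n x)"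
  by (simp add: columns_def)

lemma finite_columns: "finite (columns L H n)"
proof (rule finite_subset)
  show "columns L H n \<subseteq> (SIGMA x:{0..2 * int n}. {L (fold_col n x)..H (fold_col n x)})"
    by (auto simp: columns_def fold_col_def)
qed auto

lemma reflect_sep: "reflect n ` sep x t = sep (2 * int n - 1 - x) t"
proof -
  have "ht (2 * int n - 1 - x) t = ht (x + 1) t" "ht (2 * int n - 1 - x + 1) t = ht x t"
    by (rule ht_reflect; simp)+
  moreover have "2 * int n - (x + 1) = 2 * int n - 1 - x" "2 * int n - 1 - x + 1 = 2 * int n - x"
    by simp_all
  ultimately show ?thesis
    by (simp only: sep_def reflect_def image_insert image_empty fst_conv snd_conv insert_commute)
qed

lemma reflect_side: "reflect n ` side x s = side (2 * int n - x) s"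
proof -
  have "ht (2 * int n - x) t = ht x t" for t
    by (rule ht_reflect) simp
  then show ?thesis
    by (simp add: side_def reflect_def)
qed

lemma reflect_reflect: "reflect n ` (reflect n ` e) = e"
  by (simp add: image_image reflect_def)

text \<open>It suffices to examine the left half \<open>W\<close> of the boundary. Its
  \<open>sep\<close> edges are the tops and bottoms of the columns, and a \<open>side\<close> edge
  is required wherever a slot belongs to just one of two neighbouring columns;
  \<open>1 \<le> x\<close> expresses that no column lies left of column 0.\<close>

lemma enclosed_reflect:
  assumes LH: "\<And>x. 0 \<le> x \<Longrightarrow> L x \<le> H x"
    and sepW: "\<And>x t. sep x t \<in> W \<Longrightarrow> 0 \<le> x \<and> x < int n \<and> (t = H x \<or> t = L x)"
    and HW: "\<And>x. 0 \<le> x \<Longrightarrow> x < int n \<Longrightarrow> sep x (H x) \<in> W"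
    and LW: "\<And>x. 0 \<le> x \<Longrightarrow> x < int n \<Longrightarrow> sep x (L x) \<in> W"
    and sideW: "\<And>x s. 0 \<le> x \<Longrightarrow> x < int n \<Longrightarrow> ht x s \<noteq> ht x (s + 1) \<Longrightarrow>
      (1 \<le> x \<and> L (x - 1) \<le> s \<and> s < H (x - 1)) \<noteq> (L x \<le> s \<and> s < H x) \<Longrightarrow> side x s \<in> W"
  shows "enclosed (W \<union> (\<lambda>e. reflect n ` e) ` W) = cellat ` columns L H n"
proof -
  let ?B = "W \<union> (\<lambda>e. reflect n ` e) ` W"
  have refl: "e \<in> (\<lambda>e. reflect n ` e) ` W \<longleftrightarrow> reflect n ` e \<in> W" for e
    using reflect_reflect[of n] by (metis (no_types, lifting) imageE image_eqI)
  have B: "e \<in> ?B \<longleftrightarrow> e \<in> W \<or> reflect n ` e \<in> W" for e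
    using refl by blast
  have left: "fold_col n x = x" if "x < int n" for x
    using that by (simp add: fold_col_def)
  have right: "fold_col n x = 2 * int n - 1 - x" if "int n \<le> x" for x
    using that by (simp add: fold_col_def)
  have sepB: "0 \<le> fold_col n x \<and> (t = H (fold_col n x) \<or> t = L (fold_col n x))" if "sep x t \<in> ?B" for x t
  proof -
    have "sep x t \<in> W \<or> sep (2 * int n - 1 - x) t \<in> W"
      using that unfolding B reflect_sep .
    then show ?thesis
    proof
      assume "sep x t \<in> W"
      then show ?thesis using sepW[of x t] left[of x] by simp
    next
      assume "sep (2 * int n - 1 - x) t \<in> W"
      then show ?thesis using sepW[of "2 * int n - 1 - x" t] right[of x] by simp
    qed
  qed
  have HB: "sep x (H (fold_col n x)) \<in> ?B" "sep x (L (fold_col n x)) \<in> ?B" if "0 \<le> fold_col n x" for x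
  proof -
    show "sep x (H (fold_col n x)) \<in> ?B"
      unfolding B reflect_sep using that HW left right by (cases "x < int n") (simp_all add: not_less)
    show "sep x (L (fold_col n x)) \<in> ?B"
      unfolding B reflect_sep using that LW left right by (cases "x < int n") (simp_all add: not_less)
  qed
  show ?thesis
  proof (rule enclosed_columns[OF finite_columns])
    fix x s assume "(x, s) \<in> columns L H n" "(x, s + 1) \<notin> columns L H n"
    then have "0 \<le> fold_col n x" "s + 1 = H (fold_col n x)"
      by (auto simp: mem_columns)
    then show "sep x (s + 1) \<in> ?B"
      using HB(1)[of x] by simp
  next
    fix x s assume "(x, s) \<in> columns L H n" "(x, s - 1) \<notin> columns L H n"
    then have "0 \<le> fold_col n x" "s = L (fold_col n x)"
      by (auto simp: mem_columns)
    then show "sep x s \<in> ?B"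
      using HB(2)[of x] by simp
  next
    fix x s assume "(x, s) \<notin> columns L H n"
    then consider "fold_col n x < 0" | "0 \<le> fold_col n x" "s < L (fold_col n x)" | "0 \<le> fold_col n x" "H (fold_col n x) \<le> s"
      by (force simp: mem_columns)
    then show "(\<forall>t>s. sep x t \<notin> ?B) \<or> (\<forall>t\<le>s. sep x t \<notin> ?B)"
    proof cases
      case 1
      then show ?thesis using sepB by fastforce
    next
      case 2
      then have "sep x t \<notin> ?B" if "t \<le> s" for t
        using sepB[of x t] LH[of "fold_col n x"] that by linarith
      then show ?thesis by blast
    next
      case 3
      then have "sep x t \<notin> ?B" if "t > s" for t
        using sepB[of x t] LH[of "fold_col n x"] that by linarith
      then show ?thesis by blast
    qed
  next
    fix x s assume iff: "(x - 1, s) \<in> columns L H n \<longleftrightarrow> (x, s) \<notin> columns L H n"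
      and nd: "ht x s \<noteq> ht x (s + 1)"
    consider "x < 0 \<or> x > 2 * int n" | "0 \<le> x" "x < int n" | "x = int n" | "int n < x" "x \<le> 2 * int n"
      by linarith
    then show "side x s \<in> ?B"
    proof cases
      case 1
      then have "fold_col n x < 0" "fold_col n (x - 1) < 0"
        by (auto simp: fold_col_def)
      then show ?thesis using iff by (simp add: mem_columns)
    next
      case 2
      then have "side x s \<in> W"
        using iff left[of x] left[of "x - 1"] by (intro sideW nd) (auto simp: mem_columns)
      then show ?thesis by blast
    next
      \<comment> \<open>The columns on either side of the axis are mirror images, so membership
        never changes across it.\<close>
      case 3
      then have "fold_col n x = fold_col n (x - 1)"
        by (simp add: fold_col_def)
      then show ?thesis using iff by (auto simp: mem_columns)
    next
      case 4
      define x' where "x' = 2 * int n - x"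
      have x': "0 \<le> x'" "x' < int n"
        using 4 by (simp_all add: x'_def)
      have f: "fold_col n x = x' - 1" "fold_col n (x - 1) = x'"
        using 4 by (simp_all add: x'_def fold_col_def)
      have "ht x' t = ht x t" for t
        by (rule ht_reflect) (simp add: x'_def)
      with nd have "ht x' s \<noteq> ht x' (s + 1)"
        by simp
      then have "side x' s \<in> W"
        using iff x' by (intro sideW) (auto simp: mem_columns f)
      then show ?thesis
        unfolding B reflect_side x'_def by blast
    qed
  qed
qed

text \<open>One period of a boundary path spans 4 columns and a height of 4, which amounts to 6
  slots; \<open>a, b, c, d\<close> are the slots in the initial period.\<close>

definition quarter :: "int \<Rightarrow> int \<Rightarrow> int \<Rightarrow> int \<Rightarrow> int \<Rightarrow> int" where
  "quarter a b c d x = 6 * (x div 4) +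
    (if x mod 4 = 0 then a else if x mod 4 = 1 then b else if x mod 4 = 2 then c else d)"

lemma quarter_simps:
  "quarter a b c d (4 * q) = 6 * q + a" "quarter a b c d (4 * q + 1) = 6 * q + b"
  "quarter a b c d (4 * q + 2) = 6 * q + c" "quarter a b c d (4 * q + 3) = 6 * q + d"
  "quarter a b c d (4 * q - 1) = 6 * q - 6 + d"
proof -
  have "(4 * q + 1) div 4 = q" "(4 * q + 1) mod 4 = 1" "(4 * q + 2) div 4 = q" "(4 * q + 2) mod 4 = 2"
    "(4 * q + 3) div 4 = q" "(4 * q + 3) mod 4 = 3" "(4 * q - 1) div 4 = q - 1" "(4 * q - 1) mod 4 = 3"
    by presburger+
  then show "quarter a b c d (4 * q) = 6 * q + a" "quarter a b c d (4 * q + 1) = 6 * q + b"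
    "quarter a b c d (4 * q + 2) = 6 * q + c" "quarter a b c d (4 * q + 3) = 6 * q + d"
    "quarter a b c d (4 * q - 1) = 6 * q - 6 + d"
    by (simp_all add: quarter_def)
qed

lemma mod4_cases:
  fixes x :: int
  obtains q where "x = 4 * q" | q where "x = 4 * q + 1" | q where "x = 4 * q + 2" | q where "x = 4 * q + 3"
proof -
  have "\<exists>q. x = 4 * q \<or> x = 4 * q + 1 \<or> x = 4 * q + 2 \<or> x = 4 * q + 3"
    by presburger
  then show ?thesis
    using that by blast
qed

lemma less7_cases: "(r :: nat) < 7 \<Longrightarrow> r = 0 \<or> r = 1 \<or> r = 2 \<or> r = 3 \<or> r = 4 \<or> r = 5 \<or> r = 6"
  by linarith

section \<open>The four boundary paths in slots\<close>

abbreviation "nwZ \<equiv> [North, East, North, East, NorthEast, East, North]"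
abbreviation "swZ \<equiv> [East, South, South, East, South, East, SouthEast]"
abbreviation "nwB \<equiv> [NorthEast, East, North, East, North, North, East]"
abbreviation "swB \<equiv> [South, East, SouthEast, East, South, East, South]"

lemma nwZ_points:
  "path_point nwZ 0 = (0, 0)" "path_point nwZ (Suc 0) = (0, 1)" "path_point nwZ 2 = (1, 1)"
  "path_point nwZ 3 = (1, 2)" "path_point nwZ 4 = (2, 2)" "path_point nwZ 5 = (3, 3)"
  "path_point nwZ 6 = (4, 3)" "path_point nwZ 7 = (4, 4)"
  by (simp_all add: path_point_0 path_point_1 path_point_numeral)

lemma swZ_points:
  "path_point swZ 0 = (0, 0)" "path_point swZ (Suc 0) = (1, 0)" "path_point swZ 2 = (1, -1)"
  "path_point swZ 3 = (1, -2)" "path_point swZ 4 = (2, -2)" "path_point swZ 5 = (2, -3)"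
  "path_point swZ 6 = (3, -3)" "path_point swZ 7 = (4, -4)"
  by (simp_all add: path_point_0 path_point_1 path_point_numeral)

lemma nwB_points:
  "path_point nwB 0 = (0, 0)" "path_point nwB (Suc 0) = (1, 1)" "path_point nwB 2 = (2, 1)"
  "path_point nwB 3 = (2, 2)" "path_point nwB 4 = (3, 2)" "path_point nwB 5 = (3, 3)"
  "path_point nwB 6 = (3, 4)" "path_point nwB 7 = (4, 4)"
  by (simp_all add: path_point_0 path_point_1 path_point_numeral)

lemma swB_points:
  "path_point swB 0 = (0, 0)" "path_point swB (Suc 0) = (0, -1)" "path_point swB 2 = (1, -1)"
  "path_point swB 3 = (2, -2)" "path_point swB 4 = (3, -2)" "path_point swB 5 = (3, -3)"
  "path_point swB 6 = (4, -3)" "path_point swB 7 = (4, -4)"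
  by (simp_all add: path_point_0 path_point_1 path_point_numeral)

lemma seg_sepI:
  assumes "x = 4 * q + u" "u' = u + 1" "ht x s = d * q + y" "ht (x + 1) s = d * q + y'"
  shows "seg d q (u, y) (u', y') = sep x s"
  using assms by (simp add: seg_def sep_def add.assoc)

lemma seg_vertI:
  assumes "x = 4 * q + u" "z = d * q + min y y'" "\<bar>y - y'\<bar> = 1"
  shows "seg d q (u, y) (u, y') = vert x z"
proof -
  have "y' = y + 1 \<or> y = y' + 1"
    using assms(3) by linarith
  then show ?thesis
    using assms(1,2) by (auto simp: seg_def vert_def add.assoc insert_commute)
qed

lemma nwZ_segs:
  "seg 4 q (0, 0) (0, 1) = vert (4 * q) (4 * q)"
  "seg 4 q (0, 1) (1, 1) = sep (4 * q) (6 * q + 2)"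
  "seg 4 q (1, 1) (1, 2) = vert (4 * q + 1) (4 * q + 1)"
  "seg 4 q (1, 2) (2, 2) = sep (4 * q + 1) (6 * q + 3)"
  "seg 4 q (2, 2) (3, 3) = sep (4 * q + 2) (6 * q + 4)"
  "seg 4 q (3, 3) (4, 3) = sep (4 * q + 3) (6 * q + 5)"
  "seg 4 q (4, 3) (4, 4) = vert (4 * q + 4) (4 * q + 3)"
  by ((rule seg_vertI; simp) | (rule seg_sepI; simp add: ht_def; presburger))+

lemma swZ_segs:
  "seg (- 4) q (0, 0) (1, 0) = sep (4 * q) (6 * - q + 0)"
  "seg (- 4) q (1, 0) (1, - 1) = vert (4 * q + 1) (- 4 * q - 1)"
  "seg (- 4) q (1, - 1) (1, - 2) = vert (4 * q + 1) (- 4 * q - 2)"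
  "seg (- 4) q (1, - 2) (2, - 2) = sep (4 * q + 1) (6 * - q + - 3)"
  "seg (- 4) q (2, - 2) (2, - 3) = vert (4 * q + 2) (- 4 * q - 3)"
  "seg (- 4) q (2, - 3) (3, - 3) = sep (4 * q + 2) (6 * - q + - 4)"
  "seg (- 4) q (3, - 3) (4, - 4) = sep (4 * q + 3) (6 * - q + - 5)"
  by ((rule seg_vertI; simp) | (rule seg_sepI; simp add: ht_def; presburger))+

lemma nwB_segs:
  "seg 4 q (0, 0) (1, 1) = sep (4 * q) (6 * q + 1)"
  "seg 4 q (1, 1) (2, 1) = sep (4 * q + 1) (6 * q + 2)"
  "seg 4 q (2, 1) (2, 2) = vert (4 * q + 2) (4 * q + 1)"
  "seg 4 q (2, 2) (3, 2) = sep (4 * q + 2) (6 * q + 3)"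
  "seg 4 q (3, 2) (3, 3) = vert (4 * q + 3) (4 * q + 2)"
  "seg 4 q (3, 3) (3, 4) = vert (4 * q + 3) (4 * q + 3)"
  "seg 4 q (3, 4) (4, 4) = sep (4 * q + 3) (6 * q + 6)"
  by ((rule seg_vertI; simp) | (rule seg_sepI; simp add: ht_def; presburger))+

lemma swB_segs:
  "seg (- 4) q (0, 0) (0, - 1) = vert (4 * q) (- 4 * q - 1)"
  "seg (- 4) q (0, - 1) (1, - 1) = sep (4 * q) (6 * - q + - 1)"
  "seg (- 4) q (1, - 1) (2, - 2) = sep (4 * q + 1) (6 * - q + - 2)"
  "seg (- 4) q (2, - 2) (3, - 2) = sep (4 * q + 2) (6 * - q + - 3)"
  "seg (- 4) q (3, - 2) (3, - 3) = vert (4 * q + 3) (- 4 * q - 3)"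
  "seg (- 4) q (3, - 3) (4, - 3) = sep (4 * q + 3) (6 * - q + - 4)"
  "seg (- 4) q (4, - 3) (4, - 4) = vert (4 * q + 4) (- 4 * q - 4)"
  by ((rule seg_vertI; simp) | (rule seg_sepI; simp add: ht_def; presburger))+

lemma path_sep_bound:
  assumes "length w = 7" "path_point w 7 = (4, d)" "e \<in> path_edges w n"
  obtains q r where "r \<in> {0, Suc 0, 2, 3, 4, 5, 6}" "4 * int q + fst (path_point w r) < int n"
    "e = seg d (int q) (path_point w r) (path_point w (Suc r))"
proof -
  obtain q r where qr: "r < 7" "4 * int q + fst (path_point w r) < int n"
    "e = seg d (int q) (path_point w r) (path_point w (Suc r))"
    using assms(3) unfolding path_edges_seg[OF assms(1,2)] by blast
  have "r \<in> {0, Suc 0, 2, 3, 4, 5, 6}"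
    using less7_cases[OF qr(1)] by simp
  then show ?thesis
    using qr(2,3) by (rule that)
qed

lemma path_memI:
  assumes w: "length w = 7" "path_point w 7 = (4, d)" and q: "0 \<le> q" and r: "r < 7"
    and "4 * q + fst (path_point w r) < int n"
  shows "seg d q (path_point w r) (path_point w (Suc r)) \<in> path_edges w n"
  unfolding path_edges_seg[OF w] using assms by (intro exI[of _ "nat q"] exI[of _ r]) simp

lemma nwZ_mem:
  assumes "0 \<le> q"
  shows "4 * q < int n \<Longrightarrow> vert (4 * q) (4 * q) \<in> path_edges nwZ n"
    "4 * q < int n \<Longrightarrow> sep (4 * q) (6 * q + 2) \<in> path_edges nwZ n"
    "4 * q + 1 < int n \<Longrightarrow> vert (4 * q + 1) (4 * q + 1) \<in> path_edges nwZ n"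
    "4 * q + 1 < int n \<Longrightarrow> sep (4 * q + 1) (6 * q + 3) \<in> path_edges nwZ n"
    "4 * q + 2 < int n \<Longrightarrow> sep (4 * q + 2) (6 * q + 4) \<in> path_edges nwZ n"
    "4 * q + 3 < int n \<Longrightarrow> sep (4 * q + 3) (6 * q + 5) \<in> path_edges nwZ n"
    "4 * q + 4 < int n \<Longrightarrow> vert (4 * q + 4) (4 * q + 3) \<in> path_edges nwZ n"
  using path_memI[of nwZ 4 q 0 n] path_memI[of nwZ 4 q "Suc 0" n] path_memI[of nwZ 4 q 2 n]
    path_memI[of nwZ 4 q 3 n] path_memI[of nwZ 4 q 4 n] path_memI[of nwZ 4 q 5 n] path_memI[of nwZ 4 q 6 n] assms
  by (simp_all add: nwZ_points nwZ_segs flip: numeral_2_eq_2)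

lemma swZ_mem:
  assumes "0 \<le> q"
  shows "4 * q < int n \<Longrightarrow> sep (4 * q) (6 * - q + 0) \<in> path_edges swZ n"
    "4 * q + 1 < int n \<Longrightarrow> vert (4 * q + 1) (- 4 * q - 1) \<in> path_edges swZ n"
    "4 * q + 1 < int n \<Longrightarrow> vert (4 * q + 1) (- 4 * q - 2) \<in> path_edges swZ n"
    "4 * q + 1 < int n \<Longrightarrow> sep (4 * q + 1) (6 * - q + - 3) \<in> path_edges swZ n"
    "4 * q + 2 < int n \<Longrightarrow> vert (4 * q + 2) (- 4 * q - 3) \<in> path_edges swZ n"
    "4 * q + 2 < int n \<Longrightarrow> sep (4 * q + 2) (6 * - q + - 4) \<in> path_edges swZ n"
    "4 * q + 3 < int n \<Longrightarrow> sep (4 * q + 3) (6 * - q + - 5) \<in> path_edges swZ n"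
  using path_memI[of swZ "-4" q 0 n] path_memI[of swZ "-4" q "Suc 0" n] path_memI[of swZ "-4" q 2 n]
    path_memI[of swZ "-4" q 3 n] path_memI[of swZ "-4" q 4 n] path_memI[of swZ "-4" q 5 n] path_memI[of swZ "-4" q 6 n] assms
  by (simp_all add: swZ_points swZ_segs flip: numeral_2_eq_2)

lemma nwB_mem:
  assumes "0 \<le> q"
  shows "4 * q < int n \<Longrightarrow> sep (4 * q) (6 * q + 1) \<in> path_edges nwB n"
    "4 * q + 1 < int n \<Longrightarrow> sep (4 * q + 1) (6 * q + 2) \<in> path_edges nwB n"
    "4 * q + 2 < int n \<Longrightarrow> vert (4 * q + 2) (4 * q + 1) \<in> path_edges nwB n"
    "4 * q + 2 < int n \<Longrightarrow> sep (4 * q + 2) (6 * q + 3) \<in> path_edges nwB n"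
    "4 * q + 3 < int n \<Longrightarrow> vert (4 * q + 3) (4 * q + 2) \<in> path_edges nwB n"
    "4 * q + 3 < int n \<Longrightarrow> vert (4 * q + 3) (4 * q + 3) \<in> path_edges nwB n"
    "4 * q + 3 < int n \<Longrightarrow> sep (4 * q + 3) (6 * q + 6) \<in> path_edges nwB n"
  using path_memI[of nwB 4 q 0 n] path_memI[of nwB 4 q "Suc 0" n] path_memI[of nwB 4 q 2 n]
    path_memI[of nwB 4 q 3 n] path_memI[of nwB 4 q 4 n] path_memI[of nwB 4 q 5 n] path_memI[of nwB 4 q 6 n] assms
  by (simp_all add: nwB_points nwB_segs flip: numeral_2_eq_2)

lemma swB_mem:
  assumes "0 \<le> q"
  shows "4 * q < int n \<Longrightarrow> vert (4 * q) (- 4 * q - 1) \<in> path_edges swB n"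
    "4 * q < int n \<Longrightarrow> sep (4 * q) (6 * - q + - 1) \<in> path_edges swB n"
    "4 * q + 1 < int n \<Longrightarrow> sep (4 * q + 1) (6 * - q + - 2) \<in> path_edges swB n"
    "4 * q + 2 < int n \<Longrightarrow> sep (4 * q + 2) (6 * - q + - 3) \<in> path_edges swB n"
    "4 * q + 3 < int n \<Longrightarrow> vert (4 * q + 3) (- 4 * q - 3) \<in> path_edges swB n"
    "4 * q + 3 < int n \<Longrightarrow> sep (4 * q + 3) (6 * - q + - 4) \<in> path_edges swB n"
    "4 * q + 4 < int n \<Longrightarrow> vert (4 * q + 4) (- 4 * q - 4) \<in> path_edges swB n"
  using path_memI[of swB "-4" q 0 n] path_memI[of swB "-4" q "Suc 0" n] path_memI[of swB "-4" q 2 n]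
    path_memI[of swB "-4" q 3 n] path_memI[of swB "-4" q 4 n] path_memI[of swB "-4" q 5 n] path_memI[of swB "-4" q 6 n] assms
  by (simp_all add: swB_points swB_segs flip: numeral_2_eq_2)

lemma nwZ_sepD:
  assumes "sep x t \<in> path_edges nwZ n"
  shows "0 \<le> x \<and> x < int n \<and> t = quarter 2 3 4 5 x"
proof -
  have "length nwZ = 7" by simp
  from path_sep_bound[OF this nwZ_points(8) assms] obtain q r
    where r: "r \<in> {0, Suc 0, 2, 3, 4, 5, 6}" and b: "4 * int q + fst (path_point nwZ r) < int n"
      and e: "sep x t = seg 4 (int q) (path_point nwZ r) (path_point nwZ (Suc r))" .
  from r show ?thesis
    using b e by (elim insertE emptyE; simp add: nwZ_points nwZ_segs sep_inject vert_neq_sep quarter_simps flip: numeral_2_eq_2)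
qed

lemma swZ_sepD:
  assumes "sep x t \<in> path_edges swZ n"
  shows "0 \<le> x \<and> x < int n \<and> t = - quarter 0 3 4 5 x"
proof -
  have "length swZ = 7" by simp
  from path_sep_bound[OF this swZ_points(8) assms] obtain q r
    where r: "r \<in> {0, Suc 0, 2, 3, 4, 5, 6}" and b: "4 * int q + fst (path_point swZ r) < int n"
      and e: "sep x t = seg (- 4) (int q) (path_point swZ r) (path_point swZ (Suc r))" .
  from r show ?thesis
    using b e by (elim insertE emptyE; simp add: swZ_points swZ_segs sep_inject vert_neq_sep quarter_simps flip: numeral_2_eq_2)
qed

lemma nwB_sepD:
  assumes "sep x t \<in> path_edges nwB n"
  shows "0 \<le> x \<and> x < int n \<and> t = quarter 1 2 3 6 x"
proof -
  have "length nwB = 7" by simp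
  from path_sep_bound[OF this nwB_points(8) assms] obtain q r
    where r: "r \<in> {0, Suc 0, 2, 3, 4, 5, 6}" and b: "4 * int q + fst (path_point nwB r) < int n"
      and e: "sep x t = seg 4 (int q) (path_point nwB r) (path_point nwB (Suc r))" .
  from r show ?thesis
    using b e by (elim insertE emptyE; simp add: nwB_points nwB_segs sep_inject vert_neq_sep quarter_simps flip: numeral_2_eq_2)
qed

lemma swB_sepD:
  assumes "sep x t \<in> path_edges swB n"
  shows "0 \<le> x \<and> x < int n \<and> t = - quarter 1 2 3 4 x"
proof -
  have "length swB = 7" by simp
  from path_sep_bound[OF this swB_points(8) assms] obtain q r
    where r: "r \<in> {0, Suc 0, 2, 3, 4, 5, 6}" and b: "4 * int q + fst (path_point swB r) < int n"
      and e: "sep x t = seg (- 4) (int q) (path_point swB r) (path_point swB (Suc r))" .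
  from r show ?thesis
    using b e by (elim insertE emptyE; simp add: swB_points swB_segs sep_inject vert_neq_sep quarter_simps flip: numeral_2_eq_2)
qed

lemma quarter_nonneg:
  "0 \<le> x \<Longrightarrow> 0 \<le> a \<Longrightarrow> 0 \<le> b \<Longrightarrow> 0 \<le> c \<Longrightarrow> 0 \<le> d \<Longrightarrow> 0 \<le> quarter a b c d x"
  by (simp add: quarter_def pos_imp_zdiv_nonneg_iff)

lemma ht_eqI: "3 * y \<le> 2 * s + of_bool (odd x) \<Longrightarrow> 2 * s + of_bool (odd x) < 3 * y + 3 \<Longrightarrow> ht x s = y"
  unfolding ht_def by linarith

lemma quarter_simps':
  "quarter a b c d (1 + 4 * q) = 6 * q + b" "quarter a b c d (2 + 4 * q) = 6 * q + c"
  using quarter_simps(2,3)[of a b c d q] by (simp_all add: add.commute)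

lemma ht_degenerate:
  "ht x s \<noteq> ht x (s + 1) \<Longrightarrow> 3 * y \<le> 2 * s + of_bool (odd x) \<Longrightarrow>
    2 * s + 2 + of_bool (odd x) < 3 * y + 3 \<Longrightarrow> P"
  using ht_eqI[of y s x] ht_eqI[of y "s + 1" x] by simp

lemma side_memI:
  assumes "ht x s \<noteq> ht x (s + 1)" "3 * y \<le> 2 * s + of_bool (odd x)"
    "2 * s + of_bool (odd x) < 3 * y + 3" "vert x y \<in> W"
  shows "side x s \<in> W"
  using side_vert[OF assms(1)] ht_eqI[OF assms(2,3)] assms(4) by simp

lemma Z_columns:
  assumes "0 < n"
  shows "Z n = cellat ` columns (\<lambda>x. - quarter 0 3 4 5 x) (quarter 2 3 4 5) n"
proof -
  let ?W = "path_edges nwZ n \<union> path_edges swZ n"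
  have "enclosed (?W \<union> (\<lambda>e. reflect n ` e) ` ?W) =
      cellat ` columns (\<lambda>x. - quarter 0 3 4 5 x) (quarter 2 3 4 5) n"
  proof (rule enclosed_reflect)
    fix x :: int assume "0 \<le> x"
    then show "- quarter 0 3 4 5 x \<le> quarter 2 3 4 5 x"
      using quarter_nonneg[of x 0 3 4 5] quarter_nonneg[of x 2 3 4 5] by simp
  next
    fix x t assume "sep x t \<in> ?W"
    then show "0 \<le> x \<and> x < int n \<and> (t = quarter 2 3 4 5 x \<or> t = - quarter 0 3 4 5 x)"
      using nwZ_sepD[of x t n] swZ_sepD[of x t n] by blast
  next
    fix x :: int assume x: "0 \<le> x" "x < int n"
    show "sep x (quarter 2 3 4 5 x) \<in> ?W"
      using x by (cases x rule: mod4_cases) (auto simp: quarter_simps intro!: nwZ_mem UnI1)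
  next
    fix x :: int assume x: "0 \<le> x" "x < int n"
    show "sep x (- quarter 0 3 4 5 x) \<in> ?W"
    proof (cases x rule: mod4_cases)
      case (1 q)
      then show ?thesis using x swZ_mem(1)[of q n] by (simp add: quarter_simps)
    next
      case (2 q)
      then show ?thesis using x swZ_mem(4)[of q n] by (simp add: quarter_simps)
    next
      case (3 q)
      then show ?thesis using x swZ_mem(6)[of q n] by (simp add: quarter_simps)
    next
      case (4 q)
      then show ?thesis using x swZ_mem(7)[of q n] by (simp add: quarter_simps)
    qed
  next
    fix x s assume x: "0 \<le> x" "x < int n" and nd: "ht x s \<noteq> ht x (s + 1)"
      and d: "(1 \<le> x \<and> - quarter 0 3 4 5 (x - 1) \<le> s \<and> s < quarter 2 3 4 5 (x - 1)) \<noteq>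
        (- quarter 0 3 4 5 x \<le> s \<and> s < quarter 2 3 4 5 x)"
    show "side x s \<in> ?W"
    proof (cases x rule: mod4_cases)
      case (1 q)
      \<comment> \<open>These are the slots in which columns \<open>x - 1\<close> and
        \<open>x\<close> differ. Either the slot has no vertical side on this line, contradicting
        \<open>nd\<close>, or its side is a vertical step of one of the paths. The last slot
        requires \<open>1 \<le> q\<close> because column -1 is empty.\<close>
      have "s = - 6 * q \<or> s = 6 * q \<or> s = 6 * q + 1 \<or> (s = 6 * q - 1 \<and> 1 \<le> q)"
        using d x 1 by (simp add: quarter_simps quarter_simps') linarith
      then show ?thesis
      proof (elim disjE)
        assume s: "s = - 6 * q"
        show ?thesis
          by (rule ht_degenerate[OF nd, of "- 4 * q"]) (use s 1 in simp_all)
      next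
        assume s: "s = 6 * q"
        show ?thesis
          by (rule ht_degenerate[OF nd, of "4 * q"]) (use s 1 in simp_all)
      next
        assume s: "s = 6 * q + 1"
        show ?thesis
          by (rule side_memI[OF nd, of "4 * q"]) (use s 1 x nwZ_mem(1)[of "q" n] in simp_all)
      next
        assume s: "s = 6 * q - 1 \<and> 1 \<le> q"
        show ?thesis
          by (rule side_memI[OF nd, of "4 * q - 1"]) (use s 1 x nwZ_mem(7)[of "q - 1" n] in simp_all)
      qed
    next
      case (2 q)
      have "s = 6 * q + 2 \<or> s = - 6 * q - 1 \<or> s = - 6 * q - 2 \<or> s = - 6 * q - 3"
        using d x 2 by (simp add: quarter_simps quarter_simps') linarith
      then show ?thesis
      proof (elim disjE)
        assume s: "s = 6 * q + 2"
        show ?thesis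
          by (rule side_memI[OF nd, of "4 * q + 1"]) (use s 2 x nwZ_mem(3)[of "q" n] in simp_all)
      next
        assume s: "s = - 6 * q - 1"
        show ?thesis
          by (rule side_memI[OF nd, of "- 4 * q - 1"]) (use s 2 x swZ_mem(2)[of "q" n] in simp_all)
      next
        assume s: "s = - 6 * q - 2"
        show ?thesis
          by (rule ht_degenerate[OF nd, of "- 4 * q - 1"]) (use s 2 in simp_all)
      next
        assume s: "s = - 6 * q - 3"
        show ?thesis
          by (rule side_memI[OF nd, of "- 4 * q - 2"]) (use s 2 x swZ_mem(3)[of "q" n] in simp_all)
      qed
    next
      case (3 q)
      have "s = 6 * q + 3 \<or> s = - 6 * q - 4"
        using d x 3 by (simp add: quarter_simps quarter_simps') linarith
      then show ?thesis
      proof (elim disjE)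
        assume s: "s = 6 * q + 3"
        show ?thesis
          by (rule ht_degenerate[OF nd, of "4 * q + 2"]) (use s 3 in simp_all)
      next
        assume s: "s = - 6 * q - 4"
        show ?thesis
          by (rule side_memI[OF nd, of "- 4 * q - 3"]) (use s 3 x swZ_mem(5)[of "q" n] in simp_all)
      qed
    next
      case (4 q)
      have "s = 6 * q + 4 \<or> s = - 6 * q - 5"
        using d x 4 by (simp add: quarter_simps quarter_simps') linarith
      then show ?thesis
      proof (elim disjE)
        assume s: "s = 6 * q + 4"
        show ?thesis
          by (rule ht_degenerate[OF nd, of "4 * q + 3"]) (use s 4 in simp_all)
      next
        assume s: "s = - 6 * q - 5"
        show ?thesis
          by (rule ht_degenerate[OF nd, of "- 4 * q - 3"]) (use s 4 in simp_all)
      qed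
    qed
  qed
  then show ?thesis
    using assms by (simp add: Z_def region_def Let_def)
qed

lemma Zbar_columns:
  assumes "0 < n"
  shows "Zbar n = cellat ` columns (\<lambda>x. - quarter 1 2 3 4 x) (quarter 1 2 3 6) n"
proof -
  let ?W = "path_edges nwB n \<union> path_edges swB n"
  have "enclosed (?W \<union> (\<lambda>e. reflect n ` e) ` ?W) =
      cellat ` columns (\<lambda>x. - quarter 1 2 3 4 x) (quarter 1 2 3 6) n"
  proof (rule enclosed_reflect)
    fix x :: int assume "0 \<le> x"
    then show "- quarter 1 2 3 4 x \<le> quarter 1 2 3 6 x"
      using quarter_nonneg[of x 1 2 3 4] quarter_nonneg[of x 1 2 3 6] by simp
  next
    fix x t assume "sep x t \<in> ?W"
    then show "0 \<le> x \<and> x < int n \<and> (t = quarter 1 2 3 6 x \<or> t = - quarter 1 2 3 4 x)"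
      using nwB_sepD[of x t n] swB_sepD[of x t n] by blast
  next
    fix x :: int assume x: "0 \<le> x" "x < int n"
    show "sep x (quarter 1 2 3 6 x) \<in> ?W"
      using x by (cases x rule: mod4_cases) (auto simp: quarter_simps intro!: nwB_mem UnI1)
  next
    fix x :: int assume x: "0 \<le> x" "x < int n"
    show "sep x (- quarter 1 2 3 4 x) \<in> ?W"
    proof (cases x rule: mod4_cases)
      case (1 q)
      then show ?thesis using x swB_mem(2)[of q n] by (simp add: quarter_simps)
    next
      case (2 q)
      then show ?thesis using x swB_mem(3)[of q n] by (simp add: quarter_simps)
    next
      case (3 q)
      then show ?thesis using x swB_mem(4)[of q n] by (simp add: quarter_simps)
    next
      case (4 q)
      then show ?thesis using x swB_mem(6)[of q n] by (simp add: quarter_simps)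
    qed
  next
    fix x s assume x: "0 \<le> x" "x < int n" and nd: "ht x s \<noteq> ht x (s + 1)"
      and d: "(1 \<le> x \<and> - quarter 1 2 3 4 (x - 1) \<le> s \<and> s < quarter 1 2 3 6 (x - 1)) \<noteq>
        (- quarter 1 2 3 4 x \<le> s \<and> s < quarter 1 2 3 6 x)"
    show "side x s \<in> ?W"
    proof (cases x rule: mod4_cases)
      case (1 q)
      have "s = 6 * q \<or> s = - 6 * q - 1 \<or> s = - 6 * q \<or> (s = - 6 * q + 1 \<and> 1 \<le> q)"
        using d x 1 by (simp add: quarter_simps quarter_simps') linarith
      then show ?thesis
      proof (elim disjE)
        assume s: "s = 6 * q"
        show ?thesis
          by (rule ht_degenerate[OF nd, of "4 * q"]) (use s 1 in simp_all)
      next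
        assume s: "s = - 6 * q - 1"
        show ?thesis
          by (rule side_memI[OF nd, of "- 4 * q - 1"]) (use s 1 x swB_mem(1)[of "q" n] in simp_all)
      next
        assume s: "s = - 6 * q"
        show ?thesis
          by (rule ht_degenerate[OF nd, of "- 4 * q"]) (use s 1 in simp_all)
      next
        assume s: "s = - 6 * q + 1 \<and> 1 \<le> q"
        show ?thesis
          by (rule side_memI[OF nd, of "- 4 * q"]) (use s 1 x swB_mem(7)[of "q - 1" n] in simp_all)
      qed
    next
      case (2 q)
      have "s = 6 * q + 1 \<or> s = - 6 * q - 2"
        using d x 2 by (simp add: quarter_simps quarter_simps') linarith
      then show ?thesis
      proof (elim disjE)
        assume s: "s = 6 * q + 1"
        show ?thesis
          by (rule ht_degenerate[OF nd, of "4 * q + 1"]) (use s 2 in simp_all)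
      next
        assume s: "s = - 6 * q - 2"
        show ?thesis
          by (rule ht_degenerate[OF nd, of "- 4 * q - 1"]) (use s 2 in simp_all)
      qed
    next
      case (3 q)
      have "s = 6 * q + 2 \<or> s = - 6 * q - 3"
        using d x 3 by (simp add: quarter_simps quarter_simps') linarith
      then show ?thesis
      proof (elim disjE)
        assume s: "s = 6 * q + 2"
        show ?thesis
          by (rule side_memI[OF nd, of "4 * q + 1"]) (use s 3 x nwB_mem(3)[of "q" n] in simp_all)
      next
        assume s: "s = - 6 * q - 3"
        show ?thesis
          by (rule ht_degenerate[OF nd, of "- 4 * q - 2"]) (use s 3 in simp_all)
      qed
    next
      case (4 q)
      have "s = 6 * q + 3 \<or> s = 6 * q + 4 \<or> s = 6 * q + 5 \<or> s = - 6 * q - 4"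
        using d x 4 by (simp add: quarter_simps quarter_simps') linarith
      then show ?thesis
      proof (elim disjE)
        assume s: "s = 6 * q + 3"
        show ?thesis
          by (rule side_memI[OF nd, of "4 * q + 2"]) (use s 4 x nwB_mem(5)[of "q" n] in simp_all)
      next
        assume s: "s = 6 * q + 4"
        show ?thesis
          by (rule ht_degenerate[OF nd, of "4 * q + 3"]) (use s 4 in simp_all)
      next
        assume s: "s = 6 * q + 5"
        show ?thesis
          by (rule side_memI[OF nd, of "4 * q + 3"]) (use s 4 x nwB_mem(6)[of "q" n] in simp_all)
      next
        assume s: "s = - 6 * q - 4"
        show ?thesis
          by (rule side_memI[OF nd, of "- 4 * q - 3"]) (use s 4 x swB_mem(5)[of "q" n] in simp_all)
      qed
    qed
  qed
  then show ?thesis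
    using assms by (simp add: Zbar_def region_def Let_def)
qed

section \<open>Forced tiles\<close>

lemma msum_forced_set:
  assumes "finite U" "finite V" "U \<subseteq> V" "inj_on f U" "f ` U \<subseteq> V - U"
    and "\<And>u. u \<in> U \<Longrightarrow> {u, f u} \<in> E"
    and "\<And>u e. u \<in> U \<Longrightarrow> e \<in> E \<Longrightarrow> e \<subseteq> V \<Longrightarrow> u \<in> e \<Longrightarrow> e = {u, f u}"
  shows "msum V E (\<lambda>_. 1) = msum (V - U - f ` U) E (\<lambda>_. 1)"
  using assms
proof (induction U arbitrary: V rule: finite_induct)
  case empty
  then show ?case by simp
next
  case (insert u U)
  have "msum V E (\<lambda>_. 1) = 1 * msum (V - {u, f u}) E (\<lambda>_. 1)"
    by (rule msum_forced) (use insert.prems in auto)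
  also have "msum (V - {u, f u}) E (\<lambda>_. 1) = msum (V - {u, f u} - U - f ` U) E (\<lambda>_. 1)"
  proof (rule insert.IH)
    have "f u \<notin> f ` U"
      using insert.hyps(2) insert.prems(3) by (auto simp: inj_on_def)
    moreover have "f u \<notin> U" "u \<notin> f ` U" "f ` U \<subseteq> V - U"
      using insert.prems(4) by auto
    ultimately show "f ` U \<subseteq> V - {u, f u} - U" "U \<subseteq> V - {u, f u}"
      using insert.prems(2) insert.hyps(2) by blast+
  next
    fix v e assume "v \<in> U" "e \<in> E" "e \<subseteq> V - {u, f u}" "v \<in> e"
    then show "e = {v, f v}"
      using insert.prems(6)[of v e] by auto
  qed (use insert.prems in auto)
  also have "V - {u, f u} - U - f ` U = V - insert u U - f ` insert u U"
    by auto
  finally show ?case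
    by simp
qed

lemma dual_edge_neighbours:
  assumes "e \<in> dual_edges" "(x, s) \<in> e"
  shows "e = {(x, s), (x, s + 1)} \<or> e = {(x, s), (x, s - 1)} \<or>
    e = {(x, s), (x + 1, s)} \<and> hadj x s \<or> e = {(x, s), (x - 1, s)} \<and> hadj (x - 1) s"
proof -
  consider a b where "e = {(a, b), (a, b + 1)}" | a b where "e = {(a, b), (a + 1, b)}" "hadj a b"
    using assms(1) unfolding dual_edges_def by blast
  then show ?thesis
  proof cases
    case (1 a b)
    then consider "a = x" "b = s" | "a = x" "b = s - 1"
      using assms(2) by auto
    then show ?thesis
    proof cases
      case a: 1
      then show ?thesis unfolding 1 by simp
    next
      case a: 2
      then show ?thesis unfolding 1 by (simp add: insert_commute[of "(x, s - 1)"])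
    qed
  next
    case (2 a b)
    then consider "a = x" "b = s" | "a = x - 1" "b = s"
      using assms(2) by auto
    then show ?thesis
    proof cases
      case a: 1
      then show ?thesis using 2 by simp
    next
      case a: 2
      then show ?thesis using 2 by (simp add: insert_commute[of "(x - 1, s)"])
    qed
  qed
qed

text \<open>Left of the axis \<open>f\<close> is \<open>x\<close> and right of it
  \<open>2 * n - 1 - x\<close>, so comparing parities tells on which side the next outer column
  lies.\<close>

lemma fold_col_neighbours:
  assumes "fold_col n x = f" "0 \<le> f"
  shows "even x \<longleftrightarrow> even f \<Longrightarrow> fold_col n (x - 1) = f - 1" "\<not> (even x \<longleftrightarrow> even f) \<Longrightarrow> fold_col n (x + 1) = f - 1"
proof -
  have "x < int n \<and> f = x \<or> int n \<le> x \<and> f = 2 * int n - 1 - x"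
    using assms(1) by (auto simp: fold_col_def)
  then show "even x \<longleftrightarrow> even f \<Longrightarrow> fold_col n (x - 1) = f - 1" "\<not> (even x \<longleftrightarrow> even f) \<Longrightarrow> fold_col n (x + 1) = f - 1"
    by (auto simp: fold_col_def)
qed

text \<open>In \<open>Z\<close> (but not in \<open>Zbar\<close>) some triangles on the boundary can only be matched across their diagonal.\<close>

lemma msum_Z_columns:
  "msum (columns (\<lambda>x. - quarter 0 3 4 5 x) (quarter 2 3 4 5) n) dual_edges (\<lambda>_. 1) =
   msum (columns (\<lambda>x. - quarter 0 1 4 5 x) (quarter 0 3 4 5) n) dual_edges (\<lambda>_. 1)"
proof -
  let ?V = "columns (\<lambda>x. - quarter 0 3 4 5 x) (quarter 2 3 4 5) n"
  let ?V' = "columns (\<lambda>x. - quarter 0 1 4 5 x) (quarter 0 3 4 5) n"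
  \<comment> \<open>The topmost triangles of the columns \<open>4 * q\<close> and the lowest ones of
    the columns \<open>4 * q + 1\<close>. Their only lateral neighbour is in the next outer column,
    which is too short to contain it, so only the partner across the diagonal is left.\<close>
  define U where "U = {(x, s). 0 \<le> fold_col n x \<and>
    (fold_col n x mod 4 = 0 \<and> s = 6 * (fold_col n x div 4) + 1 \<or>
     fold_col n x mod 4 = 1 \<and> s = - 6 * (fold_col n x div 4) - 3)}"
  \<comment> \<open>The partner across the diagonal; positive slots in \<open>U\<close> are tops and
    negative ones are bottoms.\<close>
  define f :: "point \<Rightarrow> point" where "f = (\<lambda>(x, s). (x, if 0 < s then s - 1 else s + 1))"
  have U_iff: "(x, s) \<in> U \<longleftrightarrow> 0 \<le> fold_col n x \<and>
      (s = 6 * q + 1 \<and> j = 0 \<or> s = - 6 * q - 3 \<and> j = 1)"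
    if "fold_col n x = 4 * q + j" "j \<in> {0, 1, 2, 3}" for x s q j
  proof -
    have "0 \<le> j" "j < 4"
      using that(2) by auto
    then have dm: "fold_col n x div 4 = q" "fold_col n x mod 4 = j"
      unfolding that(1) by presburger+
    show ?thesis
      unfolding U_def mem_Collect_eq case_prod_conv dm by blast
  qed
  have U_cases: thesis if U: "(x, s) \<in> U"
    and 1: "\<And>q. 0 \<le> q \<Longrightarrow> fold_col n x = 4 * q \<Longrightarrow> s = 6 * q + 1 \<Longrightarrow> thesis"
    and 2: "\<And>q. 0 \<le> q \<Longrightarrow> fold_col n x = 4 * q + 1 \<Longrightarrow> s = - 6 * q - 3 \<Longrightarrow> thesis" for x s thesis
  proof (cases "fold_col n x" rule: mod4_cases)
    case (1 q)
    then show ?thesis using U U_iff[of x q 0 s] that(2)[of q] by simp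
  next
    case (2 q)
    then show ?thesis using U U_iff[of x q 1 s] that(3)[of q] by simp
  next
    case (3 q)
    then show ?thesis using U U_iff[of x q 2 s] by simp
  next
    case (4 q)
    then show ?thesis using U U_iff[of x q 3 s] by simp
  qed
  have UV: "U \<subseteq> ?V"
  proof
    fix u assume u: "u \<in> U"
    obtain x s where xs: "u = (x, s)" by fastforce
    from u[unfolded xs] show "u \<in> ?V"
      by (rule U_cases) (simp_all add: xs mem_columns quarter_simps)
  qed
  have only: "e = {u, f u}" if u: "u \<in> U" and e: "e \<in> dual_edges" "e \<subseteq> ?V" "u \<in> e" for u e
  proof -
    obtain x s where xs: "u = (x, s)" by fastforce
    note nb = dual_edge_neighbours[OF e(1) e(3)[unfolded xs]]
    from u[unfolded xs] show ?thesis
    proof (rule U_cases)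
      fix q assume q: "0 \<le> q" "fold_col n x = 4 * q" "s = 6 * q + 1"
      have "s mod 3 = 1"
        unfolding q(3) by presburger
      have 1: "(x, s + 1) \<notin> ?V"
        using q by (simp add: mem_columns quarter_simps)
      have 2: "(x + 1, s) \<notin> ?V" if "hadj x s"
        using that fold_col_neighbours(2)[OF q(2)] q \<open>s mod 3 = 1\<close>
        by (auto simp: mem_columns quarter_simps hadj_def)
      have 3: "(x - 1, s) \<notin> ?V" if "hadj (x - 1) s"
        using that fold_col_neighbours(1)[OF q(2)] q \<open>s mod 3 = 1\<close>
        by (auto simp: mem_columns quarter_simps hadj_def)
      have "e = {(x, s), (x, s - 1)}"
        using nb 1 2 3 e(2) by blast
      then show ?thesis
        using q by (simp add: xs f_def)
    next
      fix q assume q: "0 \<le> q" "fold_col n x = 4 * q + 1" "s = - 6 * q - 3"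
      have "s mod 3 = 0"
        unfolding q(3) by presburger
      have 1: "(x, s - 1) \<notin> ?V"
        using q by (simp add: mem_columns quarter_simps)
      have 2: "(x + 1, s) \<notin> ?V" if "hadj x s"
        using that fold_col_neighbours(2)[OF q(2)] q \<open>s mod 3 = 0\<close>
        by (auto simp: mem_columns quarter_simps hadj_def)
      have 3: "(x - 1, s) \<notin> ?V" if "hadj (x - 1) s"
        using that fold_col_neighbours(1)[OF q(2)] q \<open>s mod 3 = 0\<close>
        by (auto simp: mem_columns quarter_simps hadj_def)
      have "e = {(x, s), (x, s + 1)}"
        using nb 1 2 3 e(2) by blast
      then show ?thesis
        using q by (simp add: xs f_def)
    qed
  qed
  have "msum ?V dual_edges (\<lambda>_. 1) = msum (?V - U - f ` U) dual_edges (\<lambda>_. 1)"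
  proof (rule msum_forced_set[OF _ finite_columns UV])
    show "finite U"
      using UV finite_columns by (rule finite_subset)
    show "inj_on f U"
    proof (rule inj_onI)
      fix u v assume uv: "u \<in> U" "v \<in> U" "f u = f v"
      obtain x s y t where xs: "u = (x, s)" "v = (y, t)" by fastforce
      have "x = y"
        using uv(3) by (simp add: xs f_def)
      from uv(1)[unfolded xs] show "u = v"
      proof (rule U_cases)
        fix q assume "0 \<le> q" "fold_col n x = 4 * q" "s = 6 * q + 1"
        then show ?thesis
          using uv(2) U_iff[of x q 0 t] by (simp add: xs \<open>x = y\<close>)
      next
        fix q assume "0 \<le> q" "fold_col n x = 4 * q + 1" "s = - 6 * q - 3"
        then show ?thesis
          using uv(2) U_iff[of x q 1 t] by (simp add: xs \<open>x = y\<close>)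
      qed
    qed
    show "f ` U \<subseteq> ?V - U"
    proof (rule image_subsetI)
      fix u assume u: "u \<in> U"
      obtain x s where xs: "u = (x, s)" by fastforce
      from u[unfolded xs] show "f u \<in> ?V - U"
      proof (rule U_cases)
        fix q assume q: "0 \<le> q" "fold_col n x = 4 * q" "s = 6 * q + 1"
        then show ?thesis
          using U_iff[of x q 0 "s - 1"] by (simp add: xs f_def mem_columns quarter_simps)
      next
        fix q assume q: "0 \<le> q" "fold_col n x = 4 * q + 1" "s = - 6 * q - 3"
        then show ?thesis
          using U_iff[of x q 1 "s + 1"] by (simp add: xs f_def mem_columns quarter_simps)
      qed
    qed
    show "{u, f u} \<in> dual_edges" if "u \<in> U" for u
      using vertical_dual_edge by (cases u) (simp add: f_def)
  qed (use only in blast)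
  also have "?V - U - f ` U = ?V'"
  proof (rule set_eqI)
    fix p :: point
    obtain x s where p: "p = (x, s)" by fastforce
    have fU: "(x, s) \<in> f ` U \<longleftrightarrow> 0 \<le> fold_col n x \<and> (s = 6 * q \<and> j = 0 \<or> s = - 6 * q - 2 \<and> j = 1)"
      if j: "fold_col n x = 4 * q + j" "j \<in> {0, 1, 2, 3}" for q j
    proof
      assume "(x, s) \<in> f ` U"
      then obtain s' where s': "(x, s') \<in> U" "s = (if 0 < s' then s' - 1 else s' + 1)"
        by (auto simp: f_def)
      then show "0 \<le> fold_col n x \<and> (s = 6 * q \<and> j = 0 \<or> s = - 6 * q - 2 \<and> j = 1)"
        using U_iff[OF j, of s'] j by auto
    next
      assume a: "0 \<le> fold_col n x \<and> (s = 6 * q \<and> j = 0 \<or> s = - 6 * q - 2 \<and> j = 1)"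
      then have "0 \<le> q"
        using j by auto
      show "(x, s) \<in> f ` U"
      proof (cases "j = 0")
        case True
        then have "(x, s + 1) \<in> U" "f (x, s + 1) = (x, s)"
          using a U_iff[OF j, of "s + 1"] \<open>0 \<le> q\<close> by (simp_all add: f_def)
        then show ?thesis by (metis imageI)
      next
        case False
        then have "(x, s - 1) \<in> U" "f (x, s - 1) = (x, s)"
          using a U_iff[OF j, of "s - 1"] \<open>0 \<le> q\<close> by (simp_all add: f_def)
        then show ?thesis by (metis imageI)
      qed
    qed
    show "p \<in> ?V - U - f ` U \<longleftrightarrow> p \<in> ?V'"
    proof (cases "fold_col n x" rule: mod4_cases)
      case (1 q)
      then show ?thesis
        using U_iff[of x q 0 s] fU[of q 0] by (auto simp: p mem_columns quarter_simps)
    next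
      case (2 q)
      then show ?thesis
        using U_iff[of x q 1 s] fU[of q 1] by (auto simp: p mem_columns quarter_simps)
    next
      case (3 q)
      then show ?thesis
        using U_iff[of x q 2 s] fU[of q 2] by (auto simp: p mem_columns quarter_simps)
    next
      case (4 q)
      then show ?thesis
        using U_iff[of x q 3 s] fU[of q 3] by (auto simp: p mem_columns quarter_simps)
    qed
  qed
  finally show ?thesis .
qed

section \<open>The core described in folded columns\<close>

lemma tri_row_iff:
  "tri_row y = 3 * k \<longleftrightarrow> y = 2 * k" "tri_row y = 3 * k + 1 \<longleftrightarrow> y = 2 * k + 1" "tri_row y \<noteq> 3 * k + 2"
proof -
  show "tri_row y = 3 * k \<longleftrightarrow> y = 2 * k"
    by (cases y rule: parity_cases; simp add: tri_row_def level_even level_odd; presburger)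
  show "tri_row y = 3 * k + 1 \<longleftrightarrow> y = 2 * k + 1"
    by (cases y rule: parity_cases; simp add: tri_row_def level_even level_odd; presburger)
  show "tri_row y \<noteq> 3 * k + 2"
    by (cases y rule: parity_cases; simp add: tri_row_def level_even level_odd; presburger)
qed

lemma squares_fold_col:
  "(x - int (Suc N), y) \<in> squares (Suc N) \<longleftrightarrow> - fold_col (Suc N) x - 1 \<le> y \<and> y \<le> fold_col (Suc N) x"
  "(x - int (Suc N), y) \<in> squares N \<longleftrightarrow> - fold_col (Suc N) x \<le> y \<and> y \<le> fold_col (Suc N) x - 1"
  unfolding mem_squares fold_col_def by auto

text \<open>Of the two lattice points at height \<open>y\<close> bounding the column just one has
  the required parity, and this parity also turns weak bounds into strict ones.\<close>

lemma diamond_fold_col: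
  "(x - int (Suc N), y) \<in> diamond (Suc N) \<or> (x - int (Suc N) + 1, y) \<in> diamond (Suc N) \<longleftrightarrow>
    \<bar>y\<bar> \<le> fold_col (Suc N) x"
proof -
  define X n where "X = x - int (Suc N)" and "n = int (Suc N)"
  have f: "fold_col (Suc N) x = (if X < 0 then n + X else n - 1 - X)"
    by (auto simp: fold_col_def X_def n_def)
  have par: "odd (X + 1 + y - n) \<longleftrightarrow> even (X + y - n)"
    by presburger
  have m: "(u, y) \<in> diamond (Suc N) \<longleftrightarrow> \<bar>u\<bar> + \<bar>y\<bar> < n \<and> odd (u + y - n)" for u
    by (simp add: diamond_def n_def)
  have ab: "even (\<bar>u\<bar> + \<bar>y\<bar> - n) \<longleftrightarrow> even (u + y - n)" for u
    by auto
  have strict: "\<bar>u\<bar> + \<bar>y\<bar> < n \<longleftrightarrow> \<bar>u\<bar> + \<bar>y\<bar> \<le> n" if "odd (u + y - n)" for u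
  proof -
    have "\<bar>u\<bar> + \<bar>y\<bar> \<noteq> n"
      using that ab[of u] by auto
    then show ?thesis by auto
  qed
  show ?thesis
  proof (cases "odd (X + y - n)")
    case True
    then have "(X, y) \<in> diamond (Suc N) \<or> (X + 1, y) \<in> diamond (Suc N) \<longleftrightarrow> \<bar>X\<bar> + \<bar>y\<bar> < n"
      using par by (simp only: m) blast
    also have "\<dots> \<longleftrightarrow> \<bar>y\<bar> \<le> fold_col (Suc N) x"
      using strict[OF True] by (auto simp: f)
    finally show ?thesis
      by (simp add: X_def)
  next
    case False
    then have p: "odd (X + 1 + y - n)"
      using par by blast
    have "(X, y) \<in> diamond (Suc N) \<or> (X + 1, y) \<in> diamond (Suc N) \<longleftrightarrow> \<bar>X + 1\<bar> + \<bar>y\<bar> < n"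
      using False p by (simp only: m) blast
    also have "\<dots> \<longleftrightarrow> \<bar>y\<bar> \<le> fold_col (Suc N) x"
      using strict[OF p] by (auto simp: f)
    finally show ?thesis
      by (simp add: X_def)
  qed
qed

context
  fixes l :: "int \<Rightarrow> bool"
  assumes alt: "alternating l"
begin

lemma mem_core:
  "(x, s) \<in> core l (Suc N) \<longleftrightarrow>
    main_row l (2 * s div 3) = s \<and> - fold_col (Suc N) x - 1 \<le> 2 * s div 3 \<and> 2 * s div 3 \<le> fold_col (Suc N) x \<and>
      (even (2 * s div 3) \<or> \<not> l (2 * s div 3) \<longrightarrow>
        - fold_col (Suc N) x \<le> 2 * s div 3 \<and> 2 * s div 3 \<le> fold_col (Suc N) x - 1) \<or>
    (\<exists>y. l y \<and> tri_row y = s \<and> \<bar>y\<bar> \<le> fold_col (Suc N) x)"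
proof -
  let ?n = "Suc N" and ?Y = "2 * s div 3"
  have 1: "(x, s) \<in> embed ?n l ` V \<longleftrightarrow> main_row l ?Y = s \<and> (x - int ?n, ?Y) \<in> V" for V
  proof
    assume "(x, s) \<in> embed ?n l ` V"
    then obtain u y where "(u, y) \<in> V" "x = u + int ?n" "s = main_row l y"
      by auto
    then show "main_row l ?Y = s \<and> (x - int ?n, ?Y) \<in> V"
      using strip_main_row[of l y] by simp
  next
    assume a: "main_row l ?Y = s \<and> (x - int ?n, ?Y) \<in> V"
    then have "(x, s) = embed ?n l (x - int ?n, ?Y)"
      by simp
    then show "(x, s) \<in> embed ?n l ` V"
      using a by (metis imageI)
  qed
  have 2: "(x, s) \<in> priv ?n l (u, y) \<longleftrightarrow> l y \<and> tri_row y = s \<and> (u = x - int ?n \<or> u = x - int ?n + 1)" for u y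
    by auto
  have "(x, s) \<in> (\<Union>c\<in>diamond ?n. priv ?n l c) \<longleftrightarrow>
      (\<exists>u y. (u, y) \<in> diamond ?n \<and> (x, s) \<in> priv ?n l (u, y))"
    by (auto simp del: priv.simps)
  also have "\<dots> \<longleftrightarrow> (\<exists>y. l y \<and> tri_row y = s \<and>
      ((x - int ?n, y) \<in> diamond ?n \<or> (x - int ?n + 1, y) \<in> diamond ?n))"
    unfolding 2 by blast
  finally have P: "(x, s) \<in> (\<Union>c\<in>diamond ?n. priv ?n l c) \<longleftrightarrow>
      (\<exists>y. l y \<and> tri_row y = s \<and> \<bar>y\<bar> \<le> fold_col ?n x)"
    unfolding diamond_fold_col .
  have V: "(x - int ?n, ?Y) \<in> {v \<in> squares ?n. v \<in> toggled l \<longrightarrow> v \<in> squares (?n - 1)} \<longleftrightarrow>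
      - fold_col ?n x - 1 \<le> ?Y \<and> ?Y \<le> fold_col ?n x \<and>
      (even ?Y \<or> \<not> l ?Y \<longrightarrow> - fold_col ?n x \<le> ?Y \<and> ?Y \<le> fold_col ?n x - 1)"
  proof -
    have "(u, y) \<in> toggled l \<longleftrightarrow> even y \<or> \<not> l y" for u y
      unfolding toggled_def by simp
    then show ?thesis
      by (simp only: mem_Collect_eq squares_fold_col diff_Suc_1 conj_assoc)
  qed
  show ?thesis
    unfolding core_def Un_iff 1 P V by blast
qed

text \<open>Of the slots \<open>3 * k\<close> and \<open>3 * k + 1\<close> one carries a main vertex
  and the other a private triangle, depending on \<open>l (2 * k)\<close>; hence the two kinds of
  bounds in exchanged order.\<close>

lemma mem_core_slots:
  "(x, 3 * k) \<in> core l (Suc N) \<longleftrightarrow> (if l (2 * k) then \<bar>2 * k\<bar> \<le> fold_col (Suc N) x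
     else - fold_col (Suc N) x \<le> 2 * k \<and> 2 * k \<le> fold_col (Suc N) x - 1)"
  "(x, 3 * k + 1) \<in> core l (Suc N) \<longleftrightarrow> (if l (2 * k) then - fold_col (Suc N) x \<le> 2 * k \<and> 2 * k \<le> fold_col (Suc N) x - 1
     else \<bar>2 * k + 1\<bar> \<le> fold_col (Suc N) x)"
  "(x, 3 * k + 2) \<in> core l (Suc N) \<longleftrightarrow> (if l (2 * k + 1) then - fold_col (Suc N) x - 1 \<le> 2 * k + 1 \<and> 2 * k + 1 \<le> fold_col (Suc N) x
     else - fold_col (Suc N) x \<le> 2 * k + 1 \<and> 2 * k + 1 \<le> fold_col (Suc N) x - 1)"
proof -
  have d: "2 * (3 * k) div 3 = 2 * k" "2 * (3 * k + 1) div 3 = 2 * k" "2 * (3 * k + 2) div 3 = 2 * k + 1"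
    by presburger+
  have m: "main_row l (2 * k) = 3 * k + of_bool (l (2 * k))" "main_row l (2 * k + 1) = 3 * k + 2"
    by (simp_all add: main_row_def level_even level_odd)
  have l: "l (2 * k + 1) \<longleftrightarrow> \<not> l (2 * k)"
    by (rule alternating_even[OF alt]) simp
  show "(x, 3 * k) \<in> core l (Suc N) \<longleftrightarrow> (if l (2 * k) then \<bar>2 * k\<bar> \<le> fold_col (Suc N) x
     else - fold_col (Suc N) x \<le> 2 * k \<and> 2 * k \<le> fold_col (Suc N) x - 1)"
    unfolding mem_core d m tri_row_iff by auto
  show "(x, 3 * k + 1) \<in> core l (Suc N) \<longleftrightarrow> (if l (2 * k) then - fold_col (Suc N) x \<le> 2 * k \<and> 2 * k \<le> fold_col (Suc N) x - 1
     else \<bar>2 * k + 1\<bar> \<le> fold_col (Suc N) x)"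
    unfolding mem_core d m tri_row_iff using l by auto
  show "(x, 3 * k + 2) \<in> core l (Suc N) \<longleftrightarrow> (if l (2 * k + 1) then - fold_col (Suc N) x - 1 \<le> 2 * k + 1 \<and> 2 * k + 1 \<le> fold_col (Suc N) x
     else - fold_col (Suc N) x \<le> 2 * k + 1 \<and> 2 * k + 1 \<le> fold_col (Suc N) x - 1)"
    unfolding mem_core d m using tri_row_iff(3)[of _ k] by auto
qed

end

section \<open>The recurrence for the numbers of tilings\<close>

text \<open>An alternating function is determined by its value at 0, so there are only two of them:
  this one, and \<open>lightB\<close> with the opposite value there.\<close>

definition lightZ :: "int \<Rightarrow> bool" where
  "lightZ y \<longleftrightarrow> y mod 4 = 1 \<or> y mod 4 = 2"

definition lightB :: "int \<Rightarrow> bool" where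
  "lightB y \<longleftrightarrow> y mod 4 = 3 \<or> y mod 4 = 0"

lemma lightB_iff: "lightB y \<longleftrightarrow> \<not> lightZ y"
  unfolding lightZ_def lightB_def by presburger

lemma lightZ_add2: "lightZ (y + 2) \<longleftrightarrow> \<not> lightZ y"
  unfolding lightZ_def by presburger

lemma alternating_lightZ: "alternating lightZ"
proof -
  have "lightZ (y + 1) \<longleftrightarrow> \<not> lightZ y" if "even y" for y
    using that unfolding lightZ_def by presburger
  moreover have "lightZ (y + 1) \<longleftrightarrow> lightZ y" if "odd y" for y
    using that unfolding lightZ_def by presburger
  ultimately show ?thesis
    by (simp add: alternating_def)
qed

lemma alternating_lightB: "alternating lightB"
  using alternating_lightZ by (simp add: alternating_def lightB_iff)

lemma lightZ_values:
  "\<not> lightZ (2 * (2 * i))" "lightZ (2 * (2 * i) + 1)" "lightZ (2 * (2 * i + 1))" "\<not> lightZ (2 * (2 * i + 1) + 1)"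
  unfolding lightZ_def by presburger+

text \<open>The parity of \<open>k\<close> decides which of the heights \<open>2 * k\<close> and
  \<open>2 * k + 1\<close> is light, and the folded column modulo 4 selects the branch of
  \<open>quarter\<close>; each combination is linear integer arithmetic. The columns are those left
  after the forced tiles of \<open>Z\<close>.\<close>

lemma core_lightZ:
  "core lightZ (Suc N) = columns (\<lambda>x. - quarter 0 1 4 5 x) (quarter 0 3 4 5) (Suc N)"
proof (rule set_eqI)
  fix p :: point
  obtain x s where p: "p = (x, s)" by fastforce
  note slots = mem_core_slots[OF alternating_lightZ]
  have "(x, s) \<in> core lightZ (Suc N) \<longleftrightarrow>
      (x, s) \<in> columns (\<lambda>x. - quarter 0 1 4 5 x) (quarter 0 3 4 5) (Suc N)"
  proof (cases s rule: mod3_cases)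
    case (1 k)
    show ?thesis
      unfolding 1 slots mem_columns
      by (cases k rule: parity_cases; cases "fold_col (Suc N) x" rule: mod4_cases;
          simp only: lightZ_values if_True if_False quarter_simps simp_thms abs_le_iff;
          intro iffI conjI; elim conjE; (linarith | presburger))
  next
    case (2 k)
    show ?thesis
      unfolding 2 slots mem_columns
      by (cases k rule: parity_cases; cases "fold_col (Suc N) x" rule: mod4_cases;
          simp only: lightZ_values if_True if_False quarter_simps simp_thms abs_le_iff;
          intro iffI conjI; elim conjE; (linarith | presburger))
  next
    case (3 k)
    show ?thesis
      unfolding 3 slots mem_columns
      by (cases k rule: parity_cases; cases "fold_col (Suc N) x" rule: mod4_cases;
          simp only: lightZ_values if_True if_False quarter_simps simp_thms abs_le_iff;
          intro iffI conjI; elim conjE; (linarith | presburger))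
  qed
  then show "p \<in> core lightZ (Suc N) \<longleftrightarrow> p \<in> columns (\<lambda>x. - quarter 0 1 4 5 x) (quarter 0 3 4 5) (Suc N)"
    unfolding p .
qed

lemma core_lightB:
  "core lightB (Suc N) = columns (\<lambda>x. - quarter 1 2 3 4 x) (quarter 1 2 3 6) (Suc N)"
proof (rule set_eqI)
  fix p :: point
  obtain x s where p: "p = (x, s)" by fastforce
  note slots = mem_core_slots[OF alternating_lightB]
  have "(x, s) \<in> core lightB (Suc N) \<longleftrightarrow>
      (x, s) \<in> columns (\<lambda>x. - quarter 1 2 3 4 x) (quarter 1 2 3 6) (Suc N)"
  proof (cases s rule: mod3_cases)
    case (1 k)
    show ?thesis
      unfolding 1 slots mem_columns
      by (cases k rule: parity_cases; cases "fold_col (Suc N) x" rule: mod4_cases;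
          simp only: lightB_iff lightZ_values if_True if_False quarter_simps simp_thms abs_le_iff;
          intro iffI conjI; elim conjE; (linarith | presburger))
  next
    case (2 k)
    show ?thesis
      unfolding 2 slots mem_columns
      by (cases k rule: parity_cases; cases "fold_col (Suc N) x" rule: mod4_cases;
          simp only: lightB_iff lightZ_values if_True if_False quarter_simps simp_thms abs_le_iff;
          intro iffI conjI; elim conjE; (linarith | presburger))
  next
    case (3 k)
    show ?thesis
      unfolding 3 slots mem_columns
      by (cases k rule: parity_cases; cases "fold_col (Suc N) x" rule: mod4_cases;
          simp only: lightB_iff lightZ_values if_True if_False quarter_simps simp_thms abs_le_iff;
          intro iffI conjI; elim conjE; (linarith | presburger))
  qed
  then show "p \<in> core lightB (Suc N) \<longleftrightarrow> p \<in> columns (\<lambda>x. - quarter 1 2 3 4 x) (quarter 1 2 3 6) (Suc N)"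
    unfolding p .
qed

definition gZ :: "int \<Rightarrow> real" where
  "gZ y = (if lightZ y then 2 else 1)"

definition gB :: "int \<Rightarrow> real" where
  "gB y = (if lightB y then 2 else 1)"

lemma gZ: "gZ y = 1 \<or> gZ y = 2" "gZ (y + 2) = 2 / gZ y"
  and gB: "gB y = 1 \<or> gB y = 2" "gB (y + 2) = 2 / gB y"
  by (simp_all add: gZ_def gB_def lightB_iff lightZ_add2)

lemma gZ_gB: "(\<lambda>y. 2 / gZ y) = gB" "(\<lambda>y. 2 / gB y) = gZ"
  by (simp_all add: gZ_def gB_def lightB_iff fun_eq_iff)

lemma msum_core_chi:
  assumes l: "alternating l" and g: "\<And>y. g y = (if l y then 2 else 1)"
  shows "msum (core l (Suc N)) dual_edges (\<lambda>_. 1) = chi g (Suc N)"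
proof -
  have "half l = (\<lambda>y. g y / 2)"
    by (simp add: fun_eq_iff half_def g)
  moreover have "(if l y then 1 else 2) = 2 / g y" for y
    by (simp add: g)
  ultimately show ?thesis
    unfolding msum_core[OF l] chi_def by simp
qed

lemma T_Z: "real (T (Z n)) = chi gZ n"
proof (cases n)
  case 0
  then show ?thesis
    by (simp add: Z_def region_def T_empty chi_0[of gZ, OF gZ])
next
  case (Suc N)
  then show ?thesis
    using msum_core_chi[of lightZ gZ N, OF alternating_lightZ gZ_def]
    by (simp only: Z_columns T_cellat msum_Z_columns core_lightZ zero_less_Suc)
qed

lemma T_Zbar: "real (T (Zbar n)) = chi gB n"
proof (cases n)
  case 0
  then show ?thesis
    by (simp add: Zbar_def region_def T_empty chi_0[of gB, OF gB])
next
  case (Suc N)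
  then show ?thesis
    using msum_core_chi[of lightB gB N, OF alternating_lightB gB_def]
    by (simp only: Zbar_columns T_cellat core_lightB zero_less_Suc)
qed

lemma T_Z_step: "T (Z (n + 3)) = 3 ^ (2 * n + 3) * T (Zbar n)"
proof -
  have "real (T (Z (n + 3))) = real (3 ^ (2 * n + 3) * T (Zbar n))"
    using chi_step[of gZ n, OF gZ] unfolding gZ_gB by (simp only: T_Z T_Zbar of_nat_mult of_nat_power of_nat_numeral)
  then show ?thesis
    by (simp only: of_nat_eq_iff)
qed

lemma T_Zbar_step: "T (Zbar (n + 3)) = 3 ^ (2 * n + 3) * T (Z n)"
proof -
  have "real (T (Zbar (n + 3))) = real (3 ^ (2 * n + 3) * T (Z n))"
    using chi_step[of gB n, OF gB] unfolding gZ_gB by (simp only: T_Z T_Zbar of_nat_mult of_nat_power of_nat_numeral)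
  then show ?thesis
    by (simp only: of_nat_eq_iff)
qed

section \<open>Initial values and periodicity of the numbers of tilings\<close>

lemma T_Z_base: "T (Z 0) = 1" "T (Z 1) = 1" "T (Z 2) = 3"
  and T_Zbar_base: "T (Zbar 0) = 1" "T (Zbar 1) = 2" "T (Zbar 2) = 6"
proof -
  have g0: "gZ 0 = 1" "gB 0 = 2"
    by (simp_all add: gZ_def gB_def lightB_iff lightZ_def)
  have "real (T (Z 0)) = real 1" "real (T (Z 1)) = real 1" "real (T (Z 2)) = real 3"
    "real (T (Zbar 0)) = real 1" "real (T (Zbar 1)) = real 2" "real (T (Zbar 2)) = real 6"
    unfolding T_Z T_Zbar using chi_0[of gZ, OF gZ] chi_1[of gZ, OF gZ] chi_2[of gZ, OF gZ]
      chi_0[of gB, OF gB] chi_1[of gB, OF gB] chi_2[of gB, OF gB] by (simp_all add: g0)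
  then show "T (Z 0) = 1" "T (Z 1) = 1" "T (Z 2) = 3"
    "T (Zbar 0) = 1" "T (Zbar 1) = 2" "T (Zbar 2) = 6"
    by (simp_all only: of_nat_eq_iff)
qed

lemmas T_base = T_Z_base T_Zbar_base T_Z_base(2)[unfolded One_nat_def] T_Zbar_base(2)[unfolded One_nat_def]

lemma T_Z_6: "T (Z (n + 6)) = 3 ^ (4 * n + 12) * T (Z n)"
proof -
  have "T (Z (n + 6)) = 3 ^ (2 * (n + 3) + 3) * (3 ^ (2 * n + 3) * T (Z n))"
    using T_Z_step[of "n + 3"] T_Zbar_step[of n] by (simp add: add.assoc)
  also have "\<dots> = 3 ^ (2 * (n + 3) + 3 + (2 * n + 3)) * T (Z n)"
    by (simp only: power_add mult.assoc)
  also have "2 * (n + 3) + 3 + (2 * n + 3) = 4 * n + 12"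
    by simp
  finally show ?thesis .
qed

lemma T_Zbar_6: "T (Zbar (n + 6)) = 3 ^ (4 * n + 12) * T (Zbar n)"
proof -
  have "T (Zbar (n + 6)) = 3 ^ (2 * (n + 3) + 3) * (3 ^ (2 * n + 3) * T (Zbar n))"
    using T_Zbar_step[of "n + 3"] T_Z_step[of n] by (simp add: add.assoc)
  also have "\<dots> = 3 ^ (2 * (n + 3) + 3 + (2 * n + 3)) * T (Zbar n)"
    by (simp only: power_add mult.assoc)
  also have "2 * (n + 3) + 3 + (2 * n + 3) = 4 * n + 12"
    by simp
  finally show ?thesis .
qed

text \<open>Two steps of length 6 from \<open>n = 12 * m + i\<close> add \<open>8 * n + 48\<close>
  to the exponent, which is the increment of \<open>48 * m ^ 2 + 8 * i * m\<close>.\<close>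

lemma T_Z_12: "T (Z (12 * m + i)) = 3 ^ (48 * m ^ 2 + 8 * i * m) * T (Z i)"
proof (induction m)
  case 0
  then show ?case by simp
next
  case (Suc m)
  let ?n = "12 * m + i"
  have "T (Z (12 * Suc m + i)) = T (Z (?n + 6 + 6))"
    by (simp add: algebra_simps)
  also have "\<dots> = 3 ^ (4 * (?n + 6) + 12) * (3 ^ (4 * ?n + 12) * (3 ^ (48 * m ^ 2 + 8 * i * m) * T (Z i)))"
    unfolding T_Z_6 Suc ..
  also have "\<dots> = 3 ^ ((4 * (?n + 6) + 12) + ((4 * ?n + 12) + (48 * m ^ 2 + 8 * i * m))) * T (Z i)"
    by (simp only: power_add mult.assoc)
  also have "(4 * (?n + 6) + 12) + ((4 * ?n + 12) + (48 * m ^ 2 + 8 * i * m)) = 48 * Suc m ^ 2 + 8 * i * Suc m"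
    by (simp add: power2_eq_square algebra_simps)
  finally show ?case .
qed

lemma T_Z_values:
  "T (Z 3) = 3 ^ 3" "T (Z 4) = 2 * 3 ^ 5" "T (Z 5) = 2 * 3 ^ 8" "T (Z 6) = 3 ^ 12" "T (Z 7) = 3 ^ 16"
  "T (Z 8) = 3 ^ 21" "T (Z 9) = 3 ^ 27" "T (Z 10) = 2 * 3 ^ 33" "T (Z 11) = 2 * 3 ^ 40"
proof -
  show 3: "T (Z 3) = 3 ^ 3" and 4: "T (Z 4) = 2 * 3 ^ 5" and 5: "T (Z 5) = 2 * 3 ^ 8"
    using T_Z_step[of 0] T_Z_step[of 1] T_Z_step[of 2] by (simp_all add: T_base)
  show "T (Z 6) = 3 ^ 12" "T (Z 7) = 3 ^ 16" "T (Z 8) = 3 ^ 21"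
    using T_Z_6[of 0] T_Z_6[of 1] T_Z_6[of 2] by (simp_all add: T_base)
  show "T (Z 9) = 3 ^ 27" "T (Z 10) = 2 * 3 ^ 33" "T (Z 11) = 2 * 3 ^ 40"
    using T_Z_6[of 3] T_Z_6[of 4] T_Z_6[of 5] by (simp_all add: 3 4 5)
qed

lemma T_Zbar_values: "T (Zbar 3) = 3 ^ 3" "T (Zbar 4) = 3 ^ 5" "T (Zbar 5) = 3 ^ 8"
  using T_Zbar_step[of 0] T_Zbar_step[of 1] T_Zbar_step[of 2] by (simp_all add: T_base)

lemma T_Zbar_multiple_3: "T (Zbar (3 * m)) = T (Z (3 * m))"
proof (induction m)
  case 0
  then show ?case by (simp add: T_base)
next
  case (Suc m)
  have "3 * Suc m = 3 * m + 3" by simp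
  then show ?case
    using Suc by (simp only: T_Z_step T_Zbar_step)
qed

text \<open>A step of length 6 multiplies both numbers by the same power of 3 and so preserves their
  ratio, whereas a step of length 3 inverts it; this is why 2 at the residues 1 and 2 becomes one
  half at 4 and 5. The factors \<open>a\<close> and \<open>b\<close> express both ratios in natural
  numbers.\<close>

lemma T_Zbar_mod_6:
  assumes "a * T (Zbar i) = b * T (Z i)"
  shows "a * T (Zbar (6 * m + i)) = b * T (Z (6 * m + i))"
proof (induction m)
  case 0
  then show ?case using assms by simp
next
  case (Suc m)
  have "6 * Suc m + i = 6 * m + i + 6" by simp
  then show ?case
    using Suc by (simp only: T_Z_6 T_Zbar_6 mult.left_commute[of a] mult.left_commute[of b])
qed

theorem theorem4p1:
  shows
    "(\<forall>m::nat.
        T (Z (12 * m)) = 3 ^ (48 * m^2) \<and>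
        T (Z (12 * m + 1)) = 3 ^ (48 * m^2 + 8 * m) \<and>
        T (Z (12 * m + 2)) = 3 ^ (48 * m^2 + 16 * m + 1) \<and>
        T (Z (12 * m + 3)) = 3 ^ (48 * m^2 + 24 * m + 3) \<and>
        T (Z (12 * m + 4)) = 2 * 3 ^ (48 * m^2 + 32 * m + 5) \<and>
        T (Z (12 * m + 5)) = 2 * 3 ^ (48 * m^2 + 40 * m + 8) \<and>
        T (Z (12 * m + 6)) = 3 ^ (48 * m^2 + 48 * m + 12) \<and>
        T (Z (12 * m + 7)) = 3 ^ (48 * m^2 + 56 * m + 16) \<and>
        T (Z (12 * m + 8)) = 3 ^ (48 * m^2 + 64 * m + 21) \<and>
        T (Z (12 * m + 9)) = 3 ^ (48 * m^2 + 72 * m + 27) \<and>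
        T (Z (12 * m + 10)) = 2 * 3 ^ (48 * m^2 + 80 * m + 33) \<and>
        T (Z (12 * m + 11)) = 2 * 3 ^ (48 * m^2 + 88 * m + 40)) \<and>
     (\<forall>m::nat.
        T (Zbar (3 * m)) = T (Z (3 * m)) \<and>
        T (Zbar (6 * m + 1)) = 2 * T (Z (6 * m + 1)) \<and>
        T (Zbar (6 * m + 2)) = 2 * T (Z (6 * m + 2)) \<and>
        real (T (Zbar (6 * m + 4))) = 1 / 2 * real (T (Z (6 * m + 4))) \<and>
        real (T (Zbar (6 * m + 5))) = 1 / 2 * real (T (Z (6 * m + 5))))"
proof (rule conjI; rule allI)
  fix m :: nat
  have Z: "T (Z (12 * m + i)) = c * 3 ^ (48 * m ^ 2 + 8 * i * m + k)" if "T (Z i) = c * 3 ^ k" for i c k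
    unfolding T_Z_12 that power_add by (simp only: mult_ac)
  show "T (Z (12 * m)) = 3 ^ (48 * m^2) \<and>
        T (Z (12 * m + 1)) = 3 ^ (48 * m^2 + 8 * m) \<and>
        T (Z (12 * m + 2)) = 3 ^ (48 * m^2 + 16 * m + 1) \<and>
        T (Z (12 * m + 3)) = 3 ^ (48 * m^2 + 24 * m + 3) \<and>
        T (Z (12 * m + 4)) = 2 * 3 ^ (48 * m^2 + 32 * m + 5) \<and>
        T (Z (12 * m + 5)) = 2 * 3 ^ (48 * m^2 + 40 * m + 8) \<and>
        T (Z (12 * m + 6)) = 3 ^ (48 * m^2 + 48 * m + 12) \<and>
        T (Z (12 * m + 7)) = 3 ^ (48 * m^2 + 56 * m + 16) \<and>
        T (Z (12 * m + 8)) = 3 ^ (48 * m^2 + 64 * m + 21) \<and>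
        T (Z (12 * m + 9)) = 3 ^ (48 * m^2 + 72 * m + 27) \<and>
        T (Z (12 * m + 10)) = 2 * 3 ^ (48 * m^2 + 80 * m + 33) \<and>
        T (Z (12 * m + 11)) = 2 * 3 ^ (48 * m^2 + 88 * m + 40)"
    using Z[of 0 1 0] Z[of 1 1 0] Z[of 2 1 1] Z[of 3 1 3] Z[of 4 2 5] Z[of 5 2 8] Z[of 6 1 12]
      Z[of 7 1 16] Z[of 8 1 21] Z[of 9 1 27] Z[of 10 2 33] Z[of 11 2 40] T_Z_base T_Z_values
    by simp
next
  fix m :: nat
  have half: "real a = 1 / 2 * real b" if "2 * a = 1 * b" for a b
    using that by linarith
  show "T (Zbar (3 * m)) = T (Z (3 * m)) \<and>
        T (Zbar (6 * m + 1)) = 2 * T (Z (6 * m + 1)) \<and>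
        T (Zbar (6 * m + 2)) = 2 * T (Z (6 * m + 2)) \<and>
        real (T (Zbar (6 * m + 4))) = 1 / 2 * real (T (Z (6 * m + 4))) \<and>
        real (T (Zbar (6 * m + 5))) = 1 / 2 * real (T (Z (6 * m + 5)))"
  proof (intro conjI)
    show "T (Zbar (3 * m)) = T (Z (3 * m))"
      by (rule T_Zbar_multiple_3)
    show "T (Zbar (6 * m + 1)) = 2 * T (Z (6 * m + 1))" "T (Zbar (6 * m + 2)) = 2 * T (Z (6 * m + 2))"
      using T_Zbar_mod_6[of 1 1 2 m] T_Zbar_mod_6[of 1 2 2 m] by (simp_all add: T_base)
    show "real (T (Zbar (6 * m + 4))) = 1 / 2 * real (T (Z (6 * m + 4)))"
      by (rule half, rule T_Zbar_mod_6) (simp add: T_Z_values T_Zbar_values)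
    show "real (T (Zbar (6 * m + 5))) = 1 / 2 * real (T (Z (6 * m + 5)))"
      by (rule half, rule T_Zbar_mod_6) (simp add: T_Z_values T_Zbar_values)
  qed
qed

end
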